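(* In four-dimensional topological Yang-Mills theory quantized in the (anti-)self-dual Landau gauges, i.e. the perturbative quantum field theory with full action $S=S_0+S_{gf}$ given in the context, all connected $n$-point Green functions $\langle\Phi_{i_1}(x_1)\cdots\Phi_{i_n}(x_n)\rangle$, with $\Phi_{i_k}\in\{A,\psi,\bar\chi,c,\bar c,\phi,\bar\phi,\bar\eta,B,b\}$, are tree-level exact, i.e. they receive no radiative corrections.
   Context: **Setting.** Flat Euclidean spacetime $\mathbb{R}^4$; $G$ is a semi-simple Lie group with structure constants $f^{abc}$; $g$ is the coupling parameter. All fields take values in the Lie algebra of $G$ (index $a$). Fields: the gauge field $A^a_\mu$, topological ghost $\psi^a_\mu$, Faddeev-Popov ghost $c^a$, bosonic ghost $\phi^a$; anti-ghosts $\bar c^a$, $\bar\chi^a_{\mu\nu}$, $\bar\phi^a$; Lautrup-Nakanishi fields $b^a$, $B^a_{\mu\nu}$, $\bar\eta^a$. Ghost numbers of $A,\psi,c,\phi,\bar c,b,\bar\phi,\bar\eta,\bar\chi,B$ are $0,1,1,2,-1,0,-2,-1,-1,0$ respectively (odd ghost number means anticommuting). Put $$F^a_{\mu\nu}=\partial_\mu A^a_\nu-\partial_\nu A^a_\mu+g f^{abc}A^b_\mu A^c_\nu,\quad \widetilde F^a_{\mu\nu}=\tfrac12\epsilon_{\mu\nu\alpha\beta}F^a_{\alpha\beta},\quad D^{ab}_\mu=\delta^{ab}\partial_\mu-g f^{abc}A^c_\mu .$$ A sign $\pm$ is fixed once and for all; $\bar\chi$ and $B$ are self-dual (sign $+$)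 or anti-self-dual (sign $-$) antisymmetric tensors. The (anti-)self-dual Landau gauges are the conditions $\partial_\mu A^a_\mu=0$, $F^a_{\mu\nu}\pm\widetilde F^a_{\mu\nu}=0$, $\partial_\mu\psi^a_\mu=0$. **BRST operator.** $s$ is the nilpotent BRST operator (raising ghost number by one, acting by the graded Leibniz rule) with $$sA^a_\mu=-D^{ab}_\mu c^b+\psi^a_\mu,\quad sc^a=\tfrac g2f^{abc}c^bc^c+\phi^a,\quad s\psi^a_\mu=gf^{abc}c^b\psi^c_\mu+D^{ab}_\mu\phi^b,\quad s\phi^a=gf^{abc}c^b\phi^c,$$ $$s\bar c^a=b^a,\ sb^a=0,\qquad s\bar\chi^a_{\mu\nu}=B^a_{\mu\nu},\ sB^a_{\mu\nu}=0,\qquad s\bar\phi^a=\bar\eta^a,\ s\bar\eta^a=0 .$$ **Action.** $S=S_0[A]+S_{gf}$, where $S_0[A]$ is a topological invariant and $$S_{gf}=s\int d^4z\Big[\bar c^a\partial_\mu A^a_\mu+\tfrac12\bar\chi^a_{\mu\nu}(F^a_{\mu\nu}\pm\widetilde F^a_{\mu\nu})+\bar\phi^a\partial_\mu\psi^a_\mu\Big]$$ $$=\int d^4z\Big[b^a\partial_\mu A^a_\mu+\tfrac12B^a_{\mu\nu}(F^a_{\mu\nu}\pm\widetilde F^a_{\mu\nu})+(\bar\eta^a-\bar c^a)\partial_\mu\psi^a_\mu+\bar c^a\partial_\mu D^{ab}_\mu c^b-\tfrac12 g f^{abc}\bar\chi^a_{\mu\nu}c^b(F^c_{\mu\nu}\pm\widetilde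 F^c_{\mu\nu})$$ $$-\bar\chi^a_{\mu\nu}\big(\delta_{\mu\alpha}\delta_{\nu\beta}\pm\tfrac12\epsilon_{\mu\nu\alpha\beta}\big)D^{ab}_\alpha\psi^b_\beta+\bar\phi^a\partial_\mu D^{ab}_\mu\phi^b+g f^{abc}\bar\phi^a\partial_\mu(c^b\psi^c_\mu)\Big].$$ For the perturbative expansion, the term $-\bar c^a\partial_\mu\psi^a_\mu$ is removed by the trivial-Jacobian redefinition $\bar\eta\to\bar\eta+\bar c$. The quantum theory is BRST invariant, so that, as is standard for BRST quantization, expectation values of BRST-exact quantities vanish: $\langle s(\cdots)\rangle=0$. **Feynman rules.** The relevant propagators are $\langle AA\rangle$, $\langle AB\rangle$, $\langle Ab\rangle$, $\langle c\bar c\rangle$, $\langle\bar\chi\psi\rangle$, $\langle\bar\eta\psi\rangle$, $\langle\phi\bar\phi\rangle$, where it is a known property of this gauge that $\langle A^a_\mu A^b_\nu\rangle(p)=0$ to all orders of perturbation theory. The relevant interaction vertices are $BAA$, $\bar\chi cA$, $\bar\chi A\psi$, $\bar cAc$, $\bar\phi A\phi$, $\bar\phi c\psi$, $\bar\chi cAA$; in particular no vertex contains $b$ or $\bar\eta$. **Terminology.** A connected Green function is tree-level exact if it equals the sum of its connected tree diagrams, i.e. the total contribution of connected diagrams with at least one loop (the radiative corrections) is zero to all orders of perturbation theory. *)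

theory Defs
  imports "HOL-Analysis.Analysis" "HOL-Library.Poly_Mapping"
begin

section \<open>Differential polynomials in graded fields\<close>

text \<open>
  A letter \<open>(x, [\<mu>\<^sub>1, \<dots>, \<mu>\<^sub>m])\<close> stands for \<open>\<partial>\<^sub>\<mu>\<^sub>1 \<dots> \<partial>\<^sub>\<mu>\<^sub>m x(z)\<close>, where \<open>x\<close> is a field component and
  the directions range over the four coordinates of Euclidean space-time.  Local densities are
  elements of the free associative algebra on the letters; graded commutativity, and the freedom
  of integrating by parts, come in when the coefficients of a density are symmetrised in
  \<open>vertex\<close> below.  Throughout, \<open>gr x\<close> says that the field \<open>x\<close> is anticommuting.
\<close>

type_synonym momentum = "real^4"

datatype 'k fword = FWord "('k \<times> 4 list) list"

primrec letters :: "'k fword \<Rightarrow> ('k \<times> 4 list) list" where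
  "letters (FWord ls) = ls"

instantiation fword :: (type) monoid_add
begin
definition zero_fword :: "'a fword" where "zero_fword = FWord []"
definition plus_fword :: "'a fword \<Rightarrow> 'a fword \<Rightarrow> 'a fword" where
  "plus_fword v w = FWord (letters v @ letters w)"
instance
proof
  fix u v w :: "'a fword"
  show "u + v + w = u + (v + w)" by (simp add: plus_fword_def)
  show "0 + u = u" by (cases u) (simp add: plus_fword_def zero_fword_def)
  show "u + 0 = u" by (cases u) (simp add: plus_fword_def zero_fword_def)
qed
end

type_synonym 'k dpoly = "'k fword \<Rightarrow>\<^sub>0 complex"

definition cst :: "complex \<Rightarrow> 'k dpoly" where
  "cst c = Poly_Mapping.single 0 c"

definition letter :: "'k \<times> 4 list \<Rightarrow> 'k dpoly" where
  "letter l = Poly_Mapping.single (FWord [l]) 1"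

definition var :: "'k \<Rightarrow> 'k dpoly" where
  "var x = letter (x, [])"

definition lin_ext :: "(('k \<times> 4 list) list \<Rightarrow> 'l dpoly) \<Rightarrow> 'k dpoly \<Rightarrow> 'l dpoly" where
  "lin_ext F P = (\<Sum>w\<in>Poly_Mapping.keys P. cst (Poly_Mapping.lookup P w) * F (letters w))"

primrec deriv_letters :: "4 \<Rightarrow> ('k \<times> 4 list) list \<Rightarrow> 'k dpoly" where
  "deriv_letters \<mu> [] = 0"
| "deriv_letters \<mu> (l # ls) =
     letter (fst l, \<mu> # snd l) * Poly_Mapping.single (FWord ls) 1 + letter l * deriv_letters \<mu> ls"

definition pd :: "4 \<Rightarrow> 'k dpoly \<Rightarrow> 'k dpoly" where
  "pd \<mu> = lin_ext (deriv_letters \<mu>)"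

text \<open>
  The odd derivation (acting from the left) that commutes with the \<open>\<partial>\<^sub>\<mu>\<close> and has given values
  on the undifferentiated field components.
\<close>

primrec odd_derivation_letters ::
    "('k \<Rightarrow> bool) \<Rightarrow> ('k \<Rightarrow> 'k dpoly) \<Rightarrow> ('k \<times> 4 list) list \<Rightarrow> 'k dpoly" where
  "odd_derivation_letters gr s [] = 0"
| "odd_derivation_letters gr s (l # ls) =
     foldr pd (snd l) (s (fst l)) * Poly_Mapping.single (FWord ls) 1
     + cst (if gr (fst l) then -1 else 1) * letter l * odd_derivation_letters gr s ls"

definition odd_derivation ::
    "('k \<Rightarrow> bool) \<Rightarrow> ('k \<Rightarrow> 'k dpoly) \<Rightarrow> 'k dpoly \<Rightarrow> 'k dpoly" where
  "odd_derivation gr s = lin_ext (odd_derivation_letters gr s)"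

definition substitute :: "('k \<Rightarrow> 'k dpoly) \<Rightarrow> 'k dpoly \<Rightarrow> 'k dpoly" where
  "substitute h = lin_ext (\<lambda>ls. prod_list (map (\<lambda>l. foldr pd (snd l) (h (fst l))) ls))"

section \<open>Feynman rules of a local action\<close>

text \<open>
  Fields are expanded as \<open>x(z) = \<integral> exp(i k\<cdot>z) x(k) dk\<close>.  For \<open>S = \<integral> P\<close> the number
  \<open>vertex gr P [J\<^sub>1,\<dots>,J\<^sub>n] [k\<^sub>1,\<dots>,k\<^sub>n]\<close> is the graded symmetric coefficient \<open>V\<close> in the degree \<open>n\<close> part
  \<open>(1/n!) \<Sum> \<integral> \<delta>(k\<^sub>1+\<dots>+k\<^sub>n) V J\<^sub>1(k\<^sub>1) \<dots> J\<^sub>n(k\<^sub>n)\<close> of \<open>S\<close>, that is, the \<open>n\<close>-th functional derivative of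
  \<open>S\<close> at the zero field.  Here \<open>\<pi> r\<close> is the place, among the \<open>n\<close> slots, of the \<open>r\<close>-th letter of the
  word, and the sign is that of rearranging the anticommuting letters.
\<close>

definition reorder_sign :: "('k \<Rightarrow> bool) \<Rightarrow> 'k list \<Rightarrow> (nat \<Rightarrow> nat) \<Rightarrow> complex" where
  "reorder_sign gr Js \<pi> =
     (-1) ^ card {(r, s). r < s \<and> s < length Js \<and> \<pi> s < \<pi> r \<and> gr (Js ! \<pi> r) \<and> gr (Js ! \<pi> s)}"

definition derivative_factor :: "4 list \<Rightarrow> momentum \<Rightarrow> complex" where
  "derivative_factor ds k = prod_list (map (\<lambda>\<mu>. \<i> * complex_of_real (k $ \<mu>)) ds)"

definition word_vertex ::
    "('k \<Rightarrow> bool) \<Rightarrow> ('k \<times> 4 list) list \<Rightarrow> 'k list \<Rightarrow> momentum list \<Rightarrow> complex" where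
  "word_vertex gr ls Js ks =
     (if length ls = length Js then
        (\<Sum>\<pi> | \<pi> permutes {..<length Js}. reorder_sign gr Js \<pi> *
           (\<Prod>r<length Js. if fst (ls ! r) = Js ! \<pi> r
                          then derivative_factor (snd (ls ! r)) (ks ! \<pi> r) else 0))
      else 0)"

definition vertex ::
    "('k \<Rightarrow> bool) \<Rightarrow> 'k dpoly \<Rightarrow> 'k list \<Rightarrow> momentum list \<Rightarrow> complex" where
  "vertex gr P Js ks =
     (\<Sum>w\<in>Poly_Mapping.keys P. Poly_Mapping.lookup P w * word_vertex gr (letters w) Js ks)"

text \<open>
  The weight is \<open>exp (- S)\<close> and the quadratic part of \<open>S\<close> is
  \<open>(1/2) \<Sum> \<integral> x(-k) (kernel k)\<^sub>x\<^sub>y y(k)\<close>, so that \<open>\<langle>x(k) y(-k)\<rangle>\<close> is the \<open>(x, y)\<close> entry of the inverse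
  kernel, for commuting as well as for anticommuting fields.  At momenta where the kernel is
  singular (\<open>k = 0\<close>, for massless fields) the propagator is set to zero.
\<close>

definition kernel ::
    "('k::finite \<Rightarrow> bool) \<Rightarrow> 'k dpoly \<Rightarrow> momentum \<Rightarrow> complex^'k^'k" where
  "kernel gr S k = (\<chi> x y. vertex gr S [x, y] [- k, k])"

definition propagator ::
    "('k::finite \<Rightarrow> bool) \<Rightarrow> 'k dpoly \<Rightarrow> momentum \<Rightarrow> complex^'k^'k" where
  "propagator gr S k =
     (if invertible (kernel gr S k) then matrix_inv (kernel gr S k) else 0)"

section \<open>Feynman diagrams\<close>

text \<open>
  A topology consists of the list of the valences of its nodes and of a pairing of the half-edges
  \<open>(v, r)\<close>, where \<open>r\<close> is less than the valence of the node \<open>v\<close>.  The first \<open>n\<close> nodes are the external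
  fields (valence 1), the others are interaction vertices.
\<close>

type_synonym half_edge = "nat \<times> nat"
type_synonym pairing = "half_edge \<Rightarrow> half_edge"

definition half_edges :: "nat list \<Rightarrow> half_edge set" where
  "half_edges val = {(v, r). v < length val \<and> r < val ! v}"

definition is_pairing :: "nat list \<Rightarrow> pairing \<Rightarrow> bool" where
  "is_pairing val m \<longleftrightarrow> m permutes half_edges val \<and>
     (\<forall>h\<in>half_edges val. m h \<noteq> h \<and> m (m h) = h)"

definition connected_topology :: "nat list \<Rightarrow> pairing \<Rightarrow> bool" where
  "connected_topology val m \<longleftrightarrow> val \<noteq> [] \<and>
     (\<forall>u<length val. \<forall>v<length val.
        (u, v) \<in> {(fst h, fst (m h)) | h. h \<in> half_edges val}\<^sup>*)"

text \<open>First Betti number of a connected topology: edges minus nodes plus one.\<close>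

definition loops :: "nat list \<Rightarrow> nat" where
  "loops val = card (half_edges val) div 2 + 1 - length val"

definition hless :: "half_edge \<Rightarrow> half_edge \<Rightarrow> bool" where
  "hless h h' \<longleftrightarrow> fst h < fst h' \<or> fst h = fst h' \<and> snd h < snd h'"

definition wick_sign ::
    "('k \<Rightarrow> bool) \<Rightarrow> nat list \<Rightarrow> pairing \<Rightarrow> (half_edge \<Rightarrow> 'k) \<Rightarrow> complex" where
  "wick_sign gr val m lab =
     (-1) ^ card {(h, h'). h \<in> half_edges val \<and> h' \<in> half_edges val \<and> gr (lab h) \<and> gr (lab h') \<and>
                    hless h h' \<and> hless h' (m h) \<and> hless (m h) (m h')}"

text \<open>
  The Feynman integrand for a given labelling of the half-edges by field components and a given
  assignment of momenta to the half-edges; the factors \<open>1/n!\<close> belong to labelled legs.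
\<close>

definition integrand ::
    "('k::finite \<Rightarrow> bool) \<Rightarrow> 'k dpoly \<Rightarrow> nat \<Rightarrow> nat list \<Rightarrow> pairing \<Rightarrow>
     (half_edge \<Rightarrow> 'k) \<Rightarrow> (half_edge \<Rightarrow> momentum) \<Rightarrow> complex" where
  "integrand gr S n val m lab k =
     wick_sign gr val m lab *
     (\<Prod>v\<in>{n..<length val}.
        - vertex gr S (map (\<lambda>r. lab (v, r)) [0..<val ! v]) (map (\<lambda>r. k (v, r)) [0..<val ! v])
          / of_nat (fact (val ! v))) *
     (\<Prod>h\<in>{h \<in> half_edges val. hless h (m h)}. propagator gr S (k h) $ lab h $ lab (m h))"

definition labellings :: "'k list \<Rightarrow> nat list \<Rightarrow> (half_edge \<Rightarrow> 'k) set" where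
  "labellings xs val =
     {lab \<in> half_edges val \<rightarrow>\<^sub>E UNIV. \<forall>i<length xs. lab (i, 0) = xs ! i}"

text \<open>
  Momentum configurations: external momenta \<open>ps\<close> are prescribed, and momentum is conserved along
  every edge and at every interaction vertex.
\<close>

definition momenta ::
    "momentum list \<Rightarrow> nat list \<Rightarrow> pairing \<Rightarrow> (half_edge \<Rightarrow> momentum) set" where
  "momenta ps val m =
     {k. (\<forall>h. h \<notin> half_edges val \<longrightarrow> k h = 0) \<and>
         (\<forall>i<length ps. k (i, 0) = ps ! i) \<and>
         (\<forall>h\<in>half_edges val. k (m h) = - k h) \<and>
         (\<forall>v\<in>{length ps..<length val}. (\<Sum>r<val ! v. k (v, r)) = 0)}"

text \<open>
  A (regularised) loop integration: for each topology, a linear functional of the integrand, as a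
  function on the momentum configurations, which is the integral \<open>\<integral> \<Prod> d\<^sup>4q/(2\<pi>)\<^sup>4\<close> over independent
  loop momenta whenever that integral converges absolutely.  In particular, the value of a
  connected tree diagram is the integrand at the unique momentum configuration (the overall
  momentum-conserving delta function being stripped off, and the value being zero if the external
  momenta do not add up to zero).  The functional does not depend on which fields run along the
  lines.
\<close>

type_synonym integration =
  "momentum list \<Rightarrow> nat list \<Rightarrow> pairing \<Rightarrow> ((half_edge \<Rightarrow> momentum) \<Rightarrow> complex) \<Rightarrow> complex"

definition loop_momenta ::
    "nat \<Rightarrow> (nat \<Rightarrow> half_edge) \<Rightarrow> (half_edge \<Rightarrow> momentum) \<Rightarrow> nat \<Rightarrow> momentum" where
  "loop_momenta L hs k = restrict (\<lambda>i. k (hs i)) {..<L}"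

definition loop_integration :: "integration \<Rightarrow> bool" where
  "loop_integration I \<longleftrightarrow>
     (\<forall>ps val m. is_pairing val m \<and> length ps \<le> length val \<and> (\<forall>i<length ps. val ! i = 1) \<longrightarrow>
        (\<forall>F G. I ps val m (\<lambda>k. F k + G k) = I ps val m F + I ps val m G) \<and>
        (\<forall>c F. I ps val m (\<lambda>k. c * F k) = c * I ps val m F) \<and>
        (\<forall>F G. (\<forall>k\<in>momenta ps val m. F k = G k) \<longrightarrow> I ps val m F = I ps val m G) \<and>
        (\<forall>L hs F.
           bij_betw (loop_momenta L hs) (momenta ps val m) ({..<L} \<rightarrow>\<^sub>E UNIV) \<and>
           integrable (\<Pi>\<^sub>M i\<in>{..<L}. lborel)
             (\<lambda>q. F (inv_into (momenta ps val m) (loop_momenta L hs) q)) \<longrightarrow>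
           I ps val m F =
             (\<integral>q. F (inv_into (momenta ps val m) (loop_momenta L hs) q) \<partial>(\<Pi>\<^sub>M i\<in>{..<L}. lborel))
               / of_real ((2 * pi) ^ (4 * L))))"

section \<open>Connected Green functions\<close>

text \<open>
  External fields are given as pairs of a component and the momentum it carries.  \<open>topologies\<close> are
  those of order \<open>N\<close> in the interaction; \<open>diagram_sum\<close> is the order \<open>N\<close> contribution, from
  \<open>exp (- S\<^sub>i\<^sub>n\<^sub>t)\<close>, of the connected diagrams whose number of loops lies in a given set.
\<close>

definition topologies :: "'k dpoly \<Rightarrow> nat \<Rightarrow> nat \<Rightarrow> (nat list \<times> pairing) set" where
  "topologies S n N =
     {(replicate n 1 @ vs, m) | vs m.
        length vs = N \<and>
        set vs \<subseteq> {length (letters w) | w. w \<in> Poly_Mapping.keys S \<and> 3 \<le> length (letters w)} \<and>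
        is_pairing (replicate n 1 @ vs) m}"

definition diagram_sum ::
    "('k::finite \<Rightarrow> bool) \<Rightarrow> 'k dpoly \<Rightarrow> integration \<Rightarrow> nat set \<Rightarrow>
     ('k \<times> momentum) list \<Rightarrow> nat \<Rightarrow> complex" where
  "diagram_sum gr S I Ls es N =
     (\<Sum>(val, m) \<in> {(val, m) \<in> topologies S (length es) N.
                      connected_topology val m \<and> loops val \<in> Ls}.
        \<Sum>lab\<in>labellings (map fst es) val.
          I (map snd es) val m (integrand gr S (length es) val m lab)) / of_nat (fact N)"

definition connected_green ::
    "('k::finite \<Rightarrow> bool) \<Rightarrow> 'k dpoly \<Rightarrow> integration \<Rightarrow> ('k \<times> momentum) list \<Rightarrow> nat \<Rightarrow> complex" where
  "connected_green gr S I = diagram_sum gr S I UNIV"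

definition tree_green ::
    "('k::finite \<Rightarrow> bool) \<Rightarrow> 'k dpoly \<Rightarrow> integration \<Rightarrow> ('k \<times> momentum) list \<Rightarrow> nat \<Rightarrow> complex" where
  "tree_green gr S I = diagram_sum gr S I {0}"

definition radiative_corrections ::
    "('k::finite \<Rightarrow> bool) \<Rightarrow> 'k dpoly \<Rightarrow> integration \<Rightarrow> ('k \<times> momentum) list \<Rightarrow> nat \<Rightarrow> complex" where
  "radiative_corrections gr S I = diagram_sum gr S I {1..}"

definition tree_level_exact ::
    "('k::finite \<Rightarrow> bool) \<Rightarrow> 'k dpoly \<Rightarrow> integration \<Rightarrow> ('k \<times> momentum) list \<Rightarrow> bool" where
  "tree_level_exact gr S I es \<longleftrightarrow>
     (\<forall>N. connected_green gr S I es N = tree_green gr S I es N \<and>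
          radiative_corrections gr S I es N = 0)"

section \<open>Topological Yang-Mills theory in the (anti-)self-dual Landau gauges\<close>

text \<open>
  The bracket is \<open>[X, Y]\<^sup>a = f\<^sup>a\<^sup>b\<^sup>c X\<^sup>b Y\<^sup>c\<close>.  No choice of an orthonormal basis is made, so \<open>f\<close> is
  antisymmetric only in its last two indices; a sum over a repeated index then pairs the Lie
  algebra with its dual.
\<close>

definition lie_bracket :: "('a::finite \<Rightarrow> 'a \<Rightarrow> 'a \<Rightarrow> real) \<Rightarrow> real^'a \<Rightarrow> real^'a \<Rightarrow> real^'a" where
  "lie_bracket f X Y = (\<chi> a. \<Sum>b\<in>UNIV. \<Sum>c\<in>UNIV. f a b c * X $ b * Y $ c)"

definition semisimple_lie_algebra :: "('a::finite \<Rightarrow> 'a \<Rightarrow> 'a \<Rightarrow> real) \<Rightarrow> bool" where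
  "semisimple_lie_algebra f \<longleftrightarrow>
     (\<forall>a b c. f a b c = - f a c b) \<and>
     (\<forall>X Y Z. lie_bracket f X (lie_bracket f Y Z) + lie_bracket f Y (lie_bracket f Z X)
              + lie_bracket f Z (lie_bracket f X Y) = 0) \<and>
     (\<forall>\<a>. subspace \<a> \<and> (\<forall>X. \<forall>Y\<in>\<a>. lie_bracket f X Y \<in> \<a>) \<and>
           (\<forall>X\<in>\<a>. \<forall>Y\<in>\<a>. lie_bracket f X Y = 0) \<longrightarrow> \<a> = {0})"

definition levi_civita :: "4 \<Rightarrow> 4 \<Rightarrow> 4 \<Rightarrow> 4 \<Rightarrow> real" where
  "levi_civita \<mu> \<nu> \<alpha> \<beta> =
     (let o2 = (\<lambda>(x::4) y. if x < y then 1 else if y < x then -1 else 0)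
      in o2 \<mu> \<nu> * o2 \<mu> \<alpha> * o2 \<mu> \<beta> * o2 \<nu> \<alpha> * o2 \<nu> \<beta> * o2 \<alpha> \<beta>)"

definition hodge_dual :: "(4 \<Rightarrow> 4 \<Rightarrow> real) \<Rightarrow> 4 \<Rightarrow> 4 \<Rightarrow> real" where
  "hodge_dual T \<mu> \<nu> = (\<Sum>\<alpha>\<in>UNIV. \<Sum>\<beta>\<in>UNIV. levi_civita \<mu> \<nu> \<alpha> \<beta> * T \<alpha> \<beta>) / 2"

text \<open>
  \<open>T\<close> is self-dual (\<open>\<sigma> = 1\<close>) or anti-self-dual (\<open>\<sigma> = -1\<close>) antisymmetric.  The four coordinates are
  \<open>0, 1, 2, 3\<close>, and such a tensor is determined by its components \<open>T\<^sub>0\<^sub>i\<close>; this is why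
  \<open>\<chi>\<close>-bar and \<open>B\<close> have three components per Lie algebra index.
\<close>

definition sd_antisym :: "real \<Rightarrow> (4 \<Rightarrow> 4 \<Rightarrow> real) \<Rightarrow> bool" where
  "sd_antisym \<sigma> T \<longleftrightarrow> (\<forall>\<mu> \<nu>. T \<mu> \<nu> = - T \<nu> \<mu>) \<and> (\<forall>\<mu> \<nu>. T \<mu> \<nu> = \<sigma> * hodge_dual T \<mu> \<nu>)"

definition spatial :: "3 \<Rightarrow> 4" where
  "spatial i = (if i = 0 then 1 else if i = 1 then 2 else 3)"

definition sd_basis :: "real \<Rightarrow> 3 \<Rightarrow> 4 \<Rightarrow> 4 \<Rightarrow> real" where
  "sd_basis \<sigma> i \<mu> \<nu> =
     (if \<mu> = 0 \<and> \<nu> = spatial i then 1 else if \<mu> = spatial i \<and> \<nu> = 0 then -1 else 0)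
     + \<sigma> * levi_civita \<mu> \<nu> 0 (spatial i)"

lemma less_4_simps:
    "(0::4) < 1" "(1::4) < 2" "(2::4) < 3" "(0::4) < 2" "(0::4) < 3" "(1::4) < 3"
  unfolding less_bit0_def bit0.Rep_0 bit0.Rep_1 bit0.Rep_numeral by simp_all

lemma forall_index4: "(\<forall>x::4. P x) \<longleftrightarrow> P 0 \<and> P 1 \<and> P 2 \<and> P 3"
proof -
  have "(4::4) = 0" by simp
  then show ?thesis by (metis exhaust_4)
qed

lemma sum_index4: "sum h (UNIV::4 set) = h 0 + h 1 + h 2 + (h 3 :: real)"
proof -
  have "h 4 = h 0" by (rule arg_cong[where f = h]) simp
  then show ?thesis by (simp add: sum_4)
qed

lemma sum_index3: "sum h (UNIV::3 set) = h 0 + h 1 + (h 2 :: real)"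
proof -
  have "h 3 = h 0" by (rule arg_cong[where f = h]) simp
  then show ?thesis by (simp add: sum_3)
qed

lemma levi_civita_degenerate: "levi_civita \<mu> \<mu> \<alpha> \<beta> = 0" "levi_civita \<mu> \<nu> \<mu> \<beta> = 0"
    "levi_civita \<mu> \<nu> \<alpha> \<mu> = 0" "levi_civita \<mu> \<nu> \<nu> \<beta> = 0" "levi_civita \<mu> \<nu> \<alpha> \<nu> = 0"
    "levi_civita \<mu> \<nu> \<alpha> \<alpha> = 0"
  by (simp_all add: levi_civita_def)

lemma levi_civita_permutation:
    "levi_civita 0 1 2 3 = 1"
    "levi_civita 0 1 3 2 = -1"
    "levi_civita 0 2 1 3 = -1"
    "levi_civita 0 2 3 1 = 1"
    "levi_civita 0 3 1 2 = 1"
    "levi_civita 0 3 2 1 = -1"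
    "levi_civita 1 0 2 3 = -1"
    "levi_civita 1 0 3 2 = 1"
    "levi_civita 1 2 0 3 = 1"
    "levi_civita 1 2 3 0 = -1"
    "levi_civita 1 3 0 2 = -1"
    "levi_civita 1 3 2 0 = 1"
    "levi_civita 2 0 1 3 = 1"
    "levi_civita 2 0 3 1 = -1"
    "levi_civita 2 1 0 3 = -1"
    "levi_civita 2 1 3 0 = 1"
    "levi_civita 2 3 0 1 = 1"
    "levi_civita 2 3 1 0 = -1"
    "levi_civita 3 0 1 2 = -1"
    "levi_civita 3 0 2 1 = 1"
    "levi_civita 3 1 0 2 = 1"
    "levi_civita 3 1 2 0 = -1"
    "levi_civita 3 2 0 1 = -1"
    "levi_civita 3 2 1 0 = 1"
  by (simp_all add: levi_civita_def less_4_simps less_4_simps[THEN less_imp_not_less])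

lemma hodge_dual_components:
    "hodge_dual T 0 0 = 0"
    "hodge_dual T 0 1 = (T 2 3 - T 3 2) / 2"
    "hodge_dual T 0 2 = (T 3 1 - T 1 3) / 2"
    "hodge_dual T 0 3 = (T 1 2 - T 2 1) / 2"
    "hodge_dual T 1 0 = (T 3 2 - T 2 3) / 2"
    "hodge_dual T 1 1 = 0"
    "hodge_dual T 1 2 = (T 0 3 - T 3 0) / 2"
    "hodge_dual T 1 3 = (T 2 0 - T 0 2) / 2"
    "hodge_dual T 2 0 = (T 1 3 - T 3 1) / 2"
    "hodge_dual T 2 1 = (T 3 0 - T 0 3) / 2"
    "hodge_dual T 2 2 = 0"
    "hodge_dual T 2 3 = (T 0 1 - T 1 0) / 2"
    "hodge_dual T 3 0 = (T 2 1 - T 1 2) / 2"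
    "hodge_dual T 3 1 = (T 0 2 - T 2 0) / 2"
    "hodge_dual T 3 2 = (T 1 0 - T 0 1) / 2"
    "hodge_dual T 3 3 = 0"
  by (simp_all add: hodge_dual_def sum_index4 levi_civita_degenerate levi_civita_permutation)

lemma sd_antisym_components:
  assumes "\<sigma> = 1 \<or> \<sigma> = -1"
  shows "sd_antisym \<sigma> T \<longleftrightarrow> T = (\<lambda>\<mu> \<nu>. \<Sum>i\<in>UNIV. sd_basis \<sigma> i \<mu> \<nu> * T 0 (spatial i))"
proof -
  have "T = (\<lambda>\<mu> \<nu>. \<Sum>i\<in>UNIV. sd_basis \<sigma> i \<mu> \<nu> * T 0 (spatial i)) \<longleftrightarrow>
      T 0 0 = 0 \<and> T 1 1 = 0 \<and> T 2 2 = 0 \<and> T 3 3 = 0 \<and>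
      T 1 0 = - T 0 1 \<and> T 2 0 = - T 0 2 \<and> T 3 0 = - T 0 3 \<and>
      T 2 3 = \<sigma> * T 0 1 \<and> T 3 2 = - \<sigma> * T 0 1 \<and> T 3 1 = \<sigma> * T 0 2 \<and> T 1 3 = - \<sigma> * T 0 2 \<and>
      T 1 2 = \<sigma> * T 0 3 \<and> T 2 1 = - \<sigma> * T 0 3"
    unfolding fun_eq_iff forall_index4 sum_index3
    by (simp add: sd_basis_def spatial_def levi_civita_degenerate levi_civita_permutation) argo
  also have "\<dots> \<longleftrightarrow> sd_antisym \<sigma> T"
    using assms unfolding sd_antisym_def forall_index4 hodge_dual_components
    by (elim disjE) (simp, argo)+
  finally show ?thesis by simp
qed

datatype 'a tym_field =
    Gauge 'a 4 | TGhost 'a 4 | Ghost 'a | BGhost 'a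
  | AntiGhost 'a | LNb 'a | AntiPhi 'a | AntiEta 'a | AntiChi 'a 3 | LNB 'a 3

text \<open>
  In this order: \<open>A\<close>, \<open>\<psi>\<close>, \<open>c\<close>, \<open>\<phi>\<close>; \<open>c\<close>-bar, \<open>b\<close>, \<open>\<phi>\<close>-bar, \<open>\<eta>\<close>-bar, \<open>\<chi>\<close>-bar, \<open>B\<close>.
\<close>

instance tym_field :: (finite) finite
proof
  have "(UNIV :: 'a tym_field set) \<subseteq>
      (\<lambda>(a, \<mu>). Gauge a \<mu>) ` UNIV \<union> (\<lambda>(a, \<mu>). TGhost a \<mu>) ` UNIV \<union> range Ghost \<union> range BGhost \<union>
      range AntiGhost \<union> range LNb \<union> range AntiPhi \<union> range AntiEta \<union> (\<lambda>(a, i). AntiChi a i) ` UNIV \<union>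
      (\<lambda>(a, i). LNB a i) ` UNIV"
    (is "_ \<subseteq> ?R")
  proof
    fix x :: "'a tym_field"
    show "x \<in> ?R" by (cases x) (auto simp: image_iff)
  qed
  then show "finite (UNIV :: 'a tym_field set)"
    by (rule finite_subset) simp
qed

primrec ghost_number :: "'a tym_field \<Rightarrow> int" where
  "ghost_number (Gauge a \<mu>) = 0"
| "ghost_number (TGhost a \<mu>) = 1"
| "ghost_number (Ghost a) = 1"
| "ghost_number (BGhost a) = 2"
| "ghost_number (AntiGhost a) = -1"
| "ghost_number (LNb a) = 0"
| "ghost_number (AntiPhi a) = -2"
| "ghost_number (AntiEta a) = -1"
| "ghost_number (AntiChi a i) = -1"
| "ghost_number (LNB a i) = 0"

definition anticommuting :: "'a tym_field \<Rightarrow> bool" where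
  "anticommuting x \<longleftrightarrow> odd (ghost_number x)"

definition rc :: "real \<Rightarrow> 'k dpoly" where
  "rc x = cst (complex_of_real x)"

definition chi_tensor :: "real \<Rightarrow> 'a \<Rightarrow> 4 \<Rightarrow> 4 \<Rightarrow> 'a tym_field dpoly" where
  "chi_tensor \<sigma> a \<mu> \<nu> = (\<Sum>i\<in>UNIV. rc (sd_basis \<sigma> i \<mu> \<nu>) * var (AntiChi a i))"

definition field_strength ::
    "('a::finite \<Rightarrow> 'a \<Rightarrow> 'a \<Rightarrow> real) \<Rightarrow> real \<Rightarrow> 'a \<Rightarrow> 4 \<Rightarrow> 4 \<Rightarrow> 'a tym_field dpoly" where
  "field_strength f g a \<mu> \<nu> =
     pd \<mu> (var (Gauge a \<nu>)) - pd \<nu> (var (Gauge a \<mu>))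
     + (\<Sum>b\<in>UNIV. \<Sum>c\<in>UNIV. rc (g * f a b c) * var (Gauge b \<mu>) * var (Gauge c \<nu>))"

definition dual_field_strength ::
    "('a::finite \<Rightarrow> 'a \<Rightarrow> 'a \<Rightarrow> real) \<Rightarrow> real \<Rightarrow> 'a \<Rightarrow> 4 \<Rightarrow> 4 \<Rightarrow> 'a tym_field dpoly" where
  "dual_field_strength f g a \<mu> \<nu> =
     rc (1/2) * (\<Sum>\<alpha>\<in>UNIV. \<Sum>\<beta>\<in>UNIV. rc (levi_civita \<mu> \<nu> \<alpha> \<beta>) * field_strength f g a \<alpha> \<beta>)"

definition cov_deriv ::
    "('a::finite \<Rightarrow> 'a \<Rightarrow> 'a \<Rightarrow> real) \<Rightarrow> real \<Rightarrow> 4 \<Rightarrow> ('a \<Rightarrow> 'a tym_field dpoly) \<Rightarrow> 'a \<Rightarrow> 'a tym_field dpoly" where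
  "cov_deriv f g \<mu> X a =
     pd \<mu> (X a) - (\<Sum>b\<in>UNIV. \<Sum>c\<in>UNIV. rc (g * f a b c) * var (Gauge c \<mu>) * X b)"

primrec brst_field ::
    "('a::finite \<Rightarrow> 'a \<Rightarrow> 'a \<Rightarrow> real) \<Rightarrow> real \<Rightarrow> 'a tym_field \<Rightarrow> 'a tym_field dpoly" where
  "brst_field f g (Gauge a \<mu>) = - cov_deriv f g \<mu> (\<lambda>b. var (Ghost b)) a + var (TGhost a \<mu>)"
| "brst_field f g (Ghost a) =
     (\<Sum>b\<in>UNIV. \<Sum>c\<in>UNIV. rc (g / 2 * f a b c) * var (Ghost b) * var (Ghost c)) + var (BGhost a)"
| "brst_field f g (TGhost a \<mu>) =
     (\<Sum>b\<in>UNIV. \<Sum>c\<in>UNIV. rc (g * f a b c) * var (Ghost b) * var (TGhost c \<mu>))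
     + cov_deriv f g \<mu> (\<lambda>b. var (BGhost b)) a"
| "brst_field f g (BGhost a) =
     (\<Sum>b\<in>UNIV. \<Sum>c\<in>UNIV. rc (g * f a b c) * var (Ghost b) * var (BGhost c))"
| "brst_field f g (AntiGhost a) = var (LNb a)"
| "brst_field f g (LNb a) = 0"
| "brst_field f g (AntiChi a i) = var (LNB a i)"
| "brst_field f g (LNB a i) = 0"
| "brst_field f g (AntiPhi a) = var (AntiEta a)"
| "brst_field f g (AntiEta a) = 0"

definition brst ::
    "('a::finite \<Rightarrow> 'a \<Rightarrow> 'a \<Rightarrow> real) \<Rightarrow> real \<Rightarrow> 'a tym_field dpoly \<Rightarrow> 'a tym_field dpoly" where
  "brst f g = odd_derivation anticommuting (brst_field f g)"

definition gauge_fermion ::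
    "('a::finite \<Rightarrow> 'a \<Rightarrow> 'a \<Rightarrow> real) \<Rightarrow> real \<Rightarrow> real \<Rightarrow> 'a tym_field dpoly" where
  "gauge_fermion f g \<sigma> =
     (\<Sum>a\<in>UNIV. \<Sum>\<mu>\<in>UNIV. var (AntiGhost a) * pd \<mu> (var (Gauge a \<mu>)))
     + rc (1/2) * (\<Sum>a\<in>UNIV. \<Sum>\<mu>\<in>UNIV. \<Sum>\<nu>\<in>UNIV. chi_tensor \<sigma> a \<mu> \<nu> *
         (field_strength f g a \<mu> \<nu> + rc \<sigma> * dual_field_strength f g a \<mu> \<nu>))
     + (\<Sum>a\<in>UNIV. \<Sum>\<mu>\<in>UNIV. var (AntiPhi a) * pd \<mu> (var (TGhost a \<mu>)))"

text \<open>The redefinition of \<open>\<eta>\<close>-bar that removes the quadratic mixing of the anti-ghost with \<open>\<psi>\<close>.\<close>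

definition eta_shift :: "'a tym_field \<Rightarrow> 'a tym_field dpoly" where
  "eta_shift x = (case x of AntiEta a \<Rightarrow> var (AntiEta a) + var (AntiGhost a) | _ \<Rightarrow> var x)"

definition tym_action ::
    "('a::finite \<Rightarrow> 'a \<Rightarrow> 'a \<Rightarrow> real) \<Rightarrow> real \<Rightarrow> real \<Rightarrow> 'a tym_field dpoly \<Rightarrow> 'a tym_field dpoly" where
  "tym_action f g \<sigma> S0 = S0 + substitute eta_shift (brst f g (gauge_fermion f g \<sigma>))"

text \<open>
  \<open>\<integral> S0\<close> is a topological invariant of the gauge field, such as the Pontryagin number: it is
  unchanged under local variations of \<open>A\<close>.  For a local functional, polynomial in the fields, this
  means that its functional derivatives of all orders \<open>n \<ge> 1\<close> (which are supported on total
  momentum zero) vanish.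
\<close>

definition topological_invariant :: "'a tym_field dpoly \<Rightarrow> bool" where
  "topological_invariant S0 \<longleftrightarrow>
     (\<forall>w\<in>Poly_Mapping.keys S0. fst ` set (letters w) \<subseteq> {Gauge a \<mu> | a \<mu>. True}) \<and>
     (\<forall>Js ks. Js \<noteq> [] \<and> length ks = length Js \<and> sum_list ks = 0 \<longrightarrow>
        vertex anticommuting S0 Js ks = 0)"

end

theory Submission
  imports Defs
begin

text \<open>
  Every monomial of the gauge-fixed action contains exactly one of the barred fields \<open>B\<close>, \<open>b\<close>,
  \<open>\<chi>\<close>-bar, \<open>\<eta>\<close>-bar, \<open>c\<close>-bar, \<open>\<phi>\<close>-bar, and every propagator joins a barred field to an unbarred one.
  Counting barred ends of lines, a connected diagram with a loop has as many lines as nodes, all its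
  external fields are barred, and it has exactly one cycle, to which trees are attached.  Conservation
  of the ghost number then makes all lines off the cycle \<open>A\<close>-lines, while the cycle consists of lines of
  a single kind, \<open>A\<close>, \<open>\<psi>\<close>, \<open>c\<close> or \<open>\<phi>\<close>.  By the BRST origin of the action, exchanging \<open>A\<close> with \<open>\<psi>\<close>
  or \<open>c\<close> with \<open>\<phi>\<close> along the cycle (and their barred partners alongside) leaves the integrand
  unchanged except for the sign \<open>-1\<close> of a fermion loop, so the contributions cancel in pairs, for
  each topology and before any loop integration.
\<close>

section \<open>Calculus of differential polynomials\<close>

text \<open>The exchange is not a symmetry of the whole action: the vertices \<chi>-bar c and
  \<phi>-bar c \<psi> have no counterpart. It works only at vertices whose remaining legs are all A,
  which is why the ghost number has to be counted first. That count removes \<phi>-bar c \<psi>; a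
  vertex \<chi>-bar c turns a c line into a \<psi> line, and no vertex on the cycle could undo this.
  No propagator is ever computed: the exchanged kernel differs from the kernel by signs on rows and
  columns, and uniqueness of the inverse carries over both these signs and the selection rule. The
  delicate point is the final -1, since the Wick sign, the vertex signs and the propagator signs all
  depend on the arbitrary order of the half-edges. They are combined by comparing two ways of
  pairing the points of the cycle, by nodes and by edges.\<close>

lemma dpoly_expand: "P = (\<Sum>w\<in>Poly_Mapping.keys P. Poly_Mapping.single w (Poly_Mapping.lookup P w))"
  for P :: "'k dpoly"
proof (rule poly_mapping_eqI)
  fix v
  have "Poly_Mapping.lookup (\<Sum>w\<in>Poly_Mapping.keys P. Poly_Mapping.single w (Poly_Mapping.lookup P w)) v
      = (\<Sum>w\<in>Poly_Mapping.keys P. if w = v then Poly_Mapping.lookup P w else 0)"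
    by (simp add: lookup_sum lookup_single when_def)
  also have "\<dots> = Poly_Mapping.lookup P v"
    by (simp add: not_in_keys_iff_lookup_eq_zero)
  finally show "Poly_Mapping.lookup P v = Poly_Mapping.lookup (\<Sum>w\<in>Poly_Mapping.keys P. Poly_Mapping.single w (Poly_Mapping.lookup P w)) v"
    by simp
qed

text \<open>Induction over monomials that stays inside a set \<open>K\<close> of words, for claims
  that hold only for polynomials in A alone.\<close>

lemma dpoly_induct_keys:
  fixes P :: "'k dpoly"
  assumes single: "\<And>w c. w \<in> K \<Longrightarrow> R (Poly_Mapping.single w c)" and zero: "R 0"
    and add: "\<And>P Q. R P \<Longrightarrow> R Q \<Longrightarrow> R (P + Q)"
    and K: "Poly_Mapping.keys P \<subseteq> K"
  shows "R P"
proof -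
  have "R (\<Sum>w\<in>A. Poly_Mapping.single w (Poly_Mapping.lookup P w))"
    if "finite A" "A \<subseteq> K" for A
    using that by (induction A) (auto intro: zero add single)
  then show ?thesis
    using K dpoly_expand[of P] by (metis finite_keys)
qed

lemma dpoly_induct [case_names single add]:
  fixes P :: "'k dpoly"
  assumes single: "\<And>w c. R (Poly_Mapping.single w c)" and add: "\<And>P Q. R P \<Longrightarrow> R Q \<Longrightarrow> R (P + Q)"
  shows "R P"
  using dpoly_induct_keys[of UNIV R P] single[of 0 0] assms by auto

text \<open>Coefficients may cancel in \<open>P + Q\<close>, so the three sets of keys differ; a
  word missing from one of them counts as coefficient 0. Serves \<open>lin_ext\<close> and
  \<open>vertex\<close> alike.\<close>

lemma keys_sum_additive:
  fixes P Q :: "'k dpoly" and \<phi> :: "'k fword \<Rightarrow> complex \<Rightarrow> 'b::comm_monoid_add"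
  assumes zero: "\<And>w. \<phi> w 0 = 0" and add: "\<And>w c d. \<phi> w (c + d) = \<phi> w c + \<phi> w d"
  shows "(\<Sum>w\<in>Poly_Mapping.keys (P + Q). \<phi> w (Poly_Mapping.lookup (P + Q) w)) =
    (\<Sum>w\<in>Poly_Mapping.keys P. \<phi> w (Poly_Mapping.lookup P w)) +
    (\<Sum>w\<in>Poly_Mapping.keys Q. \<phi> w (Poly_Mapping.lookup Q w))"
  by (rule setsum_keys_plus_distrib) (auto simp: zero add)

lemma cst_0 [simp]: "cst 0 = 0"
  and cst_1 [simp]: "cst 1 = 1"
  and cst_add: "cst (c + d) = cst c + cst d"
  and cst_uminus: "cst (- c) = - cst c"
  and cst_mult: "cst (c * d) = cst c * cst d"
  by (simp_all add: cst_def single_add single_uminus mult_single flip: single_one)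

lemma cst_mult_single [simp]: "cst c * Poly_Mapping.single w d = Poly_Mapping.single w (c * d)"
  and single_mult_cst: "Poly_Mapping.single w d * cst c = Poly_Mapping.single w (d * c)"
  by (simp_all add: cst_def mult_single)

lemma cst_commute: "P * cst c = cst c * P"
  by (induction P rule: dpoly_induct) (simp_all add: single_mult_cst mult.commute distrib_left distrib_right)

lemma cst_left_commute: "P * (cst c * Q) = cst c * (P * Q)"
  by (metis cst_commute mult.assoc)

lemma letter_mult_single: "letter l * Poly_Mapping.single w c = Poly_Mapping.single (FWord (l # letters w)) c"
  by (simp add: letter_def mult_single plus_fword_def)

lemma lin_ext_add: "lin_ext F (P + Q) = lin_ext F P + lin_ext F Q"
  unfolding lin_ext_def by (rule keys_sum_additive) (simp_all add: cst_add distrib_right)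

lemma lin_ext_single [simp]: "lin_ext F (Poly_Mapping.single w c) = cst c * F (letters w)"
  by (simp add: lin_ext_def)

lemma lin_ext_0 [simp]: "lin_ext F 0 = 0"
  by (simp add: lin_ext_def)

lemma letters_0 [simp]: "letters 0 = []"
  by (simp add: zero_fword_def)

lemma lin_ext_1 [simp]: "lin_ext F 1 = F []"
  using lin_ext_single[of F 0 1] by simp

lemma lin_ext_cst_mult: "lin_ext F (cst c * P) = cst c * lin_ext F P"
  by (induction P rule: dpoly_induct) (simp_all add: lin_ext_add distrib_left cst_mult mult.assoc)

lemma lin_ext_uminus: "lin_ext F (- P) = - lin_ext F P"
  using lin_ext_cst_mult[of F "-1" P] by (simp add: cst_uminus)

lemma lin_ext_diff: "lin_ext F (P - Q) = lin_ext F P - lin_ext F Q"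
  using lin_ext_add[of F P "- Q"] by (simp add: lin_ext_uminus)

lemma lin_ext_sum: "lin_ext F (sum P A) = (\<Sum>x\<in>A. lin_ext F (P x))"
  by (induction A rule: infinite_finite_induct) (simp_all add: lin_ext_add)

lemma pd_linear:
  shows "pd \<mu> (P + Q) = pd \<mu> P + pd \<mu> Q"
    and "pd \<mu> (P - Q) = pd \<mu> P - pd \<mu> Q"
    and "pd \<mu> (- P) = - pd \<mu> P"
    and "pd \<mu> (sum X A) = (\<Sum>x\<in>A. pd \<mu> (X x))"
    and "pd \<mu> (cst c * P) = cst c * pd \<mu> P"
    and "pd \<mu> (0) = 0"
  by (simp_all add: pd_def lin_ext_add lin_ext_diff lin_ext_uminus lin_ext_sum lin_ext_cst_mult)

lemma pd_letter_mult: "pd \<mu> (letter l * Q) = letter (fst l, \<mu> # snd l) * Q + letter l * pd \<mu> Q"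
proof (induction Q rule: dpoly_induct)
  case (single w c)
  have "pd \<mu> (letter l * Poly_Mapping.single w c) =
      cst c * (letter (fst l, \<mu> # snd l) * Poly_Mapping.single w 1 + letter l * deriv_letters \<mu> (letters w))"
    by (cases w) (simp add: pd_def letter_mult_single)
  also have "\<dots> = letter (fst l, \<mu> # snd l) * (cst c * Poly_Mapping.single w 1)
      + letter l * (cst c * deriv_letters \<mu> (letters w))"
    by (simp only: distrib_left cst_left_commute[of "letter _"])
  finally show ?case by (simp add: pd_def)
qed (simp add: distrib_left pd_linear add_ac)

lemma pd_letter: "pd \<mu> (letter l) = letter (fst l, \<mu> # snd l)"
  using pd_letter_mult[of \<mu> l 1] by (simp add: pd_def)

lemma foldr_pd_letter: "foldr pd ds (letter (x, es)) = letter (x, ds @ es)"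
  by (induction ds) (simp_all add: pd_letter)

lemma foldr_pd_add: "foldr pd ds (P + Q) = foldr pd ds P + foldr pd ds Q"
  by (induction ds) (simp_all add: pd_linear)

lemma foldr_pd_0 [simp]: "foldr pd ds 0 = 0"
  by (induction ds) (simp_all add: pd_linear)

lemma odd_derivation_linear:
  shows "odd_derivation gr s (P + Q) = odd_derivation gr s P + odd_derivation gr s Q"
    and "odd_derivation gr s (P - Q) = odd_derivation gr s P - odd_derivation gr s Q"
    and "odd_derivation gr s (- P) = - odd_derivation gr s P"
    and "odd_derivation gr s (sum X A) = (\<Sum>x\<in>A. odd_derivation gr s (X x))"
    and "odd_derivation gr s (cst c * P) = cst c * odd_derivation gr s P"
    and "odd_derivation gr s (0) = 0"
  by (simp_all add: odd_derivation_def lin_ext_add lin_ext_diff lin_ext_uminus lin_ext_sum lin_ext_cst_mult)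

lemma odd_derivation_letter_mult:
  "odd_derivation gr s (letter l * Q) =
     foldr pd (snd l) (s (fst l)) * Q + cst (if gr (fst l) then -1 else 1) * letter l * odd_derivation gr s Q"
proof (induction Q rule: dpoly_induct)
  case (single w c)
  let ?e = "cst (if gr (fst l) then -1 else 1) :: 'a dpoly"
  have "odd_derivation gr s (letter l * Poly_Mapping.single w c) =
      cst c * (foldr pd (snd l) (s (fst l)) * Poly_Mapping.single w 1 + ?e * letter l * odd_derivation_letters gr s (letters w))"
    by (cases w) (simp add: odd_derivation_def letter_mult_single)
  also have "\<dots> = foldr pd (snd l) (s (fst l)) * (cst c * Poly_Mapping.single w 1)
      + ?e * letter l * (cst c * odd_derivation_letters gr s (letters w))"
    by (simp only: distrib_left cst_left_commute[of "?e * letter l"]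
        cst_left_commute[of "foldr pd (snd l) (s (fst l))"])
  finally show ?case by (simp add: odd_derivation_def)
qed (simp add: distrib_left odd_derivation_linear add_ac)

lemma odd_derivation_letter: "odd_derivation gr s (letter l) = foldr pd (snd l) (s (fst l))"
  using odd_derivation_letter_mult[of gr s l 1] by (simp add: odd_derivation_def)

text \<open>Lets the BRST operator on polynomials in A be split into the part that produces \<psi>
  and the part that produces c.\<close>

lemma odd_derivation_add_values:
  "odd_derivation gr (\<lambda>x. s x + t x) P = odd_derivation gr s P + odd_derivation gr t P"
proof -
  have "odd_derivation_letters gr (\<lambda>x. s x + t x) ls = odd_derivation_letters gr s ls + odd_derivation_letters gr t ls" for ls
    by (induction ls) (simp_all add: foldr_pd_add algebra_simps)
  then show ?thesis
    unfolding odd_derivation_def lin_ext_def by (simp add: distrib_left sum.distrib)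
qed

lemma odd_derivation_cong:
  assumes "\<And>w x. w \<in> Poly_Mapping.keys P \<Longrightarrow> x \<in> fst ` set (letters w) \<Longrightarrow> s x = t x"
  shows "odd_derivation gr s P = odd_derivation gr t P"
proof -
  have "odd_derivation_letters gr s ls = odd_derivation_letters gr t ls"
    if "\<And>x. x \<in> fst ` set ls \<Longrightarrow> s x = t x" for ls
    using that by (induction ls) auto
  then show ?thesis
    unfolding odd_derivation_def lin_ext_def by (intro sum.cong refl arg_cong2[where f = "(*)"]) (use assms in blast)
qed

lemma substitute_linear:
  shows "substitute h (P + Q) = substitute h P + substitute h Q"
    and "substitute h (P - Q) = substitute h P - substitute h Q"
    and "substitute h (- P) = - substitute h P"
    and "substitute h (sum X A) = (\<Sum>x\<in>A. substitute h (X x))"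
    and "substitute h (cst c * P) = cst c * substitute h P"
    and "substitute h (0) = 0"
  by (simp_all add: substitute_def lin_ext_add lin_ext_diff lin_ext_uminus lin_ext_sum lin_ext_cst_mult)

lemma substitute_letter_mult:
  "substitute h (letter l * Q) = foldr pd (snd l) (h (fst l)) * substitute h Q"
proof (induction Q rule: dpoly_induct)
  case (single w c)
  show ?case
    by (simp add: substitute_def letter_mult_single cst_left_commute[of "foldr _ _ _"])
qed (simp add: distrib_left substitute_linear)

lemma prod_list_letters: "prod_list (map letter ls) = Poly_Mapping.single (FWord ls) 1"
  by (induction ls) (simp_all add: letter_mult_single zero_fword_def flip: single_one)

lemma substitute_id:
  assumes "\<And>w x. w \<in> Poly_Mapping.keys P \<Longrightarrow> x \<in> fst ` set (letters w) \<Longrightarrow> h x = var x"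
  shows "substitute h P = P"
proof -
  have "prod_list (map (\<lambda>l. foldr pd (snd l) (h (fst l))) (letters w)) = Poly_Mapping.single w 1"
    if "w \<in> Poly_Mapping.keys P" for w
  proof -
    have "map (\<lambda>l. foldr pd (snd l) (h (fst l))) (letters w) = map letter (letters w)"
      using assms[OF that] by (auto simp: var_def foldr_pd_letter)
    then show ?thesis by (cases w) (simp only: prod_list_letters letters.simps)
  qed
  then show ?thesis
    unfolding substitute_def lin_ext_def by (subst (3) dpoly_expand) simp
qed

section \<open>The gauge-fixed action\<close>

fun is_gauge :: "'a tym_field \<Rightarrow> bool" where
  "is_gauge (Gauge a \<mu>) \<longleftrightarrow> True"
| "is_gauge _ \<longleftrightarrow> False"

definition matter :: "('a tym_field \<times> 4 list) list \<Rightarrow> 'a tym_field list" where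
  "matter ls = filter (\<lambda>x. \<not> is_gauge x) (map fst ls)"

text \<open>Selection rules see only the fields other than A: A is neutral and may occur any number
  of times. Words do not commute, so the content is an ordered list here and becomes a multiset only
  in a vertex.\<close>

definition carries :: "'a tym_field list set \<Rightarrow> 'a tym_field dpoly \<Rightarrow> bool" where
  "carries X P \<longleftrightarrow> (\<forall>w\<in>Poly_Mapping.keys P. matter (letters w) \<in> X)"

lemma matter_simps [simp]:
  "matter [] = []" "matter (l # ls) = (if is_gauge (fst l) then matter ls else fst l # matter ls)"
  "matter (ls @ ls') = matter ls @ matter ls'"
  by (simp_all add: matter_def)

lemma carries_0 [simp]: "carries X 0"
  by (simp add: carries_def)

lemma carries_mono: "carries X P \<Longrightarrow> X \<subseteq> Y \<Longrightarrow> carries Y P"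
  by (auto simp: carries_def)

lemma carries_add: "carries X P \<Longrightarrow> carries X Q \<Longrightarrow> carries X (P + Q)"
  using keys_add[of P Q] by (auto simp: carries_def)

lemma carries_uminus: "carries X P \<Longrightarrow> carries X (- P)"
  by (simp add: carries_def in_keys_iff)

lemma carries_diff: "carries X P \<Longrightarrow> carries X Q \<Longrightarrow> carries X (P - Q)"
  using carries_add[of X P "- Q"] carries_uminus[of X Q] by simp

lemma carries_sum: "(\<And>i. i \<in> A \<Longrightarrow> carries X (P i)) \<Longrightarrow> carries X (sum P A)"
  by (induction A rule: infinite_finite_induct) (auto intro: carries_add)

lemma carries_mult:
  assumes "carries X P" "carries Y Q" "\<And>x y. x \<in> X \<Longrightarrow> y \<in> Y \<Longrightarrow> x @ y \<in> Z"
  shows "carries Z (P * Q)"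
  using keys_mult[of P Q] assms by (fastforce simp: carries_def plus_fword_def)

lemma carries_single: "matter (letters w) \<in> X \<Longrightarrow> carries X (Poly_Mapping.single w c)"
  by (simp add: carries_def)

lemma carries_cst_mult: "carries X P \<Longrightarrow> carries X (cst c * P)"
  by (rule carries_mult[of "{[]}" _ X]) (auto simp: cst_def intro: carries_single)

lemma carries_rc_mult: "carries X P \<Longrightarrow> carries X (rc c * P)"
  unfolding rc_def by (rule carries_cst_mult)

lemma carries_letter: "matter [l] \<in> X \<Longrightarrow> carries X (letter l)"
  by (simp add: letter_def carries_single)

lemma carries_var: "matter [(x, [])] \<in> X \<Longrightarrow> carries X (var x)"
  by (simp add: var_def carries_letter)

lemma carries_letter_mult: "carries Y Q \<Longrightarrow> (\<And>y. y \<in> Y \<Longrightarrow> matter [l] @ y \<in> X) \<Longrightarrow> carries X (letter l * Q)"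
  by (rule carries_mult[of "{matter [l]}" _ Y]) (auto intro: carries_letter)

lemma carries_lin_ext:
  assumes "\<And>w. w \<in> Poly_Mapping.keys P \<Longrightarrow> carries X (F (letters w))"
  shows "carries X (lin_ext F P)"
  unfolding lin_ext_def by (intro carries_sum carries_cst_mult assms)

lemma carries_pd: "carries X P \<Longrightarrow> carries X (pd \<mu> P)"
proof -
  have "carries {matter ls} (deriv_letters \<mu> ls)" for ls :: "('a tym_field \<times> 4 list) list"
  proof (induction ls)
    case (Cons l ls)
    have "carries {matter (l # ls)} (letter (fst l, \<mu> # snd l) * Poly_Mapping.single (FWord ls) 1)"
      by (rule carries_letter_mult[of "{matter ls}"]) (auto intro: carries_single)
    moreover have "carries {matter (l # ls)} (letter l * deriv_letters \<mu> ls)"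
      by (rule carries_letter_mult[OF Cons]) auto
    ultimately show ?case by (simp add: carries_add)
  qed simp
  then show "carries X P \<Longrightarrow> carries X (pd \<mu> P)"
    unfolding pd_def by (intro carries_lin_ext) (auto simp: carries_def)
qed

lemma carries_foldr_pd: "carries X P \<Longrightarrow> carries X (foldr pd ds P)"
  by (induction ds) (auto intro: carries_pd)

text \<open>Each summand replaces one letter A by its value, and the untouched letters are A as
  well, so they add nothing to the content.\<close>

lemma carries_odd_derivation:
  assumes "carries {[]} P" and s: "\<And>a \<mu>. carries X (s (Gauge a \<mu>))"
  shows "carries X (odd_derivation gr s P)"
proof -
  have "carries X (odd_derivation_letters gr s ls)" if "matter ls = []" for ls
    using that
  proof (induction ls)
    case (Cons l ls)
    then obtain a \<mu> where l: "fst l = Gauge a \<mu>" and ls: "matter ls = []"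
      by (cases "fst l") auto
    have "carries X (foldr pd (snd l) (s (fst l)) * Poly_Mapping.single (FWord ls) 1)"
      by (rule carries_mult[of X _ "{[]}"]) (auto intro: carries_foldr_pd s carries_single simp: l ls)
    moreover have "carries X (cst c * letter l * odd_derivation_letters gr s ls)" for c
      unfolding mult.assoc
      by (intro carries_cst_mult carries_letter_mult[of X]) (use Cons.IH[OF ls] l in auto)
    ultimately show ?case by (simp add: carries_add)
  qed simp
  then show ?thesis
    unfolding odd_derivation_def using assms(1) by (intro carries_lin_ext) (auto simp: carries_def)
qed

lemmas carries_intros = carries_add carries_diff carries_uminus carries_sum carries_pd carries_rc_mult carries_cst_mult carries_0

lemma carries_gauge_mult: "carries X P \<Longrightarrow> carries X (var (Gauge a \<mu>) * P)"
  unfolding var_def by (rule carries_letter_mult) auto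

lemma odd_derivation_cong_gauge:
  assumes "carries {[]} P" "\<And>a \<mu>. s (Gauge a \<mu>) = t (Gauge a \<mu>)"
  shows "odd_derivation gr s P = odd_derivation gr t P"
proof (rule odd_derivation_cong)
  fix w x assume "w \<in> Poly_Mapping.keys P" "x \<in> fst ` set (letters w)"
  then have "is_gauge x"
    using assms(1) by (auto simp: carries_def matter_def filter_empty_conv)
  then show "s x = t x" using assms(2) by (cases x) auto
qed

lemma substitute_eta_shift_id:
  assumes "carries X P" "\<And>a x. x \<in> X \<Longrightarrow> AntiEta a \<notin> set x"
  shows "substitute eta_shift P = P"
proof (rule substitute_id)
  fix w x assume *: "w \<in> Poly_Mapping.keys P" "x \<in> fst ` set (letters w)"
  have "x \<noteq> AntiEta a" for a
  proof
    assume "x = AntiEta a"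
    then have "AntiEta a \<in> set (matter (letters w))"
      using * by (auto simp: matter_def image_iff)
    then show False using * assms by (auto simp: carries_def)
  qed
  then show "eta_shift x = var x" by (cases x) (auto simp: eta_shift_def)
qed

section \<open>The BRST variation of the gauge fermion\<close>

definition div_A :: "'a \<Rightarrow> 'a tym_field dpoly" where
  "div_A a = (\<Sum>\<mu>\<in>UNIV. pd \<mu> (var (Gauge a \<mu>)))"

text \<open>The coefficient of the independent component \<open>AntiChi a i\<close> in the gauge
  fermion.\<close>

definition sd_curv :: "('a::finite \<Rightarrow> 'a \<Rightarrow> 'a \<Rightarrow> real) \<Rightarrow> real \<Rightarrow> real \<Rightarrow> 'a \<Rightarrow> 3 \<Rightarrow> 'a tym_field dpoly" where
  "sd_curv f g \<sigma> a i = rc (1/2) * (\<Sum>\<mu>\<in>UNIV. \<Sum>\<nu>\<in>UNIV. rc (sd_basis \<sigma> i \<mu> \<nu>) *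
     (field_strength f g a \<mu> \<nu> + rc \<sigma> * dual_field_strength f g a \<mu> \<nu>))"

text \<open>On A, s is a sum of two parts: this shift to \<psi>, which generates the exchange of A
  lines with \<psi> lines, and the gauge transformation with parameter c in
  \<open>ghost_value\<close>.\<close>

definition psi_value :: "'a tym_field \<Rightarrow> 'a tym_field dpoly" where
  "psi_value x = (case x of Gauge a \<mu> \<Rightarrow> var (TGhost a \<mu>) | _ \<Rightarrow> 0)"

definition psi_deriv :: "'a tym_field dpoly \<Rightarrow> 'a tym_field dpoly" where
  "psi_deriv = odd_derivation anticommuting psi_value"

definition ghost_value :: "('a::finite \<Rightarrow> 'a \<Rightarrow> 'a \<Rightarrow> real) \<Rightarrow> real \<Rightarrow> 'a tym_field \<Rightarrow> 'a tym_field dpoly" where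
  "ghost_value f g x = (case x of Gauge a \<mu> \<Rightarrow> - cov_deriv f g \<mu> (\<lambda>b. var (Ghost b)) a | _ \<Rightarrow> 0)"

definition ghost_deriv :: "('a::finite \<Rightarrow> 'a \<Rightarrow> 'a \<Rightarrow> real) \<Rightarrow> real \<Rightarrow> 'a tym_field dpoly \<Rightarrow> 'a tym_field dpoly" where
  "ghost_deriv f g = odd_derivation anticommuting (ghost_value f g)"

definition div_D :: "('a::finite \<Rightarrow> 'a \<Rightarrow> 'a \<Rightarrow> real) \<Rightarrow> real \<Rightarrow> ('a \<Rightarrow> 'a tym_field) \<Rightarrow> 'a \<Rightarrow> 'a tym_field dpoly" where
  "div_D f g x a = (\<Sum>\<mu>\<in>UNIV. pd \<mu> (cov_deriv f g \<mu> (\<lambda>b. var (x b)) a))"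

definition ghost_source :: "('a::finite \<Rightarrow> 'a \<Rightarrow> 'a \<Rightarrow> real) \<Rightarrow> real \<Rightarrow> 'a \<Rightarrow> 'a tym_field dpoly" where
  "ghost_source f g a = (\<Sum>\<mu>\<in>UNIV. pd \<mu> (\<Sum>b\<in>UNIV. \<Sum>c\<in>UNIV. rc (g * f a b c) * var (Ghost b) * var (TGhost c \<mu>)))"

lemma carries_div_A: "carries {[]} (div_A a)"
  unfolding div_A_def by (intro carries_intros carries_var) simp

lemma carries_field_strength: "carries {[]} (field_strength f g a \<mu> \<nu>)"
  unfolding field_strength_def mult.assoc by (intro carries_intros carries_gauge_mult carries_var) simp_all

lemma carries_sd_curv: "carries {[]} (sd_curv f g \<sigma> a i)"
  unfolding sd_curv_def dual_field_strength_def by (intro carries_intros carries_field_strength)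

lemma carries_cov_deriv:
  assumes "\<And>b. \<not> is_gauge (x b)"
  shows "carries {[x b] |b. True} (cov_deriv f g \<mu> (\<lambda>b. var (x b)) a)"
  unfolding cov_deriv_def mult.assoc by (intro carries_intros carries_gauge_mult carries_var) (use assms in auto)

lemma carries_div_D:
  assumes "\<And>b. \<not> is_gauge (x b)"
  shows "carries {[x b] |b. True} (div_D f g x a)"
  unfolding div_D_def using assms by (intro carries_intros carries_cov_deriv)

lemma carries_ghost_source: "carries {[Ghost b, TGhost c \<mu>] |b c \<mu>. True} (ghost_source f g a)"
  unfolding ghost_source_def mult.assoc var_def
  by (intro carries_intros carries_letter_mult[of "{[TGhost c \<mu>] |c \<mu>. True}"] carries_letter) auto

lemma carries_psi_deriv: "carries {[]} P \<Longrightarrow> carries {[TGhost c \<mu>] |c \<mu>. True} (psi_deriv P)"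
  unfolding psi_deriv_def by (rule carries_odd_derivation) (auto simp: psi_value_def intro!: carries_var)

lemma carries_ghost_deriv: "carries {[]} P \<Longrightarrow> carries {[Ghost b] |b. True} (ghost_deriv f g P)"
  unfolding ghost_deriv_def
  by (rule carries_odd_derivation)
    (auto simp: ghost_value_def intro!: carries_uminus carries_cov_deriv[of Ghost, simplified])

lemma brst_gauge_poly:
  assumes "carries {[]} P"
  shows "brst f g P = ghost_deriv f g P + psi_deriv P"
proof -
  have "brst f g P = odd_derivation anticommuting (\<lambda>x. ghost_value f g x + psi_value x) P"
    unfolding brst_def
    by (rule odd_derivation_cong_gauge[OF assms]) (simp add: ghost_value_def psi_value_def)
  then show ?thesis
    by (simp add: odd_derivation_add_values ghost_deriv_def psi_deriv_def)
qed

lemma brst_var_mult: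
  "brst f g (var x * P) = brst_field f g x * P + cst (if anticommuting x then -1 else 1) * var x * brst f g P"
  unfolding brst_def var_def by (simp add: odd_derivation_letter_mult)

lemma brst_linear: "brst f g (P + Q) = brst f g P + brst f g Q" "brst f g (sum R A) = (\<Sum>x\<in>A. brst f g (R x))"
  by (simp_all add: brst_def odd_derivation_linear)

lemma odd_derivation_pd_var: "odd_derivation gr s (pd \<mu> (var x)) = pd \<mu> (s x)"
  by (simp add: var_def pd_letter odd_derivation_letter)

lemma gauge_fermion_eq:
  "gauge_fermion f g \<sigma> = (\<Sum>a\<in>UNIV. var (AntiGhost a) * div_A a)
     + (\<Sum>a\<in>UNIV. \<Sum>i\<in>UNIV. var (AntiChi a i) * sd_curv f g \<sigma> a i)
     + (\<Sum>a\<in>UNIV. var (AntiPhi a) * (\<Sum>\<mu>\<in>UNIV. pd \<mu> (var (TGhost a \<mu>))))"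
proof -
  have "rc (1/2) * (\<Sum>\<mu>\<in>UNIV. \<Sum>\<nu>\<in>UNIV. chi_tensor \<sigma> a \<mu> \<nu> * G \<mu> \<nu>) =
      (\<Sum>i\<in>UNIV. var (AntiChi a i) * (rc (1/2) * (\<Sum>\<mu>\<in>UNIV. \<Sum>\<nu>\<in>UNIV. rc (sd_basis \<sigma> i \<mu> \<nu>) * G \<mu> \<nu>)))"
    for a :: 'a and G :: "4 \<Rightarrow> 4 \<Rightarrow> 'a tym_field dpoly"
  proof -
    have "(\<Sum>\<mu>\<in>UNIV. \<Sum>\<nu>\<in>UNIV. chi_tensor \<sigma> a \<mu> \<nu> * G \<mu> \<nu>)
        = (\<Sum>\<mu>\<in>UNIV. \<Sum>\<nu>\<in>UNIV. \<Sum>i\<in>UNIV. var (AntiChi a i) * (rc (sd_basis \<sigma> i \<mu> \<nu>) * G \<mu> \<nu>))"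
      by (simp add: chi_tensor_def sum_distrib_right mult.assoc cst_left_commute[of "var _"] rc_def)
    also have "\<dots> = (\<Sum>\<mu>\<in>UNIV. \<Sum>i\<in>UNIV. \<Sum>\<nu>\<in>UNIV. var (AntiChi a i) * (rc (sd_basis \<sigma> i \<mu> \<nu>) * G \<mu> \<nu>))"
      by (rule sum.cong[OF refl]) (rule sum.swap)
    also have "\<dots> = (\<Sum>i\<in>UNIV. \<Sum>\<mu>\<in>UNIV. \<Sum>\<nu>\<in>UNIV. var (AntiChi a i) * (rc (sd_basis \<sigma> i \<mu> \<nu>) * G \<mu> \<nu>))"
      by (rule sum.swap)
    finally show ?thesis
      by (simp add: rc_def cst_left_commute[of "var _"] sum_distrib_left)
  qed
  then have "rc (1/2) * (\<Sum>a\<in>UNIV. \<Sum>\<mu>\<in>UNIV. \<Sum>\<nu>\<in>UNIV. chi_tensor \<sigma> a \<mu> \<nu> *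
         (field_strength f g a \<mu> \<nu> + rc \<sigma> * dual_field_strength f g a \<mu> \<nu>))
      = (\<Sum>a\<in>UNIV. \<Sum>i\<in>UNIV. var (AntiChi a i) * sd_curv f g \<sigma> a i)"
    unfolding sum_distrib_left[of _ _ "UNIV :: 'a set"] sd_curv_def by (intro sum.cong refl)
  then show ?thesis
    unfolding gauge_fermion_def by (simp add: div_A_def sum_distrib_left)
qed

text \<open>The form in which the exchange is visible. After \<open>S0\<close>, the first three sums
  consist of pairs of partners: b with \<eta>-bar, B with \<chi>-bar, c-bar with \<phi>-bar. The
  last two sums are the terms without a partner.\<close>

lemma tym_action_eq:
  "tym_action f g \<sigma> S0 = S0
     + (\<Sum>a\<in>UNIV. var (LNb a) * div_A a + var (AntiEta a) * psi_deriv (div_A a))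
     + (\<Sum>a\<in>UNIV. \<Sum>i\<in>UNIV. var (LNB a i) * sd_curv f g \<sigma> a i
          - var (AntiChi a i) * psi_deriv (sd_curv f g \<sigma> a i))
     + (\<Sum>a\<in>UNIV. var (AntiGhost a) * div_D f g Ghost a + var (AntiPhi a) * div_D f g BGhost a)
     + (\<Sum>a\<in>UNIV. var (AntiPhi a) * ghost_source f g a)
     - (\<Sum>a\<in>UNIV. \<Sum>i\<in>UNIV. var (AntiChi a i) * ghost_deriv f g (sd_curv f g \<sigma> a i))"
proof -
  \<comment> \<open>Since \<partial>\<psi> is the \<psi> part of s(\<partial>A), the term with
    \<eta>-bar gets the same form as the one with \<chi>-bar.\<close>
  have psi_div: "psi_deriv (div_A a) = (\<Sum>\<mu>\<in>UNIV. pd \<mu> (var (TGhost a \<mu>)))" for a :: 'a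
    by (simp add: psi_deriv_def div_A_def odd_derivation_linear odd_derivation_pd_var psi_value_def)
  have ghost_div: "ghost_deriv f g (div_A a) = - div_D f g Ghost a" for a :: 'a
    by (simp add: ghost_deriv_def div_A_def odd_derivation_linear odd_derivation_pd_var ghost_value_def
        div_D_def pd_linear sum_negf)
  have brst_psi: "brst f g (\<Sum>\<mu>\<in>UNIV. pd \<mu> (var (TGhost a \<mu>))) = ghost_source f g a + div_D f g BGhost a" for a :: 'a
    by (simp add: brst_def odd_derivation_linear odd_derivation_pd_var pd_linear
        ghost_source_def div_D_def sum.distrib)
  have sub_gauge: "substitute eta_shift (div_A a) = div_A a"
      "substitute eta_shift (sd_curv f g \<sigma> a i) = sd_curv f g \<sigma> a i" for a :: 'a and i
    by (rule substitute_eta_shift_id[OF carries_div_A]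
        substitute_eta_shift_id[OF carries_sd_curv], simp)+
  have sub_psi: "substitute eta_shift (psi_deriv P) = psi_deriv P"
    if "carries {[]} P" for P :: "'a tym_field dpoly"
    by (rule substitute_eta_shift_id[OF carries_psi_deriv[OF that]]) auto
  have sub_ghost: "substitute eta_shift (ghost_deriv f g P) = ghost_deriv f g P"
    if "carries {[]} P" for P :: "'a tym_field dpoly"
    by (rule substitute_eta_shift_id[OF carries_ghost_deriv[OF that]]) auto
  have sub_D: "substitute eta_shift (div_D f g Ghost a) = div_D f g Ghost a"
      "substitute eta_shift (div_D f g BGhost a) = div_D f g BGhost a" for a :: 'a
    by (rule substitute_eta_shift_id[OF carries_div_D], auto)+
  have sub_source: "substitute eta_shift (ghost_source f g a) = ghost_source f g a" for a :: 'a
    by (rule substitute_eta_shift_id[OF carries_ghost_source]) auto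
  note sub = sub_gauge sub_psi sub_ghost sub_D sub_source carries_div_A carries_sd_curv
  have t1: "substitute eta_shift (brst f g (var (AntiGhost a) * div_A a)) =
      var (LNb a) * div_A a + var (AntiGhost a) * div_D f g Ghost a
      - var (AntiGhost a) * psi_deriv (div_A a)" for a :: 'a
    by (simp add: brst_var_mult anticommuting_def brst_gauge_poly carries_div_A cst_uminus
         ghost_div substitute_linear distrib_left)
       (simp add: var_def substitute_letter_mult eta_shift_def sub substitute_linear algebra_simps)
  have t2: "substitute eta_shift (brst f g (var (AntiChi a i) * sd_curv f g \<sigma> a i)) =
      var (LNB a i) * sd_curv f g \<sigma> a i - var (AntiChi a i) * ghost_deriv f g (sd_curv f g \<sigma> a i)
      - var (AntiChi a i) * psi_deriv (sd_curv f g \<sigma> a i)" for a :: 'a and i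
    by (simp add: brst_var_mult anticommuting_def brst_gauge_poly carries_sd_curv cst_uminus
         substitute_linear distrib_left)
       (simp add: var_def substitute_letter_mult eta_shift_def sub substitute_linear algebra_simps)
  \<comment> \<open>Here \<phi>-bar is even, so s passes it without a sign; the term with c-bar
    comes from the shift and is opposite to the last term of \<open>t1\<close>.\<close>
  have t3: "substitute eta_shift (brst f g (var (AntiPhi a) * (\<Sum>\<mu>\<in>UNIV. pd \<mu> (var (TGhost a \<mu>))))) =
      var (AntiEta a) * psi_deriv (div_A a) + var (AntiGhost a) * psi_deriv (div_A a)
      + var (AntiPhi a) * ghost_source f g a + var (AntiPhi a) * div_D f g BGhost a" for a :: 'a
    unfolding psi_div[symmetric] brst_var_mult
    by (simp add: anticommuting_def brst_psi[folded psi_div] substitute_linear distrib_left)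
       (simp add: var_def substitute_letter_mult eta_shift_def sub substitute_linear algebra_simps)
  show ?thesis
    unfolding tym_action_def gauge_fermion_eq brst_linear substitute_linear t1 t2 t3
    by (simp add: sum.distrib sum_subtractf)
qed

section \<open>Interaction vertices\<close>

lemma vertex_add: "vertex gr (P + Q) Js ks = vertex gr P Js ks + vertex gr Q Js ks"
  unfolding vertex_def by (rule keys_sum_additive) (simp_all add: distrib_right)

lemma vertex_single [simp]: "vertex gr (Poly_Mapping.single w c) Js ks = c * word_vertex gr (letters w) Js ks"
  by (simp add: vertex_def)

lemma vertex_0 [simp]: "vertex gr 0 Js ks = 0"
  by (simp add: vertex_def)

lemma vertex_cst_mult: "vertex gr (cst c * P) Js ks = c * vertex gr P Js ks"
  by (induction P rule: dpoly_induct) (simp_all add: vertex_add distrib_left)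

lemma vertex_uminus: "vertex gr (- P) Js ks = - vertex gr P Js ks"
  using vertex_cst_mult[of gr "-1" P] by (simp add: cst_uminus)

lemma vertex_diff: "vertex gr (P - Q) Js ks = vertex gr P Js ks - vertex gr Q Js ks"
  using vertex_add[of gr P "- Q"] by (simp add: vertex_uminus)

lemma vertex_sum: "vertex gr (sum P A) Js ks = (\<Sum>x\<in>A. vertex gr (P x) Js ks)"
  by (induction A rule: infinite_finite_induct) (simp_all add: vertex_add)

lemmas vertex_linear = vertex_add vertex_diff vertex_uminus vertex_sum vertex_cst_mult vertex_0

lemma word_vertex_nonzero_mset:
  assumes "word_vertex gr ls Js ks \<noteq> 0"
  shows "mset (map fst ls) = mset Js"
proof -
  have len: "length ls = length Js"
    using assms by (auto simp: word_vertex_def split: if_splits)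
  have "(\<Sum>\<pi> | \<pi> permutes {..<length Js}. reorder_sign gr Js \<pi> *
           (\<Prod>r<length Js. if fst (ls ! r) = Js ! \<pi> r
                          then derivative_factor (snd (ls ! r)) (ks ! \<pi> r) else 0)) \<noteq> 0"
    using assms len by (simp add: word_vertex_def)
  then obtain \<pi> where \<pi>: "\<pi> \<in> {\<pi>. \<pi> permutes {..<length Js}}"
    and nz: "reorder_sign gr Js \<pi> * (\<Prod>r<length Js. if fst (ls ! r) = Js ! \<pi> r
                          then derivative_factor (snd (ls ! r)) (ks ! \<pi> r) else 0) \<noteq> 0"
    by (rule sum.not_neutral_contains_not_neutral)
  note nz = mult_not_zero[OF nz, THEN conjunct2]
  have "fst (ls ! r) = Js ! \<pi> r" if "r < length Js" for r
    using nz that by (auto simp: prod_zero_iff split: if_splits)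
  then have "map fst ls = permute_list \<pi> Js"
    using len by (intro nth_equalityI) (auto simp: permute_list_def)
  then show ?thesis
    using \<pi> by simp
qed

lemma vertex_eq_0:
  assumes "carries X P" "\<And>x. x \<in> X \<Longrightarrow> mset x \<noteq> mset (filter (\<lambda>x. \<not> is_gauge x) Js)"
  shows "vertex gr P Js ks = 0"
  unfolding vertex_def
proof (rule sum.neutral, rule ballI)
  fix w assume w: "w \<in> Poly_Mapping.keys P"
  have "word_vertex gr (letters w) Js ks = 0"
  proof (rule ccontr)
    assume "word_vertex gr (letters w) Js ks \<noteq> 0"
    then have "mset (map fst (letters w)) = mset Js"
      by (rule word_vertex_nonzero_mset)
    then have "mset (matter (letters w)) = mset (filter (\<lambda>x. \<not> is_gauge x) Js)"
      unfolding matter_def by (metis mset_filter)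
    then show False using assms w by (auto simp: carries_def)
  qed
  then show "Poly_Mapping.lookup P w * word_vertex gr (letters w) Js ks = 0" by simp
qed

lemma carries_var_mult: "carries X P \<Longrightarrow> \<not> is_gauge y \<Longrightarrow> carries {y # x |x. x \<in> X} (var y * P)"
  unfolding var_def by (rule carries_letter_mult) auto

text \<open>
  The fields other than \<open>A\<close> at a vertex.  There is no \<open>c\<close>-bar \<open>\<psi>\<close> vertex: the shift of
  \<open>\<eta>\<close>-bar cancels the one produced by \<open>s\<close>.
\<close>

inductive_set tym_vertices :: "'a tym_field multiset set" where
  "{#LNb a#} \<in> tym_vertices"
| "{#LNB a i#} \<in> tym_vertices"
| "{#AntiEta a, TGhost b \<mu>#} \<in> tym_vertices"
| "{#AntiChi a i, TGhost b \<mu>#} \<in> tym_vertices"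
| "{#AntiGhost a, Ghost b#} \<in> tym_vertices"
| "{#AntiPhi a, BGhost b#} \<in> tym_vertices"
| "{#AntiPhi a, Ghost b, TGhost c \<mu>#} \<in> tym_vertices"
| "{#AntiChi a i, Ghost b#} \<in> tym_vertices"

text \<open>Momentum conservation enters here: the functional derivatives of \<open>S0\<close> are
  assumed to vanish only at total momentum zero.\<close>

lemma vertex_tym_action:
  assumes "topological_invariant S0" "Js \<noteq> []" "length ks = length Js" "sum_list ks = 0"
  shows "vertex anticommuting (tym_action f g \<sigma> S0) Js ks =
     (\<Sum>a\<in>UNIV. vertex anticommuting (var (LNb a) * div_A a) Js ks
       + vertex anticommuting (var (AntiEta a) * psi_deriv (div_A a)) Js ks)
     + (\<Sum>a\<in>UNIV. \<Sum>i\<in>UNIV. vertex anticommuting (var (LNB a i) * sd_curv f g \<sigma> a i) Js ks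
          - vertex anticommuting (var (AntiChi a i) * psi_deriv (sd_curv f g \<sigma> a i)) Js ks)
     + (\<Sum>a\<in>UNIV. vertex anticommuting (var (AntiGhost a) * div_D f g Ghost a) Js ks
          + vertex anticommuting (var (AntiPhi a) * div_D f g BGhost a) Js ks)
     + (\<Sum>a\<in>UNIV. vertex anticommuting (var (AntiPhi a) * ghost_source f g a) Js ks)
     - (\<Sum>a\<in>UNIV. \<Sum>i\<in>UNIV. vertex anticommuting (var (AntiChi a i) * ghost_deriv f g (sd_curv f g \<sigma> a i)) Js ks)"
  using assms unfolding tym_action_eq by (simp add: vertex_linear topological_invariant_def)

lemma carries_terms:
  "carries {[LNb a]} (var (LNb a) * div_A a)"
  "carries {[AntiEta a, TGhost b \<mu>] |b \<mu>. True} (var (AntiEta a) * psi_deriv (div_A a))"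
  "carries {[LNB a i]} (var (LNB a i) * sd_curv f g \<sigma> a i)"
  "carries {[AntiChi a i, TGhost b \<mu>] |b \<mu>. True} (var (AntiChi a i) * psi_deriv (sd_curv f g \<sigma> a i))"
  "carries {[AntiGhost a, Ghost b] |b. True} (var (AntiGhost a) * div_D f g Ghost a)"
  "carries {[AntiPhi a, BGhost b] |b. True} (var (AntiPhi a) * div_D f g BGhost a)"
  "carries {[AntiPhi a, Ghost b, TGhost c \<mu>] |b c \<mu>. True} (var (AntiPhi a) * ghost_source f g a)"
  "carries {[AntiChi a i, Ghost b] |b. True} (var (AntiChi a i) * ghost_deriv f g (sd_curv f g \<sigma> a i))"
  by (rule carries_mono[OF carries_var_mult], 
      rule carries_div_A carries_psi_deriv[OF carries_div_A] carries_sd_curv carries_psi_deriv[OF carries_sd_curv]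
       carries_div_D carries_ghost_source carries_ghost_deriv[OF carries_sd_curv], auto)+

lemma vertex_in_tym_vertices:
  assumes "topological_invariant S0" "Js \<noteq> []" "length ks = length Js" "sum_list ks = 0"
    and "vertex anticommuting (tym_action f g \<sigma> S0) Js ks \<noteq> 0"
  shows "mset (filter (\<lambda>x. \<not> is_gauge x) Js) \<in> tym_vertices"
proof (rule ccontr)
  assume *: "\<not> ?thesis"
  have z: "vertex anticommuting P Js ks = 0" if "carries X P" "mset ` X \<subseteq> tym_vertices" for P X
    using that * by (intro vertex_eq_0[of X]) auto
  have zs:
    "\<And>a. vertex anticommuting (var (LNb a) * div_A a) Js ks = 0"
    "\<And>a. vertex anticommuting (var (AntiEta a) * psi_deriv (div_A a)) Js ks = 0"
    "\<And>a i. vertex anticommuting (var (LNB a i) * sd_curv f g \<sigma> a i) Js ks = 0"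
    "\<And>a i. vertex anticommuting (var (AntiChi a i) * psi_deriv (sd_curv f g \<sigma> a i)) Js ks = 0"
    "\<And>a. vertex anticommuting (var (AntiGhost a) * div_D f g Ghost a) Js ks = 0"
    "\<And>a. vertex anticommuting (var (AntiPhi a) * div_D f g BGhost a) Js ks = 0"
    "\<And>a. vertex anticommuting (var (AntiPhi a) * ghost_source f g a) Js ks = 0"
    "\<And>a i. vertex anticommuting (var (AntiChi a i) * ghost_deriv f g (sd_curv f g \<sigma> a i)) Js ks = 0"
    by (rule z[OF carries_terms(1)] z[OF carries_terms(2)] z[OF carries_terms(3)] z[OF carries_terms(4)]
        z[OF carries_terms(5)] z[OF carries_terms(6)] z[OF carries_terms(7)] z[OF carries_terms(8)],
        auto simp: image_subset_iff tym_vertices.intros)+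
  show False
    using assms(5) unfolding vertex_tym_action[OF assms(1-4)] zs by simp
qed

section \<open>Exchange of bosons and fermions in a vertex\<close>

text \<open>The pairing follows the roles in the action and not s: b goes with \<eta>-bar because
  they multiply \<partial>A and \<partial>\<psi>, although s maps c-bar to b.\<close>

primrec partner :: "'a tym_field \<Rightarrow> 'a tym_field" where
  "partner (Gauge a \<mu>) = TGhost a \<mu>"
| "partner (TGhost a \<mu>) = Gauge a \<mu>"
| "partner (Ghost a) = BGhost a"
| "partner (BGhost a) = Ghost a"
| "partner (AntiGhost a) = AntiPhi a"
| "partner (LNb a) = AntiEta a"
| "partner (AntiPhi a) = AntiGhost a"
| "partner (AntiEta a) = LNb a"
| "partner (AntiChi a i) = LNB a i"
| "partner (LNB a i) = AntiChi a i"

primrec barred :: "'a tym_field \<Rightarrow> bool" where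
  "barred (Gauge a \<mu>) = False"
| "barred (TGhost a \<mu>) = False"
| "barred (Ghost a) = False"
| "barred (BGhost a) = False"
| "barred (AntiGhost a) = True"
| "barred (LNb a) = True"
| "barred (AntiPhi a) = True"
| "barred (AntiEta a) = True"
| "barred (AntiChi a i) = True"
| "barred (LNB a i) = True"

text \<open>A sector is a kind of line: an unbarred field together with the barred fields into which
  it can propagate.\<close>

datatype sector = Sector_A | Sector_psi | Sector_c | Sector_phi

primrec sector_of :: "'a tym_field \<Rightarrow> sector" where
  "sector_of (Gauge a \<mu>) = Sector_A"
| "sector_of (TGhost a \<mu>) = Sector_psi"
| "sector_of (Ghost a) = Sector_c"
| "sector_of (BGhost a) = Sector_phi"
| "sector_of (AntiGhost a) = Sector_c"
| "sector_of (LNb a) = Sector_A"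
| "sector_of (AntiPhi a) = Sector_phi"
| "sector_of (AntiEta a) = Sector_psi"
| "sector_of (AntiChi a i) = Sector_psi"
| "sector_of (LNB a i) = Sector_A"

text \<open>The sign comes from \<open>s (\<chi> F) = B F - \<chi> s F\<close>, where \<open>\<chi>\<close> is odd.\<close>

definition toggle_sign :: "'a tym_field \<Rightarrow> complex" where
  "toggle_sign x = (case x of AntiChi a i \<Rightarrow> -1 | LNB a i \<Rightarrow> -1 | _ \<Rightarrow> 1)"

lemma partner_partner [simp]: "partner (partner x) = x"
  by (cases x) simp_all

lemma partner_eq_iff: "partner x = partner y \<longleftrightarrow> x = y"
  by (metis partner_partner)

lemma barred_partner [simp]: "barred (partner x) = barred x"
  by (cases x) simp_all

lemma toggle_sign_partner [simp]: "toggle_sign (partner x) = toggle_sign x"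
  by (cases x) (simp_all add: toggle_sign_def)

lemma toggle_sign_square [simp]: "toggle_sign x * toggle_sign x = 1"
  by (cases x) (simp_all add: toggle_sign_def)

lemma anticommuting_partner [simp]: "anticommuting (partner x) \<longleftrightarrow> \<not> anticommuting x"
  by (cases x) (simp_all add: anticommuting_def)

definition toggle_letter :: "'a tym_field \<times> 'b \<Rightarrow> 'a tym_field \<times> 'b" where
  "toggle_letter l = (partner (fst l), snd l)"

lemma toggle_letter_simps [simp]: "fst (toggle_letter l) = partner (fst l)" "snd (toggle_letter l) = snd l"
    "toggle_letter (x, ds) = (partner x, ds)"
  by (simp_all add: toggle_letter_def)

text \<open>The part of \<open>word_vertex\<close>, without signs, in which letters \<open>i\<close>
  and \<open>j\<close> fill slots \<open>p\<close> and \<open>q\<close>. On this part the reordering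
  sign is constant, so a bosonic and a fermionic vertex can be compared through it.\<close>

definition slot_sum ::
    "('k \<times> 4 list) list \<Rightarrow> 'k list \<Rightarrow> momentum list \<Rightarrow> nat \<Rightarrow> nat \<Rightarrow> nat \<Rightarrow> nat \<Rightarrow> complex" where
  "slot_sum ls Js ks i j p q =
     (\<Sum>\<pi> | \<pi> permutes {..<length Js} \<and> \<pi> i = p \<and> \<pi> j = q.
        \<Prod>r<length Js. if fst (ls ! r) = Js ! \<pi> r
                      then derivative_factor (snd (ls ! r)) (ks ! \<pi> r) else 0)"

lemma slot_sum_toggle:
  assumes "length ls = length Js" "i \<noteq> j" "p \<noteq> q" "i < length Js" "j < length Js" "p < length Js" "q < length Js"
  shows "slot_sum (ls[i := toggle_letter (ls ! i), j := toggle_letter (ls ! j)])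
      (Js[p := partner (Js ! p), q := partner (Js ! q)]) ks i j p q = slot_sum ls Js ks i j p q"
  unfolding slot_sum_def
proof (rule sum.cong)
  fix \<pi> assume "\<pi> \<in> {\<pi>. \<pi> permutes {..<length Js} \<and> \<pi> i = p \<and> \<pi> j = q}"
  then have \<pi>: "\<pi> permutes {..<length Js}" "\<pi> i = p" "\<pi> j = q" by auto
  let ?ls = "ls[i := toggle_letter (ls ! i), j := toggle_letter (ls ! j)]"
  let ?Js = "Js[p := partner (Js ! p), q := partner (Js ! q)]"
  have "(if fst (?ls ! r) = ?Js ! \<pi> r then derivative_factor (snd (?ls ! r)) (ks ! \<pi> r) else 0)
      = (if fst (ls ! r) = Js ! \<pi> r then derivative_factor (snd (ls ! r)) (ks ! \<pi> r) else 0)"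
    if "r < length Js" for r
  proof -
    \<comment> \<open>By injectivity the altered slots are filled by the altered letters and by no
      others, so every matching condition survives.\<close>
    have "\<pi> r = p \<longleftrightarrow> r = i" "\<pi> r = q \<longleftrightarrow> r = j"
      using permutes_inj[OF \<pi>(1)] \<pi>(2,3) by (auto dest: injD)
    then show ?thesis
      using assms that by (auto simp: nth_list_update partner_eq_iff)
  qed
  then show "(\<Prod>r<length ?Js. if fst (?ls ! r) = ?Js ! \<pi> r then derivative_factor (snd (?ls ! r)) (ks ! \<pi> r) else 0)
      = (\<Prod>r<length Js. if fst (ls ! r) = Js ! \<pi> r then derivative_factor (snd (ls ! r)) (ks ! \<pi> r) else 0)"
    by simp
qed simp

text \<open>At most two slots are odd, so the letters \<open>i\<close> and \<open>j\<close> form the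
  only possible inversion.\<close>

lemma reorder_sign_pair:
  assumes \<pi>: "\<pi> permutes {..<length Js}" "\<pi> i = p" "\<pi> j = q" and "i < j" "j < length Js"
    and gr: "\<And>r. r < length Js \<Longrightarrow> r \<noteq> p \<Longrightarrow> r \<noteq> q \<Longrightarrow> \<not> gr (Js ! r)" "gr (Js ! p) \<longleftrightarrow> gr (Js ! q)"
  shows "reorder_sign gr Js \<pi> = (if gr (Js ! p) \<and> q < p then -1 else 1)"
proof -
  have eq: "\<pi> r = p \<longleftrightarrow> r = i" "\<pi> r = q \<longleftrightarrow> r = j" for r
    using permutes_inj[OF \<pi>(1)] \<pi>(2,3) by (auto dest: injD)
  have lt: "\<pi> r < length Js" if "r < length Js" for r
    using permutes_in_image[OF \<pi>(1)] that by auto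
  have "{(r, s). r < s \<and> s < length Js \<and> \<pi> s < \<pi> r \<and> gr (Js ! \<pi> r) \<and> gr (Js ! \<pi> s)} =
      (if gr (Js ! p) \<and> q < p then {(i, j)} else {})" (is "?A = ?B")
  proof (intro equalityI subsetI)
    fix x assume "x \<in> ?A"
    then obtain r s where x: "x = (r, s)" "r < s" "s < length Js" "\<pi> s < \<pi> r" "gr (Js ! \<pi> r)" "gr (Js ! \<pi> s)"
      by auto
    then have "r = i \<or> r = j" "s = i \<or> s = j"
      using gr(1)[OF lt, of r] gr(1)[OF lt, of s] eq by auto
    then show "x \<in> ?B" using x assms by auto
  next
    fix x assume "x \<in> ?B"
    then show "x \<in> ?A" using assms by (auto split: if_splits)
  qed
  then show ?thesis by (simp add: reorder_sign_def)
qed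

text \<open>The components in slots \<open>p\<close> and \<open>q\<close> occur in one letter each,
  so any permutation that places these letters elsewhere meets a mismatch and contributes 0.\<close>

lemma word_vertex_eq_slot_sum:
  assumes len: "length ls = length Js" and ij: "i < j" "j < length Js"
    and gr: "\<And>r. r < length Js \<Longrightarrow> r \<noteq> p \<Longrightarrow> r \<noteq> q \<Longrightarrow> \<not> gr (Js ! r)" "gr (Js ! p) \<longleftrightarrow> gr (Js ! q)"
    and pq: "p < length Js" "q < length Js"
    and uniq: "\<And>r. r < length Js \<Longrightarrow> fst (ls ! r) = Js ! p \<Longrightarrow> r = i"
      "\<And>r. r < length Js \<Longrightarrow> fst (ls ! r) = Js ! q \<Longrightarrow> r = j"
  shows "word_vertex gr ls Js ks = (if gr (Js ! p) \<and> q < p then -1 else 1) * slot_sum ls Js ks i j p q"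
proof -
  let ?F = "\<lambda>\<pi>. \<Prod>r<length Js. if fst (ls ! r) = Js ! \<pi> r
                      then derivative_factor (snd (ls ! r)) (ks ! \<pi> r) else 0"
  let ?S = "{\<pi>. \<pi> permutes {..<length Js}}" and ?T = "{\<pi>. \<pi> permutes {..<length Js} \<and> \<pi> i = p \<and> \<pi> j = q}"
  have "?F \<pi> = 0" if \<pi>: "\<pi> \<in> ?S - ?T" for \<pi>
  proof (rule ccontr)
    assume nz: "?F \<pi> \<noteq> 0"
    have perm: "\<pi> permutes {..<length Js}" using \<pi> by simp
    have F: "fst (ls ! r) = Js ! \<pi> r" if "r < length Js" for r
      using nz that by (auto simp: prod_zero_iff split: if_splits)
    have "\<pi> i = p"
      using uniq(1)[of "inv \<pi> p"] F[of "inv \<pi> p"] pq permutes_inverses[OF perm] permutes_in_image[OF permutes_inv[OF perm], of p]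
      by auto
    moreover have "\<pi> j = q"
      using uniq(2)[of "inv \<pi> q"] F[of "inv \<pi> q"] pq permutes_inverses[OF perm] permutes_in_image[OF permutes_inv[OF perm], of q]
      by auto
    ultimately show False using \<pi> by auto
  qed
  then have "(\<Sum>\<pi>\<in>?S. reorder_sign gr Js \<pi> * ?F \<pi>) = (\<Sum>\<pi>\<in>?T. reorder_sign gr Js \<pi> * ?F \<pi>)"
    by (intro sum.mono_neutral_right) (auto simp: finite_permutations)
  also have "\<dots> = (\<Sum>\<pi>\<in>?T. (if gr (Js ! p) \<and> q < p then -1 else 1) * ?F \<pi>)"
    by (intro sum.cong refl arg_cong2[where f = "(*)"] reorder_sign_pair) (use assms in auto)
  finally show ?thesis
    using len by (simp add: word_vertex_def slot_sum_def sum_distrib_left)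
qed

text \<open>The bosonic side of the exchange of A with \<psi>: slot \<open>q\<close> holds an A that
  may stem from any letter \<open>j\<close> other than the barred one. This sum over
  \<open>j\<close> is the one that the Leibniz rule produces on the \<psi> side.\<close>

lemma word_vertex_eq_slot_sums:
  assumes len: "length ls = length Js" and i: "i < length Js"
    and gr: "\<And>r. r < length Js \<Longrightarrow> \<not> gr (Js ! r)"
    and pq: "p < length Js" "q < length Js" "p \<noteq> q"
    and uniq: "\<And>r. r < length Js \<Longrightarrow> fst (ls ! r) = Js ! p \<Longrightarrow> r = i"
  shows "word_vertex gr ls Js ks = (\<Sum>j\<in>{..<length Js} - {i}. slot_sum ls Js ks i j p q)"
proof -
  let ?F = "\<lambda>\<pi>. \<Prod>r<length Js. if fst (ls ! r) = Js ! \<pi> r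
                      then derivative_factor (snd (ls ! r)) (ks ! \<pi> r) else 0"
  let ?S = "{\<pi>. \<pi> permutes {..<length Js}}" and ?T = "\<lambda>j. {\<pi>. \<pi> permutes {..<length Js} \<and> \<pi> i = p \<and> \<pi> j = q}"
  have "?F \<pi> = 0" if \<pi>: "\<pi> \<in> ?S - (\<Union>j\<in>{..<length Js} - {i}. ?T j)" for \<pi>
  proof (rule ccontr)
    assume nz: "?F \<pi> \<noteq> 0"
    have perm: "\<pi> permutes {..<length Js}" using \<pi> by simp
    have F: "fst (ls ! r) = Js ! \<pi> r" if "r < length Js" for r
      using nz that by (auto simp: prod_zero_iff split: if_splits)
    have "\<pi> i = p"
      using uniq(1)[of "inv \<pi> p"] F[of "inv \<pi> p"] pq permutes_inverses[OF perm] permutes_in_image[OF permutes_inv[OF perm], of p]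
      by auto
    moreover have "\<pi> (inv \<pi> q) = q" "inv \<pi> q < length Js"
      using pq permutes_inverses[OF perm] permutes_in_image[OF permutes_inv[OF perm], of q] by auto
    ultimately show False using \<pi> pq(3) by auto
  qed
  then have "(\<Sum>\<pi>\<in>?S. ?F \<pi>) = (\<Sum>\<pi>\<in>(\<Union>j\<in>{..<length Js} - {i}. ?T j). ?F \<pi>)"
    by (intro sum.mono_neutral_right) (auto simp: finite_permutations)
  also have "\<dots> = (\<Sum>j\<in>{..<length Js} - {i}. \<Sum>\<pi>\<in>?T j. ?F \<pi>)"
  proof (rule sum.UNION_disjoint)
    show "\<forall>j\<in>{..<length Js} - {i}. finite (?T j)"
      by (auto intro: finite_subset[OF _ finite_permutations[of "{..<length Js}"]])
    show "\<forall>j\<in>{..<length Js} - {i}. \<forall>k\<in>{..<length Js} - {i}. j \<noteq> k \<longrightarrow> ?T j \<inter> ?T k = {}"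
      by (auto dest: permutes_inj injD)
  qed simp
  moreover have "reorder_sign gr Js \<pi> = 1" if "\<pi> permutes {..<length Js}" for \<pi>
  proof -
    have empty: "{(r, s). r < s \<and> s < length Js \<and> \<pi> s < \<pi> r \<and> gr (Js ! \<pi> r) \<and> gr (Js ! \<pi> s)} = {}"
      using gr permutes_in_image[OF that] by (auto dest: order.strict_trans)
    show ?thesis unfolding reorder_sign_def empty by simp
  qed
  ultimately show ?thesis
    using len by (simp add: word_vertex_def slot_sum_def)
qed

lemma anticommuting_simps [simp]:
  "\<not> anticommuting (Gauge a \<mu>)" "anticommuting (TGhost a \<mu>)" "anticommuting (Ghost a)" "\<not> anticommuting (BGhost a)"
  "anticommuting (AntiGhost a)" "\<not> anticommuting (LNb a)" "\<not> anticommuting (AntiPhi a)" "anticommuting (AntiEta a)"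
  "anticommuting (AntiChi a i)" "\<not> anticommuting (LNB a i)"
  by (simp_all add: anticommuting_def)

text \<open>All letters are A and hence even, so the graded Leibniz rule yields no signs.\<close>

lemma psi_deriv_word:
  assumes "matter ls = []"
  shows "odd_derivation_letters anticommuting psi_value ls =
    (\<Sum>j<length ls. Poly_Mapping.single (FWord (ls[j := toggle_letter (ls ! j)])) 1)"
  using assms
proof (induction ls)
  case (Cons l ls)
  then obtain a \<mu> ds where l: "l = (Gauge a \<mu>, ds)" and ls: "matter ls = []"
    by (cases l; cases "fst l") auto
  have "odd_derivation_letters anticommuting psi_value (l # ls) =
      letter (TGhost a \<mu>, ds) * Poly_Mapping.single (FWord ls) 1
      + letter l * (\<Sum>j<length ls. Poly_Mapping.single (FWord (ls[j := toggle_letter (ls ! j)])) 1)"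
    using Cons.IH[OF ls] by (simp add: l foldr_pd_letter psi_value_def[of "Gauge a \<mu>"] var_def)
  then show ?case
    by (simp add: l letter_mult_single sum_distrib_left sum.lessThan_Suc_shift del: sum.lessThan_Suc)
qed simp

lemma matter_Nil_nth: "matter ls = [] \<Longrightarrow> r < length ls \<Longrightarrow> is_gauge (fst (ls ! r))"
  by (auto simp: matter_def filter_empty_conv)

text \<open>After the exchange the toggled letter is the only \<psi> and just two slots are odd, so
  each word reduces to a single slot sum with a transposition sign. Before it everything commutes
  and the same slot sums are simply added.\<close>

lemma word_vertex_toggle_A:
  assumes ls: "matter ls = []" and pq: "p < length Js" "q < length Js" "p \<noteq> q"
    and Js: "\<And>r. r < length Js \<Longrightarrow> r \<noteq> p \<Longrightarrow> is_gauge (Js ! r)"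
    and \<beta>: "barred \<beta>" "sector_of \<beta> = Sector_A" and Jp: "barred (Js ! p)" "sector_of (Js ! p) = Sector_A"
  shows "(\<Sum>j<length ls. word_vertex anticommuting ((partner \<beta>, []) # ls[j := toggle_letter (ls ! j)])
            (Js[p := partner (Js ! p), q := partner (Js ! q)]) ks) =
    (if q < p then -1 else 1) * word_vertex anticommuting ((\<beta>, []) # ls) Js ks"
proof (cases "length Js = Suc (length ls)")
  case len: True
  have even: "\<not> anticommuting x" if "is_gauge x \<or> barred x \<and> sector_of x = Sector_A" for x :: "'a tym_field"
    using that by (cases x) auto
  have gauge_not_barred: "\<not> barred x" if "is_gauge x" for x :: "'a tym_field"
    using that by (cases x) auto
  have gauge_not_barred: "\<not> barred (fst (ls ! r))" if "r < length ls" for r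
    using matter_Nil_nth[OF ls that] by (rule gauge_not_barred)
  have gauge_not_psi: "sector_of x = Sector_A" if "is_gauge x" for x :: "'a tym_field"
    using that by (cases x) auto
  have psi: "sector_of (partner x) = Sector_psi" if "is_gauge x" for x :: "'a tym_field"
    using that by (cases x) auto
  let ?Js = "Js[p := partner (Js ! p), q := partner (Js ! q)]"
  have "word_vertex anticommuting ((\<beta>, []) # ls) Js ks =
      (\<Sum>j\<in>{..<length Js} - {0}. slot_sum ((\<beta>, []) # ls) Js ks 0 j p q)"
  proof (rule word_vertex_eq_slot_sums)
    show "\<not> anticommuting (Js ! r)" if "r < length Js" for r
      using Js[OF that] Jp by (intro even) auto
    show "r = 0" if "r < length Js" "fst (((\<beta>, []) # ls) ! r) = Js ! p" for r
      using that Jp(1) gauge_not_barred[of "r - 1"] len by (cases r) auto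
  qed (use len pq in auto)
  also have "{..<length Js} - {0} = Suc ` {..<length ls}"
    unfolding len lessThan_Suc_eq_insert_0 by auto
  finally have 1: "word_vertex anticommuting ((\<beta>, []) # ls) Js ks =
      (\<Sum>j<length ls. slot_sum ((\<beta>, []) # ls) Js ks 0 (Suc j) p q)"
    by (simp add: sum.reindex)
  have 2: "word_vertex anticommuting ((partner \<beta>, []) # ls[j := toggle_letter (ls ! j)]) ?Js ks
      = (if q < p then -1 else 1) * slot_sum ((\<beta>, []) # ls) Js ks 0 (Suc j) p q" if j: "j < length ls" for j
  proof -
    let ?ls = "((\<beta>, []) # ls)[0 := toggle_letter (((\<beta>, []) # ls) ! 0),
        Suc j := toggle_letter (((\<beta>, []) # ls) ! Suc j)]"
    have "word_vertex anticommuting ?ls ?Js ks = (if anticommuting (?Js ! p) \<and> q < p then -1 else 1) * slot_sum ?ls ?Js ks 0 (Suc j) p q"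
    proof (rule word_vertex_eq_slot_sum)
      show "\<not> anticommuting (?Js ! r)" if "r < length ?Js" "r \<noteq> p" "r \<noteq> q" for r
        using Js[of r] that even[of "Js ! r"] by auto
      show "anticommuting (?Js ! p) = anticommuting (?Js ! q)"
        using pq Js[of q] Jp even by (auto simp: nth_list_update)
      show "r = 0" if "r < length ?Js" "fst (?ls ! r) = ?Js ! p" for r
      proof (rule ccontr)
        assume "r \<noteq> 0"
        then have "\<not> barred (fst (?ls ! r))"
          using that(1) len j gauge_not_barred by (cases r) (auto simp: nth_list_update)
        then show False using that pq Jp by (auto simp: nth_list_update)
      qed
      show "r = Suc j" if "r < length ?Js" "fst (?ls ! r) = ?Js ! q" for r
      proof (rule ccontr)
        assume "r \<noteq> Suc j"
        then have "barred (fst (?ls ! r)) \<or> sector_of (fst (?ls ! r)) = Sector_A"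
          using that(1) len j matter_Nil_nth[OF ls] \<beta> by (cases r) (auto simp: nth_list_update gauge_not_psi)
        moreover have "\<not> barred (?Js ! q)" "sector_of (?Js ! q) = Sector_psi"
          using pq Js[of q] by (cases "Js ! q"; simp add: psi)+
        ultimately show False using that by auto
      qed
    qed (use len pq j in auto)
    also have "slot_sum ?ls ?Js ks 0 (Suc j) p q = slot_sum ((\<beta>, []) # ls) Js ks 0 (Suc j) p q"
      by (rule slot_sum_toggle) (use len pq j in auto)
    finally show ?thesis
      using pq Jp even[of "Js ! p"] by (simp add: nth_list_update)
  qed
  show ?thesis
    unfolding 1 sum_distrib_left by (intro sum.cong refl 2) simp
next
  case False
  then show ?thesis by (simp add: word_vertex_def)
qed

lemma vertex_toggle_A:
  assumes Q: "carries {[]} Q" and pq: "p < length Js" "q < length Js" "p \<noteq> q"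
    and Js: "\<And>r. r < length Js \<Longrightarrow> r \<noteq> p \<Longrightarrow> is_gauge (Js ! r)"
    and \<beta>: "barred \<beta>" "sector_of \<beta> = Sector_A" and Jp: "barred (Js ! p)" "sector_of (Js ! p) = Sector_A"
  shows "vertex anticommuting (var (partner \<beta>) * psi_deriv Q) (Js[p := partner (Js ! p), q := partner (Js ! q)]) ks =
    (if q < p then -1 else 1) * vertex anticommuting (var \<beta> * Q) Js ks"
proof (rule dpoly_induct_keys[of "{w. matter (letters w) = []}" _ Q])
  fix w :: "'a tym_field fword" and c assume "w \<in> {w. matter (letters w) = []}"
  then have w: "matter (letters w) = []" by simp
  have "psi_deriv (Poly_Mapping.single w c) = cst c * (\<Sum>j<length (letters w).
      Poly_Mapping.single (FWord ((letters w)[j := toggle_letter (letters w ! j)])) 1)"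
    by (simp add: psi_deriv_def odd_derivation_def psi_deriv_word[OF w])
  then have "vertex anticommuting (var (partner \<beta>) * psi_deriv (Poly_Mapping.single w c)) Js' ks =
     c * (\<Sum>j<length (letters w). word_vertex anticommuting ((partner \<beta>, []) # (letters w)[j := toggle_letter (letters w ! j)])
            Js' ks)" for Js'
    by (simp add: cst_left_commute[of "var _"] vertex_linear)
      (simp add: var_def sum_distrib_left letter_mult_single vertex_linear)
  then show "vertex anticommuting (var (partner \<beta>) * psi_deriv (Poly_Mapping.single w c)) (Js[p := partner (Js ! p), q := partner (Js ! q)]) ks =
    (if q < p then -1 else 1) * vertex anticommuting (var \<beta> * Poly_Mapping.single w c) Js ks"
    by (simp add: word_vertex_toggle_A[OF w pq Js \<beta> Jp] var_def letter_mult_single)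
next
  show "Poly_Mapping.keys Q \<subseteq> {w. matter (letters w) = []}"
    using Q by (auto simp: carries_def)
qed (simp_all add: psi_deriv_def odd_derivation_linear distrib_left vertex_linear)

text \<open>Neither c nor c-bar occurs twice in the word, so both sides are single slot sums. Here
  the sign belongs to the side before the exchange, where c and c-bar are odd.\<close>

lemma word_vertex_toggle_c:
  assumes ls: "j \<noteq> 0" "j < length ls" "fst (ls ! 0) = AntiGhost e" "fst (ls ! j) = Ghost e'"
      "\<And>r. r < length ls \<Longrightarrow> r \<noteq> 0 \<Longrightarrow> r \<noteq> j \<Longrightarrow> is_gauge (fst (ls ! r))"
    and pq: "p < length Js" "q < length Js" "p \<noteq> q"
    and Js: "\<And>r. r < length Js \<Longrightarrow> r \<noteq> p \<Longrightarrow> r \<noteq> q \<Longrightarrow> is_gauge (Js ! r)"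
      "Js ! p = AntiGhost d" "Js ! q = Ghost d'"
  shows "word_vertex anticommuting (ls[0 := toggle_letter (ls ! 0), j := toggle_letter (ls ! j)])
      (Js[p := partner (Js ! p), q := partner (Js ! q)]) ks =
    (if q < p then -1 else 1) * word_vertex anticommuting ls Js ks"
proof (cases "length Js = length ls")
  case len: True
  let ?Js = "Js[p := partner (Js ! p), q := partner (Js ! q)]"
  let ?ls = "ls[0 := toggle_letter (ls ! 0), j := toggle_letter (ls ! j)]"
  have even: "\<not> anticommuting x" if "is_gauge x" for x :: "'a tym_field"
    using that by (cases x) auto
  have "word_vertex anticommuting ls Js ks = (if anticommuting (Js ! p) \<and> q < p then -1 else 1) * slot_sum ls Js ks 0 j p q"
  proof (rule word_vertex_eq_slot_sum)
    show "r = 0" if "r < length Js" "fst (ls ! r) = Js ! p" for r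
      using that ls(1-4) ls(5)[of r] pq Js(2,3) len by (cases "r = 0"; cases "r = j") auto
    show "r = j" if "r < length Js" "fst (ls ! r) = Js ! q" for r
      using that ls(1-4) ls(5)[of r] pq Js(2,3) len by (cases "r = 0"; cases "r = j") auto
  qed (use assms len even in auto)
  moreover have "word_vertex anticommuting ?ls ?Js ks = (if anticommuting (?Js ! p) \<and> q < p then -1 else 1) * slot_sum ?ls ?Js ks 0 j p q"
  proof (rule word_vertex_eq_slot_sum)
    show "r = 0" if "r < length ?Js" "fst (?ls ! r) = ?Js ! p" for r
      using that ls(1-4) ls(5)[of r] pq Js(2,3) len by (cases "r = 0"; cases "r = j") (auto simp: nth_list_update)
    show "r = j" if "r < length ?Js" "fst (?ls ! r) = ?Js ! q" for r
      using that ls(1-4) ls(5)[of r] pq Js(2,3) len by (cases "r = 0"; cases "r = j") (auto simp: nth_list_update)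
  qed (use assms len even in \<open>auto simp: nth_list_update\<close>)
  moreover have "slot_sum ?ls ?Js ks 0 j p q = slot_sum ls Js ks 0 j p q"
    by (rule slot_sum_toggle) (use assms len in auto)
  ultimately show ?thesis using pq Js by simp
next
  case False
  then show ?thesis by (simp add: word_vertex_def)
qed

lemma div_D_expand:
  "div_D f g x a = (\<Sum>\<mu>\<in>UNIV. letter (x a, [\<mu>, \<mu>]) - (\<Sum>b\<in>UNIV. \<Sum>c\<in>UNIV. rc (g * f a b c) *
     (letter (Gauge c \<mu>, [\<mu>]) * letter (x b, []) + letter (Gauge c \<mu>, []) * letter (x b, [\<mu>]))))"
  unfolding div_D_def cov_deriv_def rc_def
  by (simp add: pd_linear var_def pd_letter pd_letter_mult mult.assoc)

lemma vertex_toggle_c: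
  assumes pq: "p < length Js" "q < length Js" "p \<noteq> q"
    and Js: "\<And>r. r < length Js \<Longrightarrow> r \<noteq> p \<Longrightarrow> r \<noteq> q \<Longrightarrow> is_gauge (Js ! r)"
      "Js ! p = AntiGhost d" "Js ! q = Ghost d'"
  shows "vertex anticommuting (var (AntiPhi a) * div_D f g BGhost a) (Js[p := partner (Js ! p), q := partner (Js ! q)]) ks =
    (if q < p then -1 else 1) * vertex anticommuting (var (AntiGhost a) * div_D f g Ghost a) Js ks"
proof -
  let ?Js = "Js[p := partner (Js ! p), q := partner (Js ! q)]"
  let ?s = "if q < p then -1 else 1 :: complex"
  have quadratic: "word_vertex anticommuting [(AntiPhi a, []), (BGhost b, ds)] ?Js ks =
      ?s * word_vertex anticommuting [(AntiGhost a, []), (Ghost b, ds)] Js ks" for b ds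
    using word_vertex_toggle_c[of 1 "[(AntiGhost a, []), (Ghost b, ds)]" a b p Js q d d' ks, OF _ _ _ _ _ pq Js]
    by (simp add: less_2_cases_iff)
  have cubic: "word_vertex anticommuting [(AntiPhi a, []), (Gauge c \<mu>, es), (BGhost b, ds)] ?Js ks =
      ?s * word_vertex anticommuting [(AntiGhost a, []), (Gauge c \<mu>, es), (Ghost b, ds)] Js ks" for b c \<mu> ds es
    using word_vertex_toggle_c[of 2 "[(AntiGhost a, []), (Gauge c \<mu>, es), (Ghost b, ds)]" a b p Js q d d' ks, OF _ _ _ _ _ pq Js]
    by (auto simp: numeral_3_eq_3 less_Suc_eq)
  have expand: "vertex anticommuting (var y * div_D f g x a) Ks ks =
      (\<Sum>\<mu>\<in>UNIV. word_vertex anticommuting [(y, []), (x a, [\<mu>, \<mu>])] Ks ks -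
       (\<Sum>b\<in>UNIV. \<Sum>c\<in>UNIV. complex_of_real (g * f a b c) *
         (word_vertex anticommuting [(y, []), (Gauge c \<mu>, [\<mu>]), (x b, [])] Ks ks
         + word_vertex anticommuting [(y, []), (Gauge c \<mu>, []), (x b, [\<mu>])] Ks ks)))" for x y Ks
    unfolding div_D_expand rc_def
    by (simp add: sum_distrib_left right_diff_distrib cst_left_commute[of "var _"] distrib_left vertex_linear)
      (simp add: var_def letter_mult_single vertex_linear letter_def[of "(x _, _)"])
  show ?thesis
    unfolding expand quadratic cubic
    by (simp add: sum_distrib_left right_diff_distrib distrib_left mult_ac)
qed

lemma mset_filter_nth: "mset (filter P xs) = image_mset ((!) xs) (mset_set {r. r < length xs \<and> P (xs ! r)})"
proof -
  have "filter P xs = map ((!) xs) (filter (\<lambda>r. P (xs ! r)) [0..<length xs])"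
    by (metis (no_types) comp_apply filter_cong filter_map map_nth)
  then have "mset (filter P xs) = image_mset ((!) xs) (mset (filter (\<lambda>r. P (xs ! r)) [0..<length xs]))"
    by simp
  also have "mset (filter (\<lambda>r. P (xs ! r)) [0..<length xs]) = mset_set (set (filter (\<lambda>r. P (xs ! r)) [0..<length xs]))"
    by (rule mset_set_set[symmetric]) simp
  also have "set (filter (\<lambda>r. P (xs ! r)) [0..<length xs]) = {r. r < length xs \<and> P (xs ! r)}"
    by auto
  finally show ?thesis .
qed

lemma is_gauge_not_barred: "is_gauge x \<longleftrightarrow> \<not> barred x \<and> sector_of x = Sector_A"
  by (cases x) auto

lemma mset_matter_pair:
  assumes "\<And>r. r < length Js \<Longrightarrow> r \<noteq> p \<Longrightarrow> r \<noteq> q \<Longrightarrow> is_gauge (Js ! r)" 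
    and pq: "p < length Js" "q < length Js" "p \<noteq> q" and "\<not> is_gauge (Js ! p)"
  shows "mset (filter (\<lambda>x. \<not> is_gauge x) Js) = (if is_gauge (Js ! q) then {#Js ! p#} else {#Js ! p, Js ! q#})"
proof -
  have "{r. r < length Js \<and> \<not> is_gauge (Js ! r)} = (if is_gauge (Js ! q) then {p} else {p, q})"
    using assms by auto
  then show ?thesis
    using pq(3) unfolding mset_filter_nth by simp
qed

text \<open>The sign of bringing two odd legs into the order of the word: \<open>p\<close> is the
  slot of the barred field, which stands first in every word of the gauge-fixing terms.\<close>

definition transposed :: "nat \<Rightarrow> nat \<Rightarrow> complex" where
  "transposed p q = (if q < p then -1 else 1)"

section \<open>Vertices and propagators of the theory\<close>

locale tym =
  fixes f :: "'a::finite \<Rightarrow> 'a \<Rightarrow> 'a \<Rightarrow> real" and g \<sigma> :: real and S0 :: "'a tym_field dpoly"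
  assumes S0: "topological_invariant S0"
begin

abbreviation "V \<equiv> vertex anticommuting (tym_action f g \<sigma> S0)"

text \<open>Each of these contents occurs in exactly one of the sums of
  \<open>tym_action_eq\<close>, so fixing the content isolates that sum.\<close>

lemma vertex_by_matter:
  assumes "Js \<noteq> []" "length ks = length Js" "sum_list ks = 0"
  defines "M \<equiv> mset (filter (\<lambda>x. \<not> is_gauge x) Js)"
  shows "M = {#LNb d#} \<Longrightarrow> V Js ks = (\<Sum>a\<in>UNIV. vertex anticommuting (var (LNb a) * div_A a) Js ks)"
    and "M = {#AntiEta d, TGhost e \<mu>#} \<Longrightarrow>
      V Js ks = (\<Sum>a\<in>UNIV. vertex anticommuting (var (AntiEta a) * psi_deriv (div_A a)) Js ks)"
    and "M = {#LNB d i#} \<Longrightarrow>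
      V Js ks = (\<Sum>a\<in>UNIV. \<Sum>i\<in>UNIV. vertex anticommuting (var (LNB a i) * sd_curv f g \<sigma> a i) Js ks)"
    and "M = {#AntiChi d i, TGhost e \<mu>#} \<Longrightarrow>
      V Js ks = - (\<Sum>a\<in>UNIV. \<Sum>i\<in>UNIV. vertex anticommuting (var (AntiChi a i) * psi_deriv (sd_curv f g \<sigma> a i)) Js ks)"
    and "M = {#AntiGhost d, Ghost e#} \<Longrightarrow>
      V Js ks = (\<Sum>a\<in>UNIV. vertex anticommuting (var (AntiGhost a) * div_D f g Ghost a) Js ks)"
    and "M = {#AntiPhi d, BGhost e#} \<Longrightarrow>
      V Js ks = (\<Sum>a\<in>UNIV. vertex anticommuting (var (AntiPhi a) * div_D f g BGhost a) Js ks)"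
    and "M = {#AntiChi d i, Ghost e#} \<Longrightarrow>
      V Js ks = - (\<Sum>a\<in>UNIV. \<Sum>i\<in>UNIV. vertex anticommuting (var (AntiChi a i) * ghost_deriv f g (sd_curv f g \<sigma> a i)) Js ks)"
proof -
  have z: "vertex anticommuting P Js ks = 0" if "carries X P" "\<forall>x\<in>X. \<exists>y\<in>set x. y \<notin># M" for P X
    using that by (intro vertex_eq_0[of X]) (auto simp: M_def simp flip: set_mset_mset)
  have zs:
    "LNb a \<notin># M \<Longrightarrow> vertex anticommuting (var (LNb a) * div_A a) Js ks = 0"
    "AntiEta a \<notin># M \<Longrightarrow> vertex anticommuting (var (AntiEta a) * psi_deriv (div_A a)) Js ks = 0"
    "LNB a i \<notin># M \<Longrightarrow> vertex anticommuting (var (LNB a i) * sd_curv f g \<sigma> a i) Js ks = 0"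
    "AntiChi a i \<notin># M \<or> (\<forall>b \<mu>. TGhost b \<mu> \<notin># M) \<Longrightarrow> vertex anticommuting (var (AntiChi a i) * psi_deriv (sd_curv f g \<sigma> a i)) Js ks = 0"
    "AntiGhost a \<notin># M \<Longrightarrow> vertex anticommuting (var (AntiGhost a) * div_D f g Ghost a) Js ks = 0"
    "AntiPhi a \<notin># M \<Longrightarrow> vertex anticommuting (var (AntiPhi a) * div_D f g BGhost a) Js ks = 0"
    "AntiPhi a \<notin># M \<or> (\<forall>b. Ghost b \<notin># M) \<Longrightarrow> vertex anticommuting (var (AntiPhi a) * ghost_source f g a) Js ks = 0"
    "AntiChi a i \<notin># M \<or> (\<forall>b. Ghost b \<notin># M) \<Longrightarrow> vertex anticommuting (var (AntiChi a i) * ghost_deriv f g (sd_curv f g \<sigma> a i)) Js ks = 0"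
    for a i
    by (rule carries_terms[THEN z], force)+
  note simps = vertex_tym_action[OF S0 assms(1-3)] zs sum_negf
  show "V Js ks = (\<Sum>a\<in>UNIV. vertex anticommuting (var (LNb a) * div_A a) Js ks)" if "M = {#LNb d#}"
    by (simp add: simps that)
  show "V Js ks = (\<Sum>a\<in>UNIV. vertex anticommuting (var (AntiEta a) * psi_deriv (div_A a)) Js ks)" if "M = {#AntiEta d, TGhost e \<mu>#}"
    by (simp add: simps that)
  show "V Js ks = (\<Sum>a\<in>UNIV. \<Sum>i\<in>UNIV. vertex anticommuting (var (LNB a i) * sd_curv f g \<sigma> a i) Js ks)" if "M = {#LNB d i#}"
    by (simp add: simps that)
  show "V Js ks = - (\<Sum>a\<in>UNIV. \<Sum>i\<in>UNIV. vertex anticommuting (var (AntiChi a i) * psi_deriv (sd_curv f g \<sigma> a i)) Js ks)" if "M = {#AntiChi d i, TGhost e \<mu>#}"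
    by (simp add: simps that)
  show "V Js ks = (\<Sum>a\<in>UNIV. vertex anticommuting (var (AntiGhost a) * div_D f g Ghost a) Js ks)" if "M = {#AntiGhost d, Ghost e#}"
    by (simp add: simps that)
  show "V Js ks = (\<Sum>a\<in>UNIV. vertex anticommuting (var (AntiPhi a) * div_D f g BGhost a) Js ks)" if "M = {#AntiPhi d, BGhost e#}"
    by (simp add: simps that)
  show "V Js ks = - (\<Sum>a\<in>UNIV. \<Sum>i\<in>UNIV. vertex anticommuting (var (AntiChi a i) * ghost_deriv f g (sd_curv f g \<sigma> a i)) Js ks)" if "M = {#AntiChi d i, Ghost e#}"
    by (simp add: simps that)
qed

lemma vertex_toggle_sector_A:
  assumes ks: "length ks = length Js" "sum_list ks = 0"
    and pq: "p < length Js" "q < length Js" "p \<noteq> q"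
    and Js: "\<And>r. r < length Js \<Longrightarrow> r \<noteq> p \<Longrightarrow> is_gauge (Js ! r)"
    and Jp: "barred (Js ! p)" "sector_of (Js ! p) = Sector_A"
  shows "V (Js[p := partner (Js ! p), q := partner (Js ! q)]) ks =
    toggle_sign (Js ! p) * transposed p q * V Js ks"
proof -
  let ?Js = "Js[p := partner (Js ! p), q := partner (Js ! q)]"
  have ne: "Js \<noteq> []" using pq by auto
  then have ne': "?Js \<noteq> []" by simp
  have ks': "length ks = length ?Js" using ks by simp
  obtain b \<mu> where Jq: "Js ! q = Gauge b \<mu>" using Js[OF pq(2)] pq(3) by (cases "Js ! q") auto
  have m: "mset (filter (\<lambda>x. \<not> is_gauge x) Js) = {#Js ! p#}"
    using mset_matter_pair[of Js p q] Js pq Jp Js[of q] by (auto simp: is_gauge_not_barred)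
  have m': "mset (filter (\<lambda>x. \<not> is_gauge x) ?Js) = {#partner (Js ! p), TGhost b \<mu>#}"
    using mset_matter_pair[of ?Js p q] Js pq Jp Jq by (simp add: nth_list_update is_gauge_not_barred)
  have toggle_div: "vertex anticommuting (var (AntiEta a) * psi_deriv (div_A a)) ?Js ks =
      transposed p q * vertex anticommuting (var (LNb a) * div_A a) Js ks" for a
    using vertex_toggle_A[OF carries_div_A pq Js _ _ Jp, of "LNb a" a ks] by (simp add: transposed_def)
  have toggle_curv: "vertex anticommuting (var (AntiChi a i) * psi_deriv (sd_curv f g \<sigma> a i)) ?Js ks =
      transposed p q * vertex anticommuting (var (LNB a i) * sd_curv f g \<sigma> a i) Js ks" for a i
    using vertex_toggle_A[OF carries_sd_curv pq Js _ _ Jp, of "LNB a i" f g \<sigma> a i ks] by (simp add: transposed_def)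
  show ?thesis
  proof (cases "Js ! p")
    case (LNb d)
    have "mset (filter (\<lambda>x. \<not> is_gauge x) Js) = {#LNb d#}"
      "mset (filter (\<lambda>x. \<not> is_gauge x) ?Js) = {#AntiEta d, TGhost b \<mu>#}"
      by (rule trans[OF m] trans[OF m'], simp add: LNb)+
    note V = vertex_by_matter(1)[OF ne ks this(1)] vertex_by_matter(2)[OF ne' ks' ks(2) this(2)]
    have "toggle_sign (Js ! p) = 1" by (simp add: LNb toggle_sign_def)
    then show ?thesis
      by (simp only: V toggle_div sum_distrib_left mult_1_left)
  next
    case (LNB d i)
    have "mset (filter (\<lambda>x. \<not> is_gauge x) Js) = {#LNB d i#}"
      "mset (filter (\<lambda>x. \<not> is_gauge x) ?Js) = {#AntiChi d i, TGhost b \<mu>#}"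
      by (rule trans[OF m] trans[OF m'], simp add: LNB)+
    note V = vertex_by_matter(3)[OF ne ks this(1)] vertex_by_matter(4)[OF ne' ks' ks(2) this(2)]
    have "toggle_sign (Js ! p) = -1" by (simp add: LNB toggle_sign_def)
    then show ?thesis
      by (simp only: V toggle_curv sum_distrib_left mult_minus_left sum_negf mult_1_left)
  qed (use Jp in auto)
qed

lemma vertex_toggle_sector_c:
  assumes ks: "length ks = length Js" "sum_list ks = 0"
    and pq: "p < length Js" "q < length Js" "p \<noteq> q"
    and Js: "\<And>r. r < length Js \<Longrightarrow> r \<noteq> p \<Longrightarrow> r \<noteq> q \<Longrightarrow> is_gauge (Js ! r)"
      "Js ! p = AntiGhost d" "Js ! q = Ghost e"
  shows "V (Js[p := partner (Js ! p), q := partner (Js ! q)]) ks = transposed p q * V Js ks"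
proof -
  let ?Js = "Js[p := partner (Js ! p), q := partner (Js ! q)]"
  have ne: "Js \<noteq> []" using pq by auto
  then have ne': "?Js \<noteq> []" by simp
  have ks': "length ks = length ?Js" using ks by simp
  have m: "mset (filter (\<lambda>x. \<not> is_gauge x) Js) = {#AntiGhost d, Ghost e#}"
    using mset_matter_pair[of Js p q] Js pq by simp
  have m': "mset (filter (\<lambda>x. \<not> is_gauge x) ?Js) = {#AntiPhi d, BGhost e#}"
    using mset_matter_pair[of ?Js p q] Js pq by (simp add: nth_list_update)
  have toggle: "vertex anticommuting (var (AntiPhi a) * div_D f g BGhost a) ?Js ks =
      transposed p q * vertex anticommuting (var (AntiGhost a) * div_D f g Ghost a) Js ks" for a
    using vertex_toggle_c[OF pq Js, of a f g ks] by (simp add: transposed_def)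
  show ?thesis
    unfolding vertex_by_matter(5)[OF ne ks m] vertex_by_matter(6)[OF ne' ks' ks(2) m'] toggle
    by (simp add: sum_distrib_left)
qed

lemma vertex_toggle:
  assumes ks: "length ks = length Js" "sum_list ks = 0"
    and pq: "p < length Js" "q < length Js" "p \<noteq> q"
    and Js: "\<And>r. r < length Js \<Longrightarrow> r \<noteq> p \<Longrightarrow> r \<noteq> q \<Longrightarrow> is_gauge (Js ! r)"
    and bar: "barred (Js ! p)" "\<not> barred (Js ! q)" "sector_of (Js ! p) = sector_of (Js ! q)"
  shows "V (Js[p := partner (Js ! p), q := partner (Js ! q)]) ks =
    toggle_sign (Js ! p) * transposed p q * V Js ks"
proof -
  let ?Js = "Js[p := partner (Js ! p), q := partner (Js ! q)]"
  have even: "V (Ks[p := partner (Ks ! p), q := partner (Ks ! q)]) ks = toggle_sign (Ks ! p) * transposed p q * V Ks ks"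
    if "length Ks = length Js" "\<And>r. r < length Js \<Longrightarrow> r \<noteq> p \<Longrightarrow> r \<noteq> q \<Longrightarrow> is_gauge (Ks ! r)"
      "barred (Ks ! p)" "\<not> barred (Ks ! q)" "sector_of (Ks ! p) = sector_of (Ks ! q)"
      "sector_of (Ks ! p) = Sector_A \<or> sector_of (Ks ! p) = Sector_c" for Ks
  proof -
    note Ks = that
    from Ks(6) show ?thesis
  proof
    assume A: "sector_of (Ks ! p) = Sector_A"
    have "is_gauge (Ks ! r)" if "r < length Ks" "r \<noteq> p" for r
      using that A Ks(1,4,5) Ks(2)[of r] by (cases "r = q") (auto simp: is_gauge_not_barred)
    then show ?thesis
      by (intro vertex_toggle_sector_A) (use Ks A ks pq in auto)
  next
    assume c: "sector_of (Ks ! p) = Sector_c"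
    obtain d e where "Ks ! p = AntiGhost d" "Ks ! q = Ghost e"
      using Ks(3-5) c by (cases "Ks ! p"; cases "Ks ! q") auto
    then show ?thesis
      using vertex_toggle_sector_c[of ks Ks p q d e] Ks(1,2) ks pq by (simp add: toggle_sign_def)
  qed
  qed
  consider "sector_of (Js ! p) = Sector_A \<or> sector_of (Js ! p) = Sector_c"
    | "sector_of (partner (Js ! p)) = Sector_A \<or> sector_of (partner (Js ! p)) = Sector_c"
    by (cases "Js ! p") auto
  then show ?thesis
  proof cases
    case 1
    then show ?thesis using Js bar by (intro even) auto
  next
    \<comment> \<open>In the sectors \<psi> and \<phi> the exchange leads back to A and c. All signs
      square to 1, so the rule already shown can be solved for the other side.\<close>
    case 2
    have sector: "sector_of (partner (Js ! p)) = sector_of (partner (Js ! q))"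
      using bar(3) by (cases "Js ! p"; cases "Js ! q") auto
    have inverse: "?Js[p := partner (?Js ! p), q := partner (?Js ! q)] = Js"
      using pq by (intro nth_equalityI) (auto simp: nth_list_update)
    have Jsp: "?Js ! p = partner (Js ! p)" "?Js ! q = partner (Js ! q)"
      using pq by (simp_all add: nth_list_update)
    have "V (?Js[p := partner (?Js ! p), q := partner (?Js ! q)]) ks = toggle_sign (?Js ! p) * transposed p q * V ?Js ks"
    proof (rule even)
      show "is_gauge (?Js ! r)" if "r < length Js" "r \<noteq> p" "r \<noteq> q" for r
        using Js[OF that] that by simp
    qed (use 2 bar sector in \<open>simp_all add: Jsp\<close>)
    then have "V Js ks = toggle_sign (Js ! p) * transposed p q * V ?Js ks"
      by (simp only: inverse) (simp only: Jsp toggle_sign_partner)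
    then have "toggle_sign (Js ! p) * transposed p q * V Js ks =
        (toggle_sign (Js ! p) * toggle_sign (Js ! p)) * (transposed p q * transposed p q) * V ?Js ks"
      by (simp only: mult_ac)
    moreover have "transposed p q * transposed p q = 1"
      by (simp add: transposed_def)
    ultimately show ?thesis by (simp only: toggle_sign_square mult_1_left)
  qed
qed

end

section \<open>Kernel and propagator under the exchange\<close>

lemma matrix_inverse_unique:
  fixes K :: "'b::comm_ring_1^'n^'n"
  assumes "P ** K = mat 1" "K ** Q = mat 1"
  shows "Q = P"
  by (metis assms matrix_mul_assoc matrix_mul_lid matrix_mul_rid)

lemma ghost_deriv_field_strength:
  "ghost_deriv f g (field_strength f g a \<mu> \<nu>) =
     pd \<nu> (cov_deriv f g \<mu> (\<lambda>b. var (Ghost b)) a) - pd \<mu> (cov_deriv f g \<nu> (\<lambda>b. var (Ghost b)) a)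
     - (\<Sum>b\<in>UNIV. \<Sum>c\<in>UNIV. rc (g * f a b c) *
         (cov_deriv f g \<mu> (\<lambda>b. var (Ghost b)) b * var (Gauge c \<nu>) + var (Gauge b \<mu>) * cov_deriv f g \<nu> (\<lambda>b. var (Ghost b)) c))"
proof -
  have "ghost_deriv f g (pd \<mu> (var (Gauge a \<nu>))) = - pd \<mu> (cov_deriv f g \<nu> (\<lambda>b. var (Ghost b)) a)" for a \<mu> \<nu>
    by (simp add: ghost_deriv_def odd_derivation_pd_var ghost_value_def pd_linear)
  moreover have "ghost_deriv f g (var (Gauge b \<mu>) * var (Gauge c \<nu>)) =
     - (cov_deriv f g \<mu> (\<lambda>b. var (Ghost b)) b * var (Gauge c \<nu>) + var (Gauge b \<mu>) * cov_deriv f g \<nu> (\<lambda>b. var (Ghost b)) c)" for b c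
    by (simp add: ghost_deriv_def var_def odd_derivation_letter_mult odd_derivation_letter ghost_value_def)
  ultimately show ?thesis
    unfolding field_strength_def ghost_deriv_def
    by (simp add: odd_derivation_linear rc_def mult.assoc flip: sum_negf mult_minus_right)
qed

lemma word_vertex_derivative_commute:
  "word_vertex gr [l, (x, [\<mu>, \<nu>])] Js ks = word_vertex gr [l, (x, [\<nu>, \<mu>])] Js ks"
proof -
  have "derivative_factor (snd ([l, (x, [\<mu>, \<nu>])] ! r)) k = derivative_factor (snd ([l, (x, [\<nu>, \<mu>])] ! r)) k"
    and "fst ([l, (x, [\<mu>, \<nu>])] ! r) = fst ([l, (x, [\<nu>, \<mu>])] ! r)" if "r < 2" for r k
    using that by (auto simp: less_2_cases_iff derivative_factor_def)
  then show ?thesis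
    by (auto simp: word_vertex_def numeral_2_eq_2 intro!: sum.cong prod.cong)
qed

text \<open>The part of the field strength that is linear in \<open>A\<close> is invariant under \<open>A \<rightarrow> A - \<partial>c\<close>.\<close>

lemma vertex_chi_ghost:
  assumes "length Js = 2"
  shows "vertex gr (var (AntiChi d i) * ghost_deriv f g (sd_curv f g \<sigma> a j)) Js ks = 0"
proof -
  have cov: "cov_deriv f g \<mu> (\<lambda>b. var (Ghost b)) a = letter (Ghost a, [\<mu>])
      - (\<Sum>b\<in>UNIV. \<Sum>c\<in>UNIV. rc (g * f a b c) * (letter (Gauge c \<mu>, []) * letter (Ghost b, [])))" for \<mu> a
    by (simp add: cov_deriv_def var_def pd_letter mult.assoc)
  have pd_cov: "pd \<nu> (cov_deriv f g \<mu> (\<lambda>b. var (Ghost b)) a) = letter (Ghost a, [\<nu>, \<mu>])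
      - (\<Sum>b\<in>UNIV. \<Sum>c\<in>UNIV. rc (g * f a b c) * (letter (Gauge c \<mu>, [\<nu>]) * letter (Ghost b, [])
          + letter (Gauge c \<mu>, []) * letter (Ghost b, [\<nu>])))" for \<mu> \<nu> a
    unfolding cov rc_def by (simp add: pd_linear pd_letter pd_letter_mult)
  \<comment> \<open>Only words of two letters can fill two slots, so every term with an A drops out
    and the linearised variation remains.\<close>
  have long: "vertex gr (letter l1 * (letter l2 * (letter l3 * R))) Js ks = 0" for l1 l2 l3 and R :: "'a tym_field dpoly"
  proof (induction R rule: dpoly_induct)
    case (single w c)
    then show ?case using assms by (simp add: letter_mult_single word_vertex_def)
  qed (simp add: distrib_left vertex_linear)
  have long3: "vertex gr (letter l1 * (letter l2 * letter l3)) Js ks = 0" for l1 l2 and l3 :: "'a tym_field \<times> _"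
    using long[of l1 l2 l3 1] by simp
  have "vertex gr (var (AntiChi d i) * ghost_deriv f g (field_strength f g a \<mu> \<nu>)) Js ks = 0" for a \<mu> \<nu>
  proof -
    have "vertex gr (letter (AntiChi d i, []) * pd \<nu> (cov_deriv f g \<mu> (\<lambda>b. var (Ghost b)) a)) Js ks
        = word_vertex gr [(AntiChi d i, []), (Ghost a, [\<nu>, \<mu>])] Js ks" for \<mu> \<nu>
      unfolding pd_cov rc_def
      by (simp add: right_diff_distrib distrib_left sum_distrib_left cst_left_commute[of "letter _"] vertex_linear long3)
        (simp add: letter_def[of "(Ghost a, _)"] letter_mult_single)
    moreover have "vertex gr (letter (AntiChi d i, []) * (cov_deriv f g \<mu> (\<lambda>b. var (Ghost b)) b * var (Gauge c \<nu>))) Js ks = 0" for b c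
      unfolding cov unfolding rc_def var_def
      by (simp add: right_diff_distrib left_diff_distrib sum_distrib_right distrib_left sum_distrib_left
          mult.assoc cst_left_commute[of "letter _"] vertex_linear long3 long)
    moreover have "vertex gr (letter (AntiChi d i, []) * (var (Gauge b \<mu>) * cov_deriv f g \<nu> (\<lambda>b. var (Ghost b)) c)) Js ks = 0" for b c
      unfolding cov unfolding rc_def var_def
      by (simp add: right_diff_distrib distrib_left sum_distrib_left
          mult.assoc cst_left_commute[of "letter _"] vertex_linear long3 long)
    ultimately show ?thesis
      unfolding ghost_deriv_field_strength rc_def var_def[of "AntiChi d i"]
      by (simp add: right_diff_distrib distrib_left sum_distrib_left cst_left_commute[of "letter _"] vertex_linear
          word_vertex_derivative_commute[of gr _ _ \<nu> \<mu>])
  qed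
  then show ?thesis
    unfolding sd_curv_def dual_field_strength_def rc_def ghost_deriv_def
    by (simp add: odd_derivation_linear distrib_left sum_distrib_left cst_left_commute[of "var _"] vertex_linear)
qed

context tym begin

abbreviation "K \<equiv> kernel anticommuting (tym_action f g \<sigma> S0)"
abbreviation "prop \<equiv> propagator anticommuting (tym_action f g \<sigma> S0)"

text \<open>Among the contents possible with two legs only \<chi>-bar c mixes two sectors, and
  \<open>vertex_chi_ghost\<close> removes it.\<close>

lemma kernel_nonzero:
  assumes "K k $ x $ y \<noteq> 0"
  shows "sector_of x = sector_of y" "barred x \<noteq> barred y"
proof -
  have V: "V [x, y] [- k, k] \<noteq> 0"
    using assms by (simp add: kernel_def)
  then have mem: "mset (filter (\<lambda>x. \<not> is_gauge x) [x, y]) \<in> tym_vertices"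
    by (intro vertex_in_tym_vertices[OF S0]) auto
  have zero: "V [x, y] [- k, k] = 0" if M: "mset (filter (\<lambda>x. \<not> is_gauge x) [x, y]) = {#AntiChi d i, Ghost e#}" for d i e
    using vertex_by_matter(7)[OF _ _ _ M, of "[- k, k]"] by (simp add: vertex_chi_ghost)
  have "sector_of x = sector_of y \<and> barred x \<noteq> barred y"
    using mem
  proof cases
    case (8 a i b)
    then show ?thesis using zero V by blast
  qed (auto simp: add_eq_conv_ex is_gauge_not_barred split: if_splits)
  then show "sector_of x = sector_of y" "barred x \<noteq> barred y" by auto
qed

text \<open>This is \<open>vertex_toggle\<close> for two legs. The additional minus sign for a
  barred \<open>y\<close> arises because the barred field then stands second, against the order of
  the words.\<close>

lemma kernel_toggle:
  "K k $ partner x $ partner y =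
     (if barred x then toggle_sign x else 1) * K k $ x $ y * (if barred y then - toggle_sign y else 1)"
proof (cases "sector_of x = sector_of y \<and> barred x \<noteq> barred y")
  case True
  show ?thesis
  proof (cases "barred x")
    case bar: True
    have "V ([x, y][0 := partner ([x, y] ! 0), 1 := partner ([x, y] ! 1)]) [- k, k] =
        toggle_sign ([x, y] ! 0) * transposed 0 1 * V [x, y] [- k, k]"
      by (rule vertex_toggle) (use True bar in \<open>auto simp: less_2_cases_iff\<close>)
    then show ?thesis using True bar by (simp add: kernel_def transposed_def)
  next
    case bar: False
    have "V ([x, y][1 := partner ([x, y] ! 1), 0 := partner ([x, y] ! 0)]) [- k, k] =
        toggle_sign ([x, y] ! 1) * transposed 1 0 * V [x, y] [- k, k]"
      by (rule vertex_toggle) (use True bar in \<open>auto simp: less_2_cases_iff\<close>)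
    then show ?thesis using True bar by (simp add: kernel_def transposed_def)
  qed
next
  case False
  have "sector_of (partner x) = sector_of (partner y) \<longleftrightarrow> sector_of x = sector_of y"
    by (cases x; cases y) auto
  then have "K k $ partner x $ partner y = 0" "K k $ x $ y = 0"
    using False kernel_nonzero[of k x y] kernel_nonzero[of k "partner x" "partner y"] by auto
  then show ?thesis by simp
qed

lemma invertible_kernel_prop:
  assumes "invertible (K k)"
  shows "K k ** prop k = mat 1" "prop k ** K k = mat 1"
  using assms unfolding propagator_def invertible_def matrix_inv_def
  by (simp_all, (metis (mono_tags, lifting) someI_ex)+)

text \<open>The kernel obeys the same selection rule, so deleting the forbidden entries of the
  propagator leaves a right inverse of the kernel; the inverse being unique, nothing was
  deleted.\<close>

lemma prop_nonzero:
  assumes "prop k $ x $ y \<noteq> 0"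
  shows "sector_of x = sector_of y" "barred x \<noteq> barred y"
proof -
  have inv: "invertible (K k)"
    using assms by (auto simp: propagator_def split: if_splits)
  let ?R = "\<lambda>x y :: 'a tym_field. sector_of x = sector_of y \<and> barred x \<noteq> barred y"
  let ?Q = "\<chi> x y. if ?R x y then prop k $ x $ y else 0"
  have "K k ** ?Q = mat 1"
  proof -
    have "(\<Sum>y\<in>UNIV. K k $ x $ y * ?Q $ y $ z) = (if x = z then 1 else 0)" for x z
    proof (cases "sector_of x = sector_of z \<and> barred x = barred z")
      case True
      have "(\<Sum>y\<in>UNIV. K k $ x $ y * ?Q $ y $ z) = (\<Sum>y\<in>UNIV. K k $ x $ y * prop k $ y $ z)"
      proof (intro sum.cong refl)
        fix y
        show "K k $ x $ y * ?Q $ y $ z = K k $ x $ y * prop k $ y $ z"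
          using True kernel_nonzero[of k x y] by (cases "K k $ x $ y = 0") auto
      qed
      also have "\<dots> = (K k ** prop k) $ x $ z"
        by (simp add: matrix_matrix_mult_def)
      finally show ?thesis
        using invertible_kernel_prop(1)[OF inv] by (simp add: mat_def)
    next
      case False
      have "K k $ x $ y * ?Q $ y $ z = 0" for y
        using False kernel_nonzero[of k x y] by (cases "K k $ x $ y = 0") auto
      then have "(\<Sum>y\<in>UNIV. K k $ x $ y * ?Q $ y $ z) = 0"
        by (intro sum.neutral ballI)
      then show ?thesis using False by auto
    qed
    then show ?thesis by (simp add: matrix_matrix_mult_def mat_def vec_eq_iff)
  qed
  then have Q: "?Q = prop k"
    using invertible_kernel_prop(2)[OF inv] by (rule matrix_inverse_unique[rotated])
  have "?Q $ x $ y = prop k $ x $ y" unfolding Q ..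
  then show "sector_of x = sector_of y" "barred x \<noteq> barred y"
    using assms by (auto split: if_splits)
qed

text \<open>Up to the relabelling by \<open>partner\<close>, the exchanged kernel is u K w with
  diagonal matrices of signs, so its inverse is w P u. This is why the minus sign moves from the
  second index to the first.\<close>

lemma prop_toggle:
  "prop k $ partner x $ partner y =
     (if barred x then - toggle_sign x else 1) * prop k $ x $ y * (if barred y then toggle_sign y else 1)"
proof (cases "invertible (K k)")
  case inv: True
  define u where "u x = (if barred x then toggle_sign x else 1)" for x :: "'a tym_field"
  define w where "w x = (if barred x then - toggle_sign x else 1)" for x :: "'a tym_field"
  have sq: "u x * u x = 1" "w x * w x = 1" for x by (simp_all add: u_def w_def)
  let ?Q = "\<chi> x y. w x * prop k $ partner x $ partner y * u y"
  have "K k ** ?Q = mat 1"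
  proof -
    have "(\<Sum>y\<in>UNIV. K k $ x $ y * ?Q $ y $ z) = (if x = z then 1 else 0)" for x z
    proof -
      have "(\<Sum>y\<in>UNIV. K k $ x $ y * ?Q $ y $ z)
          = (\<Sum>y\<in>UNIV. u x * u z * (K k $ partner x $ partner y * prop k $ partner y $ partner z))"
      proof (intro sum.cong refl)
        fix y
        have "u x * u z * (K k $ partner x $ partner y * prop k $ partner y $ partner z)
            = (u x * u x) * (K k $ x $ y * (w y * prop k $ partner y $ partner z * u z))"
          by (simp add: kernel_toggle u_def w_def)
        then show "K k $ x $ y * ?Q $ y $ z = u x * u z * (K k $ partner x $ partner y * prop k $ partner y $ partner z)"
          by (simp only: sq mult_1_left vec_lambda_beta)
      qed
      also have "\<dots> = u x * u z * (\<Sum>y\<in>UNIV. K k $ partner x $ partner y * prop k $ partner y $ partner z)"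
        by (simp add: sum_distrib_left)
      also have "(\<Sum>y\<in>UNIV. K k $ partner x $ partner y * prop k $ partner y $ partner z)
          = (\<Sum>y\<in>UNIV. K k $ partner x $ y * prop k $ y $ partner z)"
        by (rule sum.reindex_bij_witness[of _ partner partner]) auto
      also have "\<dots> = (K k ** prop k) $ partner x $ partner z"
        by (simp add: matrix_matrix_mult_def)
      finally show ?thesis
        using invertible_kernel_prop(1)[OF inv] sq by (simp add: mat_def partner_eq_iff)
    qed
    then show ?thesis by (simp add: matrix_matrix_mult_def mat_def vec_eq_iff)
  qed
  then have Q: "?Q = prop k"
    using invertible_kernel_prop(2)[OF inv] by (rule matrix_inverse_unique[rotated])
  have "prop k $ x $ y = w x * prop k $ partner x $ partner y * u y" by (subst Q[symmetric]) simp
  then have "w x * prop k $ x $ y * u y = (w x * w x) * prop k $ partner x $ partner y * (u y * u y)"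
    by (simp only: mult_ac)
  then show ?thesis unfolding sq by (simp add: u_def w_def)
qed (simp add: propagator_def)

end

section \<open>The sign of a fermion loop\<close>

lemma hless_irrefl: "\<not> hless h h"
  and hless_total: "h \<noteq> h' \<Longrightarrow> \<not> hless h h' \<longleftrightarrow> hless h' h"
  and hless_trans: "hless h h' \<Longrightarrow> hless h' h'' \<Longrightarrow> hless h h''"
  by (auto simp: hless_def prod_eq_iff)

definition order_sign :: "half_edge \<Rightarrow> half_edge \<Rightarrow> complex" where
  "order_sign h h' = (if hless h h' then 1 else -1)"

lemma order_sign_swap: "h \<noteq> h' \<Longrightarrow> order_sign h' h = - order_sign h h'"
  using hless_total[of h h'] by (auto simp: order_sign_def)

lemma order_sign_square [simp]: "order_sign h h' * order_sign h h' = 1"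
  by (simp add: order_sign_def)

text \<open>For distinct points this is the sign of the permutation that sorts \<open>w 0\<close>,
  ..., \<open>w (M - 1)\<close>.\<close>

definition inversion_sign :: "nat \<Rightarrow> (nat \<Rightarrow> half_edge) \<Rightarrow> complex" where
  "inversion_sign M w = (\<Prod>j<M. \<Prod>i<j. order_sign (w i) (w j))"

text \<open>For four distinct points this is -1 exactly when the chords from x to y and from u to v
  cross.\<close>

definition interlace_sign :: "half_edge \<Rightarrow> half_edge \<Rightarrow> half_edge \<Rightarrow> half_edge \<Rightarrow> complex" where
  "interlace_sign x y u v = order_sign x u * order_sign x v * order_sign y u * order_sign y v"

lemma inversion_sign_Suc_front:
  "inversion_sign (Suc M) w = (\<Prod>i<M. order_sign (w 0) (w (Suc i))) * inversion_sign M (\<lambda>i. w (Suc i))"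
proof -
  have "inversion_sign (Suc M) w = (\<Prod>j<M. \<Prod>i<Suc j. order_sign (w i) (w (Suc j)))"
    unfolding inversion_sign_def by (subst prod.lessThan_Suc_shift) simp
  also have "\<dots> = (\<Prod>j<M. order_sign (w 0) (w (Suc j)) * (\<Prod>i<j. order_sign (w (Suc i)) (w (Suc j))))"
    by (intro prod.cong refl) (subst prod.lessThan_Suc_shift, simp)
  finally show ?thesis by (simp add: prod.distrib inversion_sign_def)
qed

text \<open>The first point is moved past the \<open>M\<close> others, each of which contributes one
  sign.\<close>

lemma inversion_sign_rotate:
  assumes "w (Suc M) = w 0" "\<And>i. i < M \<Longrightarrow> w (Suc i) \<noteq> w 0"
  shows "inversion_sign (Suc M) (\<lambda>i. w (Suc i)) = (-1) ^ M * inversion_sign (Suc M) w"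
proof -
  have "(\<Prod>i<M. order_sign (w (Suc i)) (w 0)) = (\<Prod>i<M. - order_sign (w 0) (w (Suc i)))"
    using assms(2) by (intro prod.cong refl) (metis lessThan_iff order_sign_swap)
  also have "\<dots> = (-1) ^ M * (\<Prod>i<M. order_sign (w 0) (w (Suc i)))"
    by (simp add: prod_uminus)
  finally show ?thesis
    unfolding inversion_sign_Suc_front[of M w] by (simp add: inversion_sign_def assms(1) mult_ac)
qed

lemma prod_lessThan_double: "(\<Prod>i<2 * n. h i) = (\<Prod>i<n. h (2 * i) * h (2 * i + 1))"
  for h :: "nat \<Rightarrow> 'b::comm_monoid_mult"
  by (induction n) (simp_all add: mult_ac)

text \<open>Inversions are sorted into those inside a block of two consecutive points and those
  between two blocks.\<close>

lemma inversion_sign_pairs: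
  "inversion_sign (2 * n) w = (\<Prod>i<n. order_sign (w (2 * i)) (w (2 * i + 1))) *
     (\<Prod>j<n. \<Prod>i<j. interlace_sign (w (2 * i)) (w (2 * i + 1)) (w (2 * j)) (w (2 * j + 1)))"
proof (induction n)
  case (Suc n)
  have "inversion_sign (2 * Suc n) w = inversion_sign (2 * n) w *
      (\<Prod>i<2 * n. order_sign (w i) (w (2 * n)) * order_sign (w i) (w (2 * n + 1)))
      * order_sign (w (2 * n)) (w (2 * n + 1))"
    by (simp add: inversion_sign_def prod.distrib mult_ac)
  also have "(\<Prod>i<2 * n. order_sign (w i) (w (2 * n)) * order_sign (w i) (w (2 * n + 1)))
      = (\<Prod>i<n. interlace_sign (w (2 * i)) (w (2 * i + 1)) (w (2 * n)) (w (2 * n + 1)))"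
    unfolding prod_lessThan_double by (simp add: interlace_sign_def mult_ac)
  finally show ?case
    unfolding Suc.IH by (simp only: prod.lessThan_Suc mult_ac)
qed (simp add: inversion_sign_def)

text \<open>Deliberately asymmetric: if two edges cross, exactly one ordered pair of their ends
  qualifies, so that each crossing is counted once, as in \<open>wick_sign\<close>.\<close>

definition crossing :: "pairing \<Rightarrow> half_edge \<Rightarrow> half_edge \<Rightarrow> bool" where
  "crossing m h h' \<longleftrightarrow> hless h h' \<and> hless h' (m h) \<and> hless (m h) (m h')"

lemma interlace_sign_eq_crossings:
  assumes "m x = y" "m y = x" "m u = v" "m v = u" "distinct [x, y, u, v]"
  defines "cr h h' \<equiv> if crossing m h h' then -1 else (1 :: complex)"
  shows "interlace_sign x y u v =
    (cr x u * cr x v * cr y u * cr y v) * (cr u x * cr u y * cr v x * cr v y)"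
proof -
  have neg: "hless y x \<longleftrightarrow> \<not> hless x y" "hless u x \<longleftrightarrow> \<not> hless x u" "hless v x \<longleftrightarrow> \<not> hless x v"
      "hless u y \<longleftrightarrow> \<not> hless y u" "hless v y \<longleftrightarrow> \<not> hless y v" "hless v u \<longleftrightarrow> \<not> hless u v"
    using assms(5) hless_total by auto
  \<comment> \<open>Transitivity discards the comparison patterns that no four points can realise;
    the others form a finite check.\<close>
  have tr: "\<not> (hless x y \<and> hless y u \<and> \<not> hless x u)" "\<not> (hless x u \<and> hless u y \<and> \<not> hless x y)"
    "\<not> (hless y x \<and> hless x u \<and> \<not> hless y u)" "\<not> (hless u x \<and> hless x y \<and> \<not> hless u y)"
    "\<not> (hless x y \<and> hless y v \<and> \<not> hless x v)" "\<not> (hless x v \<and> hless v y \<and> \<not> hless x y)"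
    "\<not> (hless y x \<and> hless x v \<and> \<not> hless y v)" "\<not> (hless v x \<and> hless x y \<and> \<not> hless v y)"
    "\<not> (hless x u \<and> hless u v \<and> \<not> hless x v)" "\<not> (hless u v \<and> hless v x \<and> \<not> hless u x)"
    "\<not> (hless y u \<and> hless u v \<and> \<not> hless y v)" "\<not> (hless u v \<and> hless v y \<and> \<not> hless u y)"
    by (blast intro: hless_trans)+
  show ?thesis
    unfolding interlace_sign_def order_sign_def cr_def crossing_def assms(1-4)
    using tr unfolding neg
    by (cases "hless x y"; cases "hless x u"; cases "hless x v"; cases "hless y u"; cases "hless y v"; cases "hless u v"; simp)
qed

lemma prod_square_off_diagonal:
  fixes Y :: "nat \<Rightarrow> nat \<Rightarrow> 'b::comm_monoid_mult"
  assumes "\<And>i. i < n \<Longrightarrow> Y i i = 1"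
  shows "(\<Prod>i<n. \<Prod>j<n. Y i j) = (\<Prod>j<n. \<Prod>i<j. Y i j * Y j i)"
  using assms by (induction n) (simp_all add: prod.distrib mult_ac)

lemma neg_one_power_card:
  assumes "finite Z"
  shows "(-1 :: complex) ^ card {(h, h'). h \<in> Z \<and> h' \<in> Z \<and> P h h'} = (\<Prod>h\<in>Z. \<Prod>h'\<in>Z. if P h h' then -1 else 1)"
proof -
  have "(\<Prod>h\<in>Z. \<Prod>h'\<in>Z. if P h h' then -1 else 1) = (\<Prod>(h, h')\<in>Z \<times> Z. if P h h' then -1 else (1 :: complex))"
    by (rule prod.cartesian_product)
  also have "\<dots> = (\<Prod>p\<in>{p \<in> Z \<times> Z. P (fst p) (snd p)}. -1)"
    unfolding case_prod_beta using assms by (subst prod.inter_filter) auto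
  also have "{p \<in> Z \<times> Z. P (fst p) (snd p)} = {(h, h'). h \<in> Z \<and> h' \<in> Z \<and> P h h'}"
    by auto
  finally show ?thesis by simp
qed

text \<open>
  Both signs compare with the sign of listing the points of the cycle in cyclic order: the pairs
  \<open>(w (2i), w (2i + 1))\<close> do not cross, and the rotation that turns them into the pairs
  \<open>(w (2i + 1), w (2i + 2))\<close> is an odd permutation of an even number of points.
\<close>

lemma cycle_sign:
  fixes w :: "nat \<Rightarrow> half_edge"
  assumes n: "n > 0" and per: "w (2 * n) = w 0" and inj: "inj_on w {..<2 * n}"
    and m: "\<And>i. i < n \<Longrightarrow> m (w (2 * i + 1)) = w (2 * i + 2)" "\<And>i. i < n \<Longrightarrow> m (w (2 * i + 2)) = w (2 * i + 1)"
    and node: "\<And>i. i < n \<Longrightarrow> fst (w (2 * i)) = fst (w (2 * i + 1))"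
      "\<And>i j. i < n \<Longrightarrow> j < n \<Longrightarrow> fst (w (2 * i)) = fst (w (2 * j)) \<Longrightarrow> i = j"
  shows "(\<Prod>i<n. order_sign (w (2 * i + 1)) (w (2 * i))) * (\<Prod>i<n. - order_sign (w (2 * i + 1)) (w (2 * i + 2))) *
    (-1) ^ card {(h, h'). h \<in> w ` {..<2 * n} \<and> h' \<in> w ` {..<2 * n} \<and> crossing m h h'} = -1"
proof -
  define x where "x i = w (2 * i + 1)" for i
  define y where "y i = w (2 * i + 2)" for i
  let ?X = "\<Prod>j<n. \<Prod>i<j. interlace_sign (x i) (y i) (x j) (y j)"
  obtain M where M: "2 * n = Suc M" using n by (cases n) auto
  have w_neq: "w i \<noteq> w j" if "i < 2 * n" "j < 2 * n" "i \<noteq> j" for i j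
    using inj that by (auto dest: inj_onD)
  let ?w' = "\<lambda>i. w (Suc i)"
  have shift_eq: "?w' i = w (if Suc i = 2 * n then 0 else Suc i)" for i
    using per by auto
  have inj': "inj_on ?w' {..<2 * n}"
  proof (rule inj_onI)
    fix i j assume "i \<in> {..<2 * n}" "j \<in> {..<2 * n}" "?w' i = ?w' j"
    then have "(if Suc i = 2 * n then 0 else Suc i) = (if Suc j = 2 * n then 0 else Suc j)"
      unfolding shift_eq using n by (intro inj_onD[OF inj]) auto
    then show "i = j" by (auto split: if_splits)
  qed
  have image': "?w' ` {..<2 * n} = w ` {..<2 * n}"
  proof
    show "?w' ` {..<2 * n} \<subseteq> w ` {..<2 * n}"
      unfolding shift_eq using n by auto
    show "w ` {..<2 * n} \<subseteq> ?w' ` {..<2 * n}"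
    proof
      fix h assume "h \<in> w ` {..<2 * n}"
      then obtain i where i: "h = w i" "i < 2 * n" by auto
      show "h \<in> ?w' ` {..<2 * n}"
      proof (cases i)
        case 0
        then have "h = ?w' M" using i per M by simp
        then show ?thesis using M by auto
      next
        case (Suc i')
        then show ?thesis using i by auto
      qed
    qed
  qed
  \<comment> \<open>Half-edges are ordered by their node first, so both half-edges of one node lie
    on the same side of those of another node.\<close>
  have node_sign: "interlace_sign (w (2 * i)) (w (2 * i + 1)) (w (2 * j)) (w (2 * j + 1)) = 1" if "i < j" "j < n" for i j
  proof -
    have "fst (w (2 * i)) \<noteq> fst (w (2 * j))" using node(2)[of i j] that by auto
    then show ?thesis
      using node(1)[of i] node(1)[of j] that by (auto simp: interlace_sign_def order_sign_def hless_def)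
  qed
  have D: "inversion_sign (2 * n) w = (\<Prod>i<n. order_sign (w (2 * i)) (w (2 * i + 1)))"
    unfolding inversion_sign_pairs using node_sign by simp
  have D': "inversion_sign (2 * n) ?w' = (\<Prod>i<n. order_sign (x i) (y i)) * ?X"
    unfolding inversion_sign_pairs by (simp add: x_def y_def)
  have rot: "inversion_sign (2 * n) ?w' = - inversion_sign (2 * n) w"
  proof -
    have "odd M" using M by presburger
    have "inversion_sign (Suc M) ?w' = (-1) ^ M * inversion_sign (Suc M) w"
      by (rule inversion_sign_rotate) (use per M w_neq in auto)
    then show ?thesis using \<open>odd M\<close> M by simp
  qed
  have m_xy: "m (x i) = y i" "m (y i) = x i" if "i < n" for i
    using m[OF that] by (simp_all add: x_def y_def)
  have distinct: "distinct [x i, y i, x j, y j]" if "i < n" "j < n" "i \<noteq> j" for i j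
  proof -
    have "?w' k \<noteq> ?w' l" if "k < 2 * n" "l < 2 * n" "k \<noteq> l" for k l
      using inj' that by (auto dest: inj_onD)
    from this[of "2 * i" "2 * i + 1"] this[of "2 * i" "2 * j"] this[of "2 * i" "2 * j + 1"]
      this[of "2 * i + 1" "2 * j"] this[of "2 * i + 1" "2 * j + 1"] this[of "2 * j" "2 * j + 1"]
    show ?thesis using that by (auto simp: x_def y_def)
  qed
  define cr where "cr h h' = (if crossing m h h' then -1 else (1 :: complex))" for h h'
  define Y where "Y i j = cr (x i) (x j) * cr (x i) (y j) * cr (y i) (x j) * cr (y i) (y j)" for i j
  have "(-1) ^ card {(h, h'). h \<in> w ` {..<2 * n} \<and> h' \<in> w ` {..<2 * n} \<and> crossing m h h'}
      = (\<Prod>h\<in>w ` {..<2 * n}. \<Prod>h'\<in>w ` {..<2 * n}. cr h h')"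
    by (subst neg_one_power_card) (simp_all add: cr_def)
  also have "\<dots> = (\<Prod>i<n. \<Prod>j<n. Y i j)"
    unfolding image'[symmetric] prod.reindex[OF inj'] prod_lessThan_double comp_def
    by (simp add: Y_def x_def y_def prod.distrib mult_ac)
  also have "\<dots> = (\<Prod>j<n. \<Prod>i<j. Y i j * Y j i)"
  proof (rule prod_square_off_diagonal)
    fix i assume i: "i < n"
    show "Y i i = 1"
      using m_xy[OF i] by (auto simp: Y_def cr_def crossing_def hless_irrefl dest: hless_trans)
  qed
  also have "\<dots> = ?X"
  proof (intro prod.cong refl)
    fix i j assume "j \<in> {..<n}" "i \<in> {..<j}"
    then show "Y i j * Y j i = interlace_sign (x i) (y i) (x j) (y j)"
      unfolding Y_def cr_def
      by (subst interlace_sign_eq_crossings[of m]) (use m_xy distinct[of i j] in auto)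
  qed
  finally have W: "(-1) ^ card {(h, h'). h \<in> w ` {..<2 * n} \<and> h' \<in> w ` {..<2 * n} \<and> crossing m h h'} = ?X" .
  let ?A = "\<Prod>i<n. order_sign (w (2 * i)) (w (2 * i + 1))" and ?B = "\<Prod>i<n. order_sign (x i) (y i)"
  have "(\<Prod>i<n. order_sign (w (2 * i + 1)) (w (2 * i))) = (\<Prod>i<n. - order_sign (w (2 * i)) (w (2 * i + 1)))"
    by (intro prod.cong refl order_sign_swap w_neq) auto
  \<comment> \<open>Turning the pairs at the nodes around costs (-1)^n, and the minus signs on the
    edges give another (-1)^n; the two cancel at the end.\<close>
  then have 1: "(\<Prod>i<n. order_sign (w (2 * i + 1)) (w (2 * i))) = (-1) ^ n * ?A"
    by (simp add: prod_uminus)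
  have 2: "(\<Prod>i<n. - order_sign (w (2 * i + 1)) (w (2 * i + 2))) = (-1) ^ n * ?B"
    by (simp add: prod_uminus x_def y_def)
  have "?B * ?X = - ?A" using D D' rot by simp
  moreover have "?A * ?A = 1" by (simp flip: prod.distrib)
  moreover have "((-1) ^ n * ?A) * ((-1) ^ n * ?B) * ?X = ((-1) ^ n * (-1) ^ n) * (?A * (?B * ?X))"
    by (simp only: mult_ac)
  ultimately have "((-1) ^ n * ?A) * ((-1) ^ n * ?B) * ?X = - ((-1) ^ n * (-1) ^ n)"
    by (simp only: mult_minus_right mult_1_right)
  then show ?thesis unfolding 1 2 W by (simp flip: power_add)
qed

section \<open>Diagrams with one loop\<close>

text \<open>
  When every node has exactly one marked half-edge and every edge exactly one marked end, following
  the marked half-edges is a self-map of the nodes, and a connected diagram has exactly one cycle.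
\<close>

locale unicyclic =
  fixes val :: "nat list" and m :: pairing and Bar :: "half_edge set"
  assumes pairing: "is_pairing val m" and connected: "connected_topology val m"
    and Bar_sub: "Bar \<subseteq> half_edges val"
    and Bar_edge: "\<And>h. h \<in> half_edges val \<Longrightarrow> m h \<in> Bar \<longleftrightarrow> h \<notin> Bar"
    and Bar_node: "\<And>v. v < length val \<Longrightarrow> \<exists>!r. (v, r) \<in> Bar"
begin

text \<open>The marked end orients each edge away from its node, and \<open>cyc\<close> consists of
  the periodic points of the resulting map. The cycle arrives at v through \<open>inn v\<close>. A
  line from a node to itself is allowed: then \<open>follow v = v\<close>, and \<open>out v\<close>
  and \<open>inn v\<close> are its two ends.\<close>

definition out :: "nat \<Rightarrow> half_edge" where "out v = (v, THE r. (v, r) \<in> Bar)"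
definition follow :: "nat \<Rightarrow> nat" where "follow v = fst (m (out v))"
definition cyc :: "nat set" where "cyc = {v. v < length val \<and> (\<exists>n>0. (follow ^^ n) v = v)}"
definition pred :: "nat \<Rightarrow> nat" where "pred v = (THE u. u \<in> cyc \<and> follow u = v)"
definition inn :: "nat \<Rightarrow> half_edge" where "inn v = m (out (pred v))"
definition cycle_edges :: "half_edge set" where "cycle_edges = out ` cyc \<union> inn ` cyc"

lemma fst_out [simp]: "fst (out v) = v"
  by (simp add: out_def)

lemma out_in_Bar: "v < length val \<Longrightarrow> out v \<in> Bar"
  unfolding out_def using theI'[OF Bar_node] by auto

lemma out_in: "v < length val \<Longrightarrow> out v \<in> half_edges val"
  using out_in_Bar Bar_sub by auto

lemma node_less: "h \<in> half_edges val \<Longrightarrow> fst h < length val"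
  by (auto simp: half_edges_def)

lemma Bar_eq_out: "h \<in> Bar \<Longrightarrow> h = out (fst h)"
proof -
  assume h: "h \<in> Bar"
  then have "fst h < length val" by (intro node_less subsetD[OF Bar_sub])
  then show "h = out (fst h)"
    using Bar_node[of "fst h"] h out_in_Bar[of "fst h"] by (auto simp: out_def prod_eq_iff)
qed

lemma m_in: "h \<in> half_edges val \<Longrightarrow> m h \<in> half_edges val"
  using pairing by (simp add: is_pairing_def permutes_in_image)

lemma m_m: "h \<in> half_edges val \<Longrightarrow> m (m h) = h"
  and m_neq: "h \<in> half_edges val \<Longrightarrow> m h \<noteq> h"
  using pairing by (auto simp: is_pairing_def)

lemma follow_less: "v < length val \<Longrightarrow> follow v < length val"
  unfolding follow_def by (intro node_less m_in out_in)

lemma funpow_follow_less: "v < length val \<Longrightarrow> (follow ^^ n) v < length val"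
  by (induction n) (auto intro: follow_less)

lemma unmarked:
  assumes "h \<in> half_edges val" "h \<notin> Bar"
  obtains w where "w < length val" "h = m (out w)" "follow w = fst h"
proof
  have "m h \<in> Bar" using assms Bar_edge by auto
  then have "m h = out (fst (m h))" by (rule Bar_eq_out)
  then show "h = m (out (fst (m h)))" using assms(1) m_m by metis
  then show "follow (fst (m h)) = fst h" by (simp add: follow_def)
  show "fst (m h) < length val" using assms(1) by (intro node_less m_in)
qed

lemma follow_cyc: "v \<in> cyc \<Longrightarrow> follow v \<in> cyc"
proof -
  assume "v \<in> cyc"
  then obtain n where n: "v < length val" "n > 0" "(follow ^^ n) v = v" by (auto simp: cyc_def)
  then have "(follow ^^ n) (follow v) = follow v"
    by (metis funpow_swap1)
  then show "follow v \<in> cyc" using n follow_less by (auto simp: cyc_def)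
qed

lemma funpow_fixed_mult: "(f ^^ n) v = v \<Longrightarrow> (f ^^ (k * n)) v = v"
  by (induction k) (simp_all add: funpow_add)

text \<open>Both nodes return after the common period \<open>n * k\<close>, and their orbits agree
  from the first step on.\<close>

lemma follow_inj_cyc: "u \<in> cyc \<Longrightarrow> v \<in> cyc \<Longrightarrow> follow u = follow v \<Longrightarrow> u = v"
proof -
  assume uv: "u \<in> cyc" "v \<in> cyc" "follow u = follow v"
  then obtain k n where kn: "k > 0" "(follow ^^ k) u = u" "n > 0" "(follow ^^ n) v = v" by (auto simp: cyc_def)
  then obtain N where N: "n * k = Suc N" by (metis Suc_pred nat_0_less_mult_iff)
  have "u = (follow ^^ (n * k)) u" using funpow_fixed_mult[OF kn(2)] by simp
  also have "\<dots> = (follow ^^ N) (follow v)" unfolding N by (simp add: funpow_swap1 uv(3))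
  also have "\<dots> = (follow ^^ (k * n)) v" unfolding N mult.commute[of k] by (simp add: funpow_swap1)
  also have "\<dots> = v" by (rule funpow_fixed_mult[OF kn(4)])
  finally show "u = v" .
qed

text \<open>Pigeonhole principle for the orbit of node 0.\<close>

lemma cyc_nonempty: "cyc \<noteq> {}"
proof -
  have L: "0 < length val" using connected by (auto simp: connected_topology_def)
  have "\<not> inj_on (\<lambda>n. (follow ^^ n) 0) {..length val}"
  proof
    assume "inj_on (\<lambda>n. (follow ^^ n) 0) {..length val}"
    then have "card {..length val} \<le> card {..<length val}"
      using funpow_follow_less[OF L] by (intro card_inj_on_le[of "\<lambda>n. (follow ^^ n) 0"]) auto
    then show False by simp
  qed
  then obtain i j where "i \<noteq> j" "(follow ^^ i) 0 = (follow ^^ j) 0"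
    by (auto simp: inj_on_def)
  then obtain i j where ij: "i < j" "(follow ^^ i) 0 = (follow ^^ j) 0"
    by (metis nat_neq_iff)
  have "(follow ^^ (j - i)) ((follow ^^ i) 0) = (follow ^^ i) 0"
    using ij by (metis add_diff_cancel_left' comp_apply funpow_add le_add_diff_inverse2 less_imp_le_nat)
  then have "(follow ^^ i) 0 \<in> cyc"
    using ij(1) funpow_follow_less[OF L] by (auto simp: cyc_def intro!: exI[of _ "j - i"])
  then show ?thesis by auto
qed

text \<open>Connectedness enters here and makes the cycle unique. The nodes whose orbit meets a
  given cycle form a set \<open>E\<close> closed under adjacency, hence all nodes; and a periodic
  node whose orbit meets the cycle lies on it.\<close>

lemma cycle_enumeration:
  obtains n c where "n > 0" "cyc = c ` {..<n}" "inj_on c {..<n}" "\<And>i. c (Suc i) = follow (c i)" "c n = c 0"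
proof -
  obtain c0 where c0: "c0 \<in> cyc" using cyc_nonempty by auto
  define c where "c i = (follow ^^ i) c0" for i
  define n where "n = (LEAST n. n > 0 \<and> c n = c0)"
  have ex: "\<exists>n>0. c n = c0" using c0 by (auto simp: cyc_def c_def)
  have n: "n > 0" "c n = c0" using LeastI_ex[OF ex] by (auto simp: n_def)
  have least: "n \<le> k" if "k > 0" "c k = c0" for k
    unfolding n_def using that by (intro Least_le) auto
  have add: "c (i + j) = (follow ^^ i) (c j)" for i j by (simp add: c_def funpow_add)
  have inj: "inj_on c {..<n}"
  proof (rule linorder_inj_onI)
    fix i j assume ij: "i < j" "j \<in> {..<n}"
    show "c i \<noteq> c j"
    proof
      assume "c i = c j"
      then have "c ((n - j) + i) = c ((n - j) + j)" by (simp only: add)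
      then have "c ((n - j) + i) = c0" using ij n by simp
      then show False using least[of "(n - j) + i"] ij by auto
    qed
  qed auto
  have range_c: "c i \<in> c ` {..<n}" for i
  proof -
    have "(follow ^^ (i div n * n)) c0 = c0"
      by (rule funpow_fixed_mult) (use n in \<open>simp add: c_def\<close>)
    then have "c (i mod n + i div n * n) = c (i mod n)" unfolding c_def funpow_add by simp
    then have "c i = c (i mod n)" by (simp only: mod_div_mult_eq)
    then show ?thesis using n by auto
  qed
  define E where "E = {v. \<exists>j. (follow ^^ j) v \<in> c ` {..<n}}"
  have E_follow: "follow v \<in> E \<longleftrightarrow> v \<in> E" for v
  proof
    assume "follow v \<in> E"
    then obtain j where "(follow ^^ j) (follow v) \<in> c ` {..<n}" by (auto simp: E_def)
    then have "(follow ^^ Suc j) v \<in> c ` {..<n}" by (simp add: funpow_swap1)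
    then show "v \<in> E" unfolding E_def by blast
  next
    assume "v \<in> E"
    then obtain j where "(follow ^^ j) v \<in> c ` {..<n}" by (auto simp: E_def)
    then obtain i where "(follow ^^ j) v = c i" by auto
    then have "(follow ^^ j) (follow v) = c (Suc i)" by (simp add: funpow_swap1[symmetric] c_def)
    then have "(follow ^^ j) (follow v) \<in> c ` {..<n}" by (simp only: range_c)
    then show "follow v \<in> E" unfolding E_def by blast
  qed
  have E_edge: "fst (m h) \<in> E \<longleftrightarrow> fst h \<in> E" if h: "h \<in> half_edges val" for h
  proof (cases "h \<in> Bar")
    case True
    then have "fst (m h) = follow (fst h)" using Bar_eq_out[OF True] by (simp add: follow_def)
    then show ?thesis by (simp add: E_follow)
  next
    case False
    then have "m h \<in> Bar" using Bar_edge h by auto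
    from Bar_eq_out[OF this] have "follow (fst (m h)) = fst (m (m h))" by (simp add: follow_def)
    then show ?thesis using m_m[OF h] E_follow[of "fst (m h)"] by simp
  qed
  have in_E: "v \<in> E" if "v < length val" for v
  proof -
    have c0E: "c0 \<in> E" using n unfolding E_def by (auto intro!: exI[of _ 0] image_eqI[of _ _ 0] simp: c_def)
    have "(c0, v) \<in> {(fst h, fst (m h)) | h. h \<in> half_edges val}\<^sup>*"
      using connected that c0 by (auto simp: connected_topology_def cyc_def)
    then show ?thesis
      by (induction rule: rtrancl_induct) (use c0E E_edge in auto)
  qed
  have "cyc = c ` {..<n}"
  proof
    show "cyc \<subseteq> c ` {..<n}"
    proof
      fix v assume v: "v \<in> cyc"
      then obtain k where k: "k > 0" "(follow ^^ k) v = v" by (auto simp: cyc_def)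
      obtain j i where j: "(follow ^^ j) v = c i"
        using in_E[of v] v by (auto simp: E_def cyc_def)
      \<comment> \<open>The multiple \<open>j * k\<close> of the period of v is large enough for the
        orbit of v to meet the cycle before it returns to v.\<close>
      have "j \<le> j * k" using k by simp
      then have "v = (follow ^^ (j * k - j + j)) v"
        using funpow_fixed_mult[OF k(2), of j] by simp
      also have "\<dots> = c (j * k - j + i)"
        unfolding add j[symmetric] by (simp add: funpow_add)
      finally show "v \<in> c ` {..<n}" using range_c by metis
    qed
    have "c i \<in> cyc" for i by (induction i) (auto simp: c_def c0 follow_cyc)
    then show "c ` {..<n} \<subseteq> cyc" by auto
  qed
  then show thesis using that[of n c] n inj by (auto simp: c_def)
qed

lemma cyc_less: "v \<in> cyc \<Longrightarrow> v < length val"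
  by (simp add: cyc_def)

lemma pred_eq: "u \<in> cyc \<Longrightarrow> pred (follow u) = u"
  unfolding pred_def by (rule the_equality) (auto dest: follow_inj_cyc)

lemma pred_cyc: 
  assumes "v \<in> cyc"
  shows "pred v \<in> cyc" "follow (pred v) = v"
proof -
  obtain n c where c: "n > 0" "cyc = c ` {..<n}" "inj_on c {..<n}" "\<And>i. c (Suc i) = follow (c i)" "c n = c 0"
    using cycle_enumeration by blast
  obtain i where i: "i < n" "v = c i" using assms c(2) by auto
  define j where "j = (if i = 0 then n - 1 else i - 1)"
  have j: "j < n" "c (Suc j) = v" using i c(1,5) by (auto simp: j_def)
  have "c j \<in> cyc" "follow (c j) = v" using j c by auto
  then show "pred v \<in> cyc" "follow (pred v) = v" using pred_eq[of "c j"] by auto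
qed

lemma fst_inn: "v \<in> cyc \<Longrightarrow> fst (inn v) = v"
  using pred_cyc(2)[of v] by (simp add: inn_def follow_def)

lemma inn_in: "v \<in> cyc \<Longrightarrow> inn v \<in> half_edges val"
  using pred_cyc(1)[of v] unfolding inn_def by (intro m_in out_in cyc_less)

lemma inn_notin_Bar: "v \<in> cyc \<Longrightarrow> inn v \<notin> Bar"
  using pred_cyc(1)[of v] Bar_edge out_in out_in_Bar unfolding inn_def by (auto simp: cyc_less)

lemma m_out_cyc: "v \<in> cyc \<Longrightarrow> m (out v) = inn (follow v)"
  by (simp add: inn_def pred_eq)

lemma cycle_edges_m: "h \<in> half_edges val \<Longrightarrow> m h \<in> cycle_edges \<longleftrightarrow> h \<in> cycle_edges"
proof -
  have *: "m h \<in> cycle_edges" if h: "h \<in> cycle_edges" for h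
  proof -
    consider v where "v \<in> cyc" "h = out v" | v where "v \<in> cyc" "h = inn v"
      using h by (auto simp: cycle_edges_def)
    then show ?thesis
    proof cases
      case 1
      then show ?thesis by (auto simp: m_out_cyc cycle_edges_def intro: follow_cyc)
    next
      case 2
      have "m h = out (pred v)"
        unfolding 2(2) inn_def by (intro m_m out_in cyc_less pred_cyc(1) 2(1))
      then show ?thesis using pred_cyc(1)[OF 2(1)] by (simp add: cycle_edges_def)
    qed
  qed
  have "h \<in> cycle_edges \<Longrightarrow> h \<in> half_edges val" for h
    using out_in inn_in cyc_less by (auto simp: cycle_edges_def)
  then show "h \<in> half_edges val \<Longrightarrow> m h \<in> cycle_edges \<longleftrightarrow> h \<in> cycle_edges"
    using * m_m by metis
qed

lemma cycle_edges_sub: "cycle_edges \<subseteq> half_edges val"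
  using out_in inn_in cyc_less by (auto simp: cycle_edges_def)

lemma cycle_edges_iff: "h \<in> cycle_edges \<longleftrightarrow> fst h \<in> cyc \<and> (h = out (fst h) \<or> h = inn (fst h))"
  using fst_inn by (auto simp: cycle_edges_def)

text \<open>Induction through the trees attached to the cycle, from the leaves inwards. The measure
  is the number of nodes whose orbit passes through v. It is smaller for a predecessor of v, because
  v could lie upstream of it only by being periodic.\<close>

lemma noncyclic_induct:
  assumes step: "\<And>v. v < length val \<Longrightarrow> v \<notin> cyc \<Longrightarrow>
      (\<And>w. w < length val \<Longrightarrow> w \<notin> cyc \<Longrightarrow> follow w = v \<Longrightarrow> P w) \<Longrightarrow> P v"
    and v: "v < length val" "v \<notin> cyc"
  shows "P v"
proof -
  let ?A = "\<lambda>v. {w. w < length val \<and> (\<exists>j. (follow ^^ j) w = v)}"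
  show ?thesis
    using v
  proof (induction "card (?A v)" arbitrary: v rule: less_induct)
    case less
    show ?case
    proof (rule step[OF less.prems])
      fix w assume w: "w < length val" "w \<notin> cyc" "follow w = v"
      have sub: "?A w \<subseteq> ?A v"
        using w(3) by (auto intro: exI[of _ "Suc _"])
      have mem: "v \<in> ?A v" using less.prems by (auto intro: exI[of _ 0])
      have nmem: "v \<notin> ?A w"
      proof
        assume "v \<in> ?A w"
        then obtain j where "(follow ^^ j) v = w" by auto
        then have "(follow ^^ Suc j) v = v" using w(3) by simp
        then show False using less.prems unfolding cyc_def by blast
      qed
      have "?A w \<noteq> ?A v"
      proof
        assume eq: "?A w = ?A v"
        have "v \<in> ?A w" unfolding eq by (rule mem)
        with nmem show False by (rule notE)
      qed
      with sub have "?A w \<subset> ?A v" by (rule psubsetI)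
      then have "card (?A w) < card (?A v)" by (intro psubset_card_mono) auto
      then show "P w" using less.hyps w(1,2) by blast
    qed
  qed
qed

lemma cycle_edges_sign:
  "(\<Prod>v\<in>cyc. order_sign (out v) (inn v)) * (\<Prod>v\<in>cyc. - order_sign (out v) (m (out v))) *
    (-1) ^ card {(h, h'). h \<in> cycle_edges \<and> h' \<in> cycle_edges \<and> crossing m h h'} = -1"
proof -
  obtain n c where c: "n > 0" "cyc = c ` {..<n}" "inj_on c {..<n}" "\<And>i. c (Suc i) = follow (c i)" "c n = c 0"
    using cycle_enumeration by blast
  have c_cyc: "c i \<in> cyc" if "i \<le> n" for i
    using c that by (cases "i = n") auto
  \<comment> \<open>The cycle as one closed sequence of half-edges: even places enter a node, odd
    places leave it.\<close>
  define w where "w i = (if even i then inn (c (i div 2)) else out (c (i div 2)))" for i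
  have w: "w (2 * i) = inn (c i)" "w (2 * i + 1) = out (c i)" "w (2 * i + 2) = inn (c (Suc i))" for i
    by (simp_all add: w_def)
  have m_out: "m (out (c i)) = inn (c (Suc i))" if "i < n" for i
    using m_out_cyc[of "c i"] c_cyc[of i] that c(4) by simp
  have image: "w ` {..<2 * n} = cycle_edges"
  proof
    show "w ` {..<2 * n} \<subseteq> cycle_edges"
      using c_cyc by (auto simp: w_def cycle_edges_def)
    have "inn (c i) = w (2 * i)" "out (c i) = w (2 * i + 1)" for i by (simp_all only: w)
    then show "cycle_edges \<subseteq> w ` {..<2 * n}"
      unfolding cycle_edges_def c(2) image_image by fastforce
  qed
  have "(\<Prod>i<n. order_sign (w (2 * i + 1)) (w (2 * i))) * (\<Prod>i<n. - order_sign (w (2 * i + 1)) (w (2 * i + 2))) *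
    (-1) ^ card {(h, h'). h \<in> w ` {..<2 * n} \<and> h' \<in> w ` {..<2 * n} \<and> crossing m h h'} = -1"
  proof (rule cycle_sign)
    show "w (2 * n) = w 0" using c(5) by (simp add: w_def)
    show "inj_on w {..<2 * n}"
    proof (rule inj_onI)
      fix i j assume ij: "i \<in> {..<2 * n}" "j \<in> {..<2 * n}" "w i = w j"
      have d: "i div 2 < n" "j div 2 < n" using ij by auto
      have "fst (w k) = c (k div 2)" if "k div 2 < n" for k
        using fst_inn c_cyc[of "k div 2"] that by (simp add: w_def)
      then have "c (i div 2) = c (j div 2)" using ij(3) d by metis
      then have "i div 2 = j div 2" using c(3) d by (auto dest: inj_onD)
      moreover have "even i \<longleftrightarrow> even j"
      proof -
        have "w k \<in> Bar \<longleftrightarrow> odd k" if "k div 2 < n" for k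
          using inn_notin_Bar c_cyc[of "k div 2"] that out_in_Bar cyc_less by (auto simp: w_def)
        then show ?thesis using ij(3) d by metis
      qed
      ultimately show "i = j" by presburger
    qed
    show "m (w (2 * i + 1)) = w (2 * i + 2)" if "i < n" for i
      using m_out[OF that] by (simp only: w)
    then show "m (w (2 * i + 2)) = w (2 * i + 1)" if "i < n" for i
      using m_m[OF out_in[OF cyc_less[OF c_cyc]], of i] that by (metis less_imp_le_nat w(2))
    show "fst (w (2 * i)) = fst (w (2 * i + 1))" if "i < n" for i
      using fst_inn[OF c_cyc[of i]] that by (simp only: w fst_out)
    show "i = j" if "i < n" "j < n" "fst (w (2 * i)) = fst (w (2 * j))" for i j
      using that fst_inn[OF c_cyc[of i]] fst_inn[OF c_cyc[of j]] inj_onD[OF c(3), of i j] by (simp only: w) auto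
  qed fact
  moreover have "(\<Prod>v\<in>cyc. order_sign (out v) (inn v)) = (\<Prod>i<n. order_sign (w (2 * i + 1)) (w (2 * i)))"
    unfolding c(2) prod.reindex[OF c(3)] comp_def w ..
  moreover have "(\<Prod>v\<in>cyc. - order_sign (out v) (m (out v))) = (\<Prod>i<n. - order_sign (w (2 * i + 1)) (w (2 * i + 2)))"
    unfolding c(2) prod.reindex[OF c(3)] comp_def w
    by (intro prod.cong refl) (simp add: m_out)
  ultimately show ?thesis by (simp only: image)
qed

end

section \<open>Cancellation of the loop contributions\<close>

lemma tym_vertices_facts:
  assumes "M \<in> tym_vertices"
  shows "size (filter_mset barred M) = 1" "(\<Sum>x\<in>#M. ghost_number x) = 0"
  using assms by (cases; simp)+

lemma ghost_number_opposite:
  assumes "sector_of x = sector_of y" "barred x \<noteq> barred y"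
  shows "ghost_number y = - ghost_number x"
  using assms by (cases x; cases y) auto

lemma half_edges_Sigma: "half_edges val = Sigma {..<length val} (\<lambda>v. {..<val ! v})"
  by (auto simp: half_edges_def)

lemma finite_half_edges [simp]: "finite (half_edges val)"
  by (simp add: half_edges_Sigma)

text \<open>All momenta are frozen at one conserving configuration \<open>k\<close>, because the
  cancellation takes place between integrands.\<close>

locale diagram = tym +
  fixes n :: nat and val :: "nat list" and m :: pairing and xs :: "'a tym_field list"
    and ps :: "momentum list" and k :: "half_edge \<Rightarrow> momentum"
  assumes n_le: "n \<le> length val" and external: "\<And>i. i < n \<Longrightarrow> val ! i = 1"
    and internal: "\<And>v. n \<le> v \<Longrightarrow> v < length val \<Longrightarrow> val ! v > 0"
    and is_pairing: "is_pairing val m" and is_connected: "connected_topology val m"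
    and has_loop: "loops val \<ge> 1"
    and lengths: "length xs = n" "length ps = n" and k: "k \<in> momenta ps val m"
begin

definition node_labels :: "(half_edge \<Rightarrow> 'a tym_field) \<Rightarrow> nat \<Rightarrow> 'a tym_field list" where
  "node_labels lab v = map (\<lambda>r. lab (v, r)) [0..<val ! v]"

definition node_momenta :: "nat \<Rightarrow> momentum list" where
  "node_momenta v = map (\<lambda>r. k (v, r)) [0..<val ! v]"

definition amplitude :: "(half_edge \<Rightarrow> 'a tym_field) \<Rightarrow> complex" where
  "amplitude lab = integrand anticommuting (tym_action f g \<sigma> S0) n val m lab k"

lemma amplitude_eq:
  "amplitude lab = wick_sign anticommuting val m lab *
     (\<Prod>v\<in>{n..<length val}. - V (node_labels lab v) (node_momenta v) / of_nat (fact (val ! v))) *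
     (\<Prod>h\<in>{h \<in> half_edges val. hless h (m h)}. prop (k h) $ lab h $ lab (m h))"
  by (simp add: amplitude_def integrand_def node_labels_def node_momenta_def)

lemma length_node [simp]: "length (node_labels lab v) = val ! v" "length (node_momenta v) = val ! v"
  by (simp_all add: node_labels_def node_momenta_def)

lemma sum_node_momenta: "v \<in> {n..<length val} \<Longrightarrow> sum_list (node_momenta v) = 0"
  using k lengths by (simp add: momenta_def node_momenta_def interv_sum_list_conv_sum_set_nat atLeast0LessThan)

lemma m_in: "h \<in> half_edges val \<Longrightarrow> m h \<in> half_edges val"
  and m_m: "h \<in> half_edges val \<Longrightarrow> m (m h) = h"
  and m_neq: "h \<in> half_edges val \<Longrightarrow> m h \<noteq> h"
  using is_pairing by (auto simp: is_pairing_def permutes_in_image)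

end

text \<open>The amplitude is a product, so assuming it nonzero yields the selection rules of all
  vertices and all lines at once.\<close>

locale labelled_diagram = diagram +
  fixes lab :: "half_edge \<Rightarrow> 'a tym_field"
  assumes lab: "lab \<in> labellings xs val" and nonzero: "amplitude lab \<noteq> 0"
begin

definition Bar :: "half_edge set" where "Bar = {h \<in> half_edges val. barred (lab h)}"

lemma vertex_matter:
  assumes v: "v \<in> {n..<length val}"
  shows "mset (filter (\<lambda>x. \<not> is_gauge x) (node_labels lab v)) \<in> tym_vertices"
proof (rule vertex_in_tym_vertices[OF S0])
  show "node_labels lab v \<noteq> []" using internal[of v] v by (auto simp: node_labels_def)
  show "sum_list (node_momenta v) = 0" using v by (rule sum_node_momenta)
  show "V (node_labels lab v) (node_momenta v) \<noteq> 0"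
    using nonzero v unfolding amplitude_eq by auto
qed simp

lemma edge_labels:
  assumes h: "h \<in> half_edges val"
  shows "sector_of (lab (m h)) = sector_of (lab h)" "barred (lab (m h)) \<longleftrightarrow> \<not> barred (lab h)"
proof -
  have *: "prop (k h) $ lab h $ lab (m h) \<noteq> 0" if "h \<in> half_edges val" "hless h (m h)" for h
    using nonzero that unfolding amplitude_eq by (cases h) auto
  have **: "sector_of (lab (m h)) = sector_of (lab h) \<and> (barred (lab (m h)) \<longleftrightarrow> \<not> barred (lab h))"
    if "h \<in> half_edges val" "hless h (m h)" for h
    using prop_nonzero[OF *[OF that]] by auto
  have "hless h (m h) \<or> hless (m h) (m (m h))"
    using hless_total[of h "m h"] m_neq[OF h] m_m[OF h] by auto
  then show "sector_of (lab (m h)) = sector_of (lab h)" "barred (lab (m h)) \<longleftrightarrow> \<not> barred (lab h)"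
    using **[OF h] **[OF m_in[OF h]] m_m[OF h] by auto
qed

lemma ghost_number_edge: "h \<in> half_edges val \<Longrightarrow> ghost_number (lab (m h)) = - ghost_number (lab h)"
  using edge_labels[of h] by (intro ghost_number_opposite) auto

lemma ghost_number_vertex:
  assumes v: "v \<in> {n..<length val}"
  shows "(\<Sum>r<val ! v. ghost_number (lab (v, r))) = 0"
proof -
  have "(\<Sum>r<val ! v. ghost_number (lab (v, r))) = sum_list (map ghost_number (node_labels lab v))"
    by (simp add: node_labels_def interv_sum_list_conv_sum_set_nat atLeast0LessThan comp_def)
  also have "\<dots> = sum_list (map ghost_number (filter (\<lambda>x. \<not> is_gauge x) (node_labels lab v)))"
  proof -
    have gauge: "ghost_number x = 0" if "is_gauge x" for x :: "'a tym_field"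
      using that by (cases x) auto
    show ?thesis
      by (rule sum_list_map_filter[symmetric]) (use gauge in auto)
  qed
  also have "\<dots> = (\<Sum>x\<in>#mset (filter (\<lambda>x. \<not> is_gauge x) (node_labels lab v)). ghost_number x)"
    by (simp only: sum_mset_sum_list[symmetric] mset_map)
  also have "\<dots> = 0" by (rule tym_vertices_facts(2)[OF vertex_matter[OF v]])
  finally show ?thesis .
qed

lemma card_Bar_node:
  assumes v: "v \<in> {n..<length val}"
  shows "card {r. r < val ! v \<and> barred (lab (v, r))} = 1"
proof -
  have "filter_mset barred (mset (filter (\<lambda>x. \<not> is_gauge x) (node_labels lab v))) = mset (filter barred (node_labels lab v))"
    by (simp only: mset_filter[symmetric] filter_filter) (rule arg_cong[where f = mset], rule filter_cong, auto simp: is_gauge_not_barred)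
  then have "length (filter barred (node_labels lab v)) = 1"
    using tym_vertices_facts(1)[OF vertex_matter[OF v]] by (metis size_mset)
  then show ?thesis
    unfolding length_filter_conv_card length_node by (simp add: node_labels_def cong: conj_cong)
qed

text \<open>An external node has only one half-edge, and an interaction vertex has exactly one
  barred leg.\<close>

lemma inj_fst_Bar: "inj_on fst Bar"
proof (rule inj_onI)
  fix h h' assume hh: "h \<in> Bar" "h' \<in> Bar" "fst h = fst h'"
  obtain v r where h: "h = (v, r)" by (cases h)
  obtain r' where h': "h' = (v, r')" using hh(3) h by (cases h') auto
  have less: "v < length val" "r < val ! v" "r' < val ! v" using hh h h' by (auto simp: Bar_def half_edges_def)
  have "r = r'"
  proof (cases "v < n")
    case True
    then show ?thesis using less external[of v] by simp
  next
    case False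
    then obtain s where "{r. r < val ! v \<and> barred (lab (v, r))} = {s}"
      using card_Bar_node[of v] less by (auto simp: card_1_singleton_iff)
    moreover have "r \<in> {r. r < val ! v \<and> barred (lab (v, r))}" "r' \<in> {r. r < val ! v \<and> barred (lab (v, r))}"
      using hh h h' less by (auto simp: Bar_def)
    ultimately show ?thesis by auto
  qed
  then show "h = h'" using h h' by simp
qed

text \<open>
  Every edge has one barred end and every node at most one barred half-edge, so that a diagram with
  as many edges as nodes has exactly one at every node, the external ones included.
\<close>

lemma fst_Bar: "fst ` Bar = {..<length val}"
proof -
  have fin: "finite Bar" by (simp add: Bar_def)
  have "inj_on m Bar"
    by (rule inj_onI) (metis (no_types, lifting) Bar_def m_m mem_Collect_eq)
  moreover have "half_edges val = Bar \<union> m ` Bar"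
  proof
    show "half_edges val \<subseteq> Bar \<union> m ` Bar"
    proof
      fix h assume h: "h \<in> half_edges val"
      show "h \<in> Bar \<union> m ` Bar"
      proof (cases "barred (lab h)")
        case False
        then have "m h \<in> Bar" using edge_labels(2)[OF h] m_in[OF h] by (simp add: Bar_def)
        then show ?thesis using m_m[OF h] by (metis UnI2 imageI)
      qed (use h in \<open>simp add: Bar_def\<close>)
    qed
  qed (use m_in in \<open>auto simp: Bar_def\<close>)
  moreover have "Bar \<inter> m ` Bar = {}"
    using edge_labels(2) by (auto simp: Bar_def)
  ultimately have "card (half_edges val) = 2 * card Bar"
    using fin by (simp add: card_Un_disjoint card_image)
  then have "length val \<le> card (fst ` Bar)"
    using has_loop by (simp add: loops_def card_image[OF inj_fst_Bar])
  moreover have "fst ` Bar \<subseteq> {..<length val}"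
    by (auto simp: Bar_def half_edges_def)
  ultimately show ?thesis
    by (metis card_lessThan card_seteq finite_lessThan)
qed

sublocale unicyclic val m Bar
proof
  show "is_pairing val m" "connected_topology val m" by (rule is_pairing is_connected)+
  show "Bar \<subseteq> half_edges val" by (auto simp: Bar_def)
  show "m h \<in> Bar \<longleftrightarrow> h \<notin> Bar" if "h \<in> half_edges val" for h
    using edge_labels(2)[OF that] m_in[OF that] that by (simp add: Bar_def)
  show "\<exists>!r. (v, r) \<in> Bar" if "v < length val" for v
  proof -
    have "v \<in> fst ` Bar" using that by (simp add: fst_Bar)
    then obtain r where r: "(v, r) \<in> Bar" by auto
    have "r' = r" if "(v, r') \<in> Bar" for r'
      using inj_onD[OF inj_fst_Bar _ that r] by simp
    with r show ?thesis by blast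
  qed
qed

lemma barred_out: "v < length val \<Longrightarrow> barred (lab (out v))"
  using out_in_Bar by (simp add: Bar_def)

lemma out_external: "v < n \<Longrightarrow> out v = (v, 0)"
  using out_in[of v] n_le external[of v] by (cases "out v") (auto simp: half_edges_def out_def)

lemma barred_ghost_number: "barred x \<Longrightarrow> ghost_number x \<le> 0"
  by (cases x) auto

text \<open>The two ends of a line cancel in the total ghost number and every vertex is neutral, so
  the external ghost numbers add up to 0. External fields are barred, hence none of these numbers is
  positive.\<close>

lemma ghost_number_external:
  assumes v: "v < n"
  shows "ghost_number (lab (v, 0)) = 0"
proof -
  have "(\<Sum>h\<in>half_edges val. ghost_number (lab h)) = (\<Sum>h\<in>half_edges val. ghost_number (lab (m h)))"
    by (rule sum.reindex_bij_witness[of _ m m]) (auto simp: m_m m_in)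
  also have "\<dots> = - (\<Sum>h\<in>half_edges val. ghost_number (lab h))"
    by (simp add: ghost_number_edge sum_negf)
  finally have "(\<Sum>h\<in>half_edges val. ghost_number (lab h)) = 0" by simp
  moreover have "(\<Sum>h\<in>half_edges val. ghost_number (lab h)) = (\<Sum>v<length val. \<Sum>r<val ! v. ghost_number (lab (v, r)))"
    unfolding half_edges_Sigma by (simp add: sum.Sigma)
  moreover have "\<dots> = (\<Sum>v<n. \<Sum>r<val ! v. ghost_number (lab (v, r)))"
    by (rule sum.mono_neutral_right) (use n_le ghost_number_vertex in auto)
  moreover have "\<dots> = (\<Sum>v<n. ghost_number (lab (v, 0)))"
    by (rule sum.cong) (auto simp: external)
  ultimately have "(\<Sum>v<n. - ghost_number (lab (v, 0))) = 0" by (simp add: sum_negf)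
  moreover have "ghost_number (lab (w, 0)) \<le> 0" if "w < n" for w
    using barred_out[of w] out_external[OF that] that n_le by (intro barred_ghost_number) auto
  ultimately show ?thesis
    using v by (subst (asm) sum_nonneg_eq_0_iff) auto
qed

text \<open>The legs other than \<open>out v\<close> connect to subtrees and are neutral by
  induction; neutrality of the vertex settles the remaining leg.\<close>

lemma ghost_number_off_cycle:
  assumes "v < length val" "v \<notin> cyc"
  shows "ghost_number (lab (out v)) = 0"
proof (rule noncyclic_induct[OF _ assms])
  fix v
  assume v: "v < length val" "v \<notin> cyc"
    and IH: "\<And>w. w < length val \<Longrightarrow> w \<notin> cyc \<Longrightarrow> follow w = v \<Longrightarrow> ghost_number (lab (out w)) = 0"
  show "ghost_number (lab (out v)) = 0"
  proof (cases "v < n")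
    case True
    then show ?thesis by (simp add: ghost_number_external out_external)
  next
    case False
    obtain p where p: "out v = (v, p)" using that[of "snd (out v)"] by (simp add: prod_eq_iff)
    have p_less: "p < val ! v" using out_in[OF v(1)] p by (simp add: half_edges_def)
    have "ghost_number (lab (v, r)) = 0" if r: "r < val ! v" "r \<noteq> p" for r
    proof -
      have h: "(v, r) \<in> half_edges val" using r v(1) by (simp add: half_edges_def)
      have "(v, r) \<notin> Bar"
      proof
        assume "(v, r) \<in> Bar"
        from Bar_eq_out[OF this] show False using p r by simp
      qed
      from unmarked[OF h this] obtain w where w: "w < length val" "(v, r) = m (out w)" "follow w = v"
        by (metis fst_conv)
      have "w \<notin> cyc" using follow_cyc[of w] w(3) v(2) by blast
      then have "ghost_number (lab (out w)) = 0" using w by (intro IH)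
      then show ?thesis unfolding w(2) using ghost_number_edge[OF out_in[OF w(1)]] by simp
    qed
    then have "(\<Sum>r<val ! v. ghost_number (lab (v, r))) = (\<Sum>r\<in>{p}. ghost_number (lab (v, r)))"
      using p_less by (intro sum.mono_neutral_right) auto
    then show ?thesis using ghost_number_vertex[of v] False v(1) p by simp
  qed
qed

lemma off_cycle_even:
  assumes h: "h \<in> half_edges val" "h \<notin> cycle_edges"
  shows "ghost_number (lab h) = 0"
proof (cases "h \<in> Bar")
  case True
  then have "h = out (fst h)" by (rule Bar_eq_out)
  moreover have "fst h \<notin> cyc" using calculation h(2) cycle_edges_iff by auto
  ultimately show ?thesis using ghost_number_off_cycle[of "fst h"] node_less[OF h(1)] by metis
next
  case False
  from unmarked[OF h(1) False] obtain w where w: "w < length val" "h = m (out w)" "follow w = fst h" .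
  have "w \<notin> cyc"
  proof
    assume "w \<in> cyc"
    then have "h = inn (follow w)" "follow w \<in> cyc" using m_out_cyc w(2) follow_cyc by auto
    then show False using h(2) by (simp add: cycle_edges_def)
  qed
  then show ?thesis
    using ghost_number_off_cycle[OF w(1)] ghost_number_edge[OF out_in[OF w(1)]] w(2) by simp
qed

text \<open>The single half-edge of an external node cannot be both the barred \<open>out v\<close>
  and the unbarred \<open>inn v\<close>.\<close>

lemma cyc_internal: "v \<in> cyc \<Longrightarrow> v \<in> {n..<length val}"
proof (rule ccontr)
  assume v: "v \<in> cyc" "v \<notin> {n..<length val}"
  then have "v < n" using cyc_less by fastforce
  then have "inn v = (v, 0)" "out v = (v, 0)"
    using inn_in[OF v(1)] fst_inn[OF v(1)] external[of v] out_external[of v]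
    by (auto simp: half_edges_def prod_eq_iff)
  then show False using inn_notin_Bar[OF v(1)] out_in_Bar[OF cyc_less[OF v(1)]] by simp
qed

text \<open>The remaining legs are neutral and unbarred, which leaves only A; this is the situation
  that \<open>vertex_toggle\<close> requires.\<close>

lemma cycle_node:
  assumes v: "v \<in> cyc"
  obtains p q where "out v = (v, p)" "inn v = (v, q)" "p < val ! v" "q < val ! v" "p \<noteq> q"
    "\<And>r. r < val ! v \<Longrightarrow> r \<noteq> p \<Longrightarrow> r \<noteq> q \<Longrightarrow> (v, r) \<notin> cycle_edges \<and> is_gauge (lab (v, r))"
proof -
  obtain p where p: "out v = (v, p)" using that[of "snd (out v)"] by (simp add: prod_eq_iff)
  obtain q where q: "inn v = (v, q)" using fst_inn[OF v] by (cases "inn v") auto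
  have less: "p < val ! v" "q < val ! v"
    using out_in[OF cyc_less[OF v]] inn_in[OF v] p q by (auto simp: half_edges_def)
  have "p \<noteq> q"
    using inn_notin_Bar[OF v] out_in_Bar[OF cyc_less[OF v]] p q by auto
  moreover have "(v, r) \<notin> cycle_edges \<and> is_gauge (lab (v, r))" if r: "r < val ! v" "r \<noteq> p" "r \<noteq> q" for r
  proof -
    have h: "(v, r) \<in> half_edges val" using r cyc_less[OF v] by (simp add: half_edges_def)
    have not_cyc: "(v, r) \<notin> cycle_edges" using cycle_edges_iff[of "(v, r)"] p q r by simp
    have "(v, r) \<notin> Bar"
    proof
      assume "(v, r) \<in> Bar"
      from Bar_eq_out[OF this] show False using p r by simp
    qed
    then have "\<not> barred (lab (v, r))" using h by (simp add: Bar_def)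
    then have "is_gauge (lab (v, r))"
      using off_cycle_even[OF h not_cyc] by (cases "lab (v, r)") auto
    then show ?thesis using not_cyc by simp
  qed
  ultimately show thesis using that p q less by blast
qed

text \<open>With all other legs A there are at most two fields of another kind, which rules out
  \<phi>-bar c \<psi>. The second alternative is the vertex \<chi>-bar c.\<close>

lemma cycle_node_sector:
  assumes v: "v \<in> cyc"
  shows "sector_of (lab (out v)) = sector_of (lab (inn v)) \<or>
     sector_of (lab (inn v)) = Sector_c \<and> sector_of (lab (out v)) = Sector_psi"
    and "\<not> barred (lab (inn v))"
proof -
  obtain p q where pq: "out v = (v, p)" "inn v = (v, q)" "p < val ! v" "q < val ! v" "p \<noteq> q"
    "\<And>r. r < val ! v \<Longrightarrow> r \<noteq> p \<Longrightarrow> r \<noteq> q \<Longrightarrow> (v, r) \<notin> cycle_edges \<and> is_gauge (lab (v, r))"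
    using cycle_node[OF v] by blast
  show unbarred: "\<not> barred (lab (inn v))"
    using inn_notin_Bar[OF v] inn_in[OF v] by (simp add: Bar_def)
  have nth: "node_labels lab v ! r = lab (v, r)" if "r < val ! v" for r
    using that by (simp add: node_labels_def)
  have bar: "barred (lab (v, p))" using barred_out[OF cyc_less[OF v]] pq by simp
  have "mset (filter (\<lambda>x. \<not> is_gauge x) (node_labels lab v)) =
      (if is_gauge (lab (v, q)) then {#lab (v, p)#} else {#lab (v, p), lab (v, q)#})"
    using mset_matter_pair[of "node_labels lab v" p q] pq bar by (simp add: nth is_gauge_not_barred)
  then have "(if is_gauge (lab (v, q)) then {#lab (v, p)#} else {#lab (v, p), lab (v, q)#}) \<in> tym_vertices"
    using vertex_matter[OF cyc_internal[OF v]] by simp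
  then have "sector_of (lab (v, p)) = sector_of (lab (v, q)) \<or>
     sector_of (lab (v, q)) = Sector_c \<and> sector_of (lab (v, p)) = Sector_psi"
    using bar unbarred unfolding pq(2)
    by cases (auto simp: add_eq_conv_ex is_gauge_not_barred split: if_splits)
  then show "sector_of (lab (out v)) = sector_of (lab (inn v)) \<or>
     sector_of (lab (inn v)) = Sector_c \<and> sector_of (lab (out v)) = Sector_psi"
    unfolding pq .
qed

lemma sector_inn_follow: "v \<in> cyc \<Longrightarrow> sector_of (lab (inn (follow v))) = sector_of (lab (out v))"
  using edge_labels(1)[OF out_in[OF cyc_less]] m_out_cyc by metis

text \<open>A line can turn from \<open>c\<close> into \<open>\<psi>\<close> but never back, so it does not change around the cycle.\<close>

lemma cycle_sector:
  assumes v: "v \<in> cyc"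
  shows "sector_of (lab (out v)) = sector_of (lab (inn v))"
proof (rule ccontr)
  assume neq: "\<not> ?thesis"
  then have turn: "sector_of (lab (inn v)) = Sector_c" "sector_of (lab (out v)) = Sector_psi"
    using cycle_node_sector(1)[OF v] by auto
  have "(follow ^^ j) v \<in> cyc \<and> sector_of (lab (out ((follow ^^ j) v))) = Sector_psi" for j
  proof (induction j)
    case (Suc j)
    then have "follow ((follow ^^ j) v) \<in> cyc" "sector_of (lab (inn (follow ((follow ^^ j) v)))) = Sector_psi"
      using follow_cyc sector_inn_follow by auto
    then show ?case using cycle_node_sector(1)[of "follow ((follow ^^ j) v)"] by auto
  qed (use v turn in simp)
  moreover obtain N where "N > 0" "(follow ^^ N) v = v" using v by (auto simp: cyc_def)
  then obtain j where "follow ((follow ^^ j) v) = v" by (cases N) auto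
  ultimately have "sector_of (lab (inn v)) = Sector_psi" using sector_inn_follow by metis
  then show False using turn by simp
qed

lemma cycle_parity:
  "(\<forall>h\<in>cycle_edges. anticommuting (lab h)) \<or> (\<forall>h\<in>cycle_edges. \<not> anticommuting (lab h))"
proof -
  obtain N c where c: "N > 0" "cyc = c ` {..<N}" "\<And>i. c (Suc i) = follow (c i)"
    using cycle_enumeration by metis
  have all: "c i \<in> cyc \<and> sector_of (lab (out (c i))) = sector_of (lab (out (c 0)))" for i
  proof (induction i)
    case 0
    show ?case using c by auto
  next
    case (Suc i)
    then have "c (Suc i) \<in> cyc" unfolding c(3) using follow_cyc by auto
    then show ?case using Suc cycle_sector[of "c (Suc i)"] sector_inn_follow[of "c i"] c(3) by simp
  qed
  have sector_out: "sector_of (lab (out v)) = sector_of (lab (out (c 0)))" if "v \<in> cyc" for v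
  proof -
    obtain i where "v = c i" using \<open>v \<in> cyc\<close> c(2) by auto
    then show ?thesis using all[of i] by simp
  qed
  have "sector_of (lab h) = sector_of (lab (out (c 0)))" if "h \<in> cycle_edges" for h
  proof -
    consider v where "v \<in> cyc" "h = out v" | v where "v \<in> cyc" "h = inn v"
      using \<open>h \<in> cycle_edges\<close> by (auto simp: cycle_edges_def)
    then show ?thesis
      by cases (use sector_out cycle_sector in metis)+
  qed
  moreover have "anticommuting x \<longleftrightarrow> sector_of x = Sector_psi \<or> sector_of x = Sector_c" for x :: "'a tym_field"
    by (cases x) auto
  ultimately show ?thesis by auto
qed

section \<open>The exchange along the cycle\<close>

definition flip :: "half_edge \<Rightarrow> 'a tym_field" where
  "flip h = (if h \<in> cycle_edges then partner (lab h) else lab h)"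

text \<open>For one of the two labellings the odd half-edges are those of the cycle and the Wick
  sign counts its crossings; for the other no half-edge is odd. The ratio is a sign, so it is the
  same in both directions.\<close>

lemma wick_sign_flip:
  "wick_sign anticommuting val m flip =
     (-1) ^ card {(h, h'). h \<in> cycle_edges \<and> h' \<in> cycle_edges \<and> crossing m h h'} * wick_sign anticommuting val m lab"
proof -
  have even: "\<not> anticommuting (lab h)" if "h \<in> half_edges val" "h \<notin> cycle_edges" for h
    using off_cycle_even[OF that] by (simp add: anticommuting_def)
  let ?W = "(-1) ^ card {(h, h'). h \<in> cycle_edges \<and> h' \<in> cycle_edges \<and> crossing m h h'} :: complex"
  have W: "wick_sign anticommuting val m l = ?W"
    if "\<And>h. h \<in> half_edges val \<Longrightarrow> anticommuting (l h) \<longleftrightarrow> h \<in> cycle_edges" for l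
  proof -
    have "{(h, h'). h \<in> half_edges val \<and> h' \<in> half_edges val \<and> anticommuting (l h) \<and> anticommuting (l h') \<and>
        hless h h' \<and> hless h' (m h) \<and> hless (m h) (m h')} = {(h, h'). h \<in> cycle_edges \<and> h' \<in> cycle_edges \<and> crossing m h h'}"
      using that cycle_edges_sub by (auto simp: crossing_def)
    then show ?thesis unfolding wick_sign_def by simp
  qed
  have one: "wick_sign anticommuting val m l = 1" if "\<And>h. h \<in> half_edges val \<Longrightarrow> \<not> anticommuting (l h)" for l
  proof -
    have empty: "{(h, h'). h \<in> half_edges val \<and> h' \<in> half_edges val \<and> anticommuting (l h) \<and> anticommuting (l h') \<and>
        hless h h' \<and> hless h' (m h) \<and> hless (m h) (m h')} = {}"
      using that by auto
    show ?thesis unfolding wick_sign_def empty by simp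
  qed
  show ?thesis
    using cycle_parity
  proof
    assume odd: "\<forall>h\<in>cycle_edges. anticommuting (lab h)"
    have "wick_sign anticommuting val m lab = ?W" by (rule W) (use odd even in auto)
    moreover have "wick_sign anticommuting val m flip = 1" by (rule one) (use odd even in \<open>auto simp: flip_def\<close>)
    ultimately show ?thesis by (simp flip: power_add)
  next
    assume ev: "\<forall>h\<in>cycle_edges. \<not> anticommuting (lab h)"
    have "wick_sign anticommuting val m flip = ?W" by (rule W) (use ev even in \<open>auto simp: flip_def\<close>)
    moreover have "wick_sign anticommuting val m lab = 1" by (rule one) (use ev even in blast)
    ultimately show ?thesis by simp
  qed
qed

lemma vertex_flip:
  assumes v: "v \<in> {n..<length val}"
  shows "V (node_labels flip v) (node_momenta v) =
    (if v \<in> cyc then toggle_sign (lab (out v)) * order_sign (out v) (inn v) else 1) * V (node_labels lab v) (node_momenta v)"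
proof (cases "v \<in> cyc")
  case True
  obtain p q where pq: "out v = (v, p)" "inn v = (v, q)" "p < val ! v" "q < val ! v" "p \<noteq> q"
    "\<And>r. r < val ! v \<Longrightarrow> r \<noteq> p \<Longrightarrow> r \<noteq> q \<Longrightarrow> (v, r) \<notin> cycle_edges \<and> is_gauge (lab (v, r))"
    using cycle_node[OF True] by blast
  let ?Js = "node_labels lab v"
  have nth: "?Js ! r = lab (v, r)" if "r < val ! v" for r
    using that by (simp add: node_labels_def)
  have "(v, p) \<in> cycle_edges" "(v, q) \<in> cycle_edges"
    using True pq(1,2) by (auto simp: cycle_edges_def image_iff intro!: bexI[of _ v])
  then have flip: "node_labels flip v = ?Js[p := partner (?Js ! p), q := partner (?Js ! q)]"
    using pq by (intro nth_equalityI) (auto simp: nth_list_update nth, auto simp: node_labels_def flip_def)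
  have "V (?Js[p := partner (?Js ! p), q := partner (?Js ! q)]) (node_momenta v) =
      toggle_sign (?Js ! p) * transposed p q * V ?Js (node_momenta v)"
  proof (rule vertex_toggle)
    show "sum_list (node_momenta v) = 0" using v by (rule sum_node_momenta)
    show "barred (?Js ! p)" "\<not> barred (?Js ! q)" "sector_of (?Js ! p) = sector_of (?Js ! q)"
      using barred_out[OF cyc_less[OF True]] cycle_node_sector(2)[OF True] cycle_sector[OF True] pq by (simp_all add: nth)
  qed (use pq in \<open>auto simp: nth\<close>)
  moreover have "transposed p q = order_sign (out v) (inn v)"
    using pq by (auto simp: transposed_def order_sign_def hless_def)
  ultimately show ?thesis using True pq by (simp add: flip nth)
next
  case False
  then have "(v, r) \<notin> cycle_edges" for r using cycle_edges_iff[of "(v, r)"] by simp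
  then show ?thesis using False by (simp add: node_labels_def flip_def)
qed

definition edge_factor :: "half_edge \<Rightarrow> complex" where
  "edge_factor h = (if barred (lab h) then - toggle_sign (lab h) else 1) * (if barred (lab (m h)) then toggle_sign (lab (m h)) else 1)"

lemma prop_flip:
  assumes h: "h \<in> half_edges val"
  shows "prop (k h) $ flip h $ flip (m h) = (if h \<in> cycle_edges then edge_factor h else 1) * prop (k h) $ lab h $ lab (m h)"
  using cycle_edges_m[OF h] by (simp add: flip_def prop_toggle edge_factor_def)

text \<open>Propagators are indexed by the smaller end of a line, vertices of the cycle by the
  barred end \<open>out v\<close>. The reindexing passes from one to the other, and
  \<open>order_sign\<close> records whether the two ends agree.\<close>

lemma prod_edge_factor:
  "(\<Prod>h\<in>{h \<in> half_edges val. hless h (m h)}. if h \<in> cycle_edges then edge_factor h else 1) =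
     (\<Prod>v\<in>cyc. toggle_sign (lab (out v)) * - order_sign (out v) (m (out v)))"
proof -
  have "(\<Prod>h\<in>{h \<in> half_edges val. hless h (m h)}. if h \<in> cycle_edges then edge_factor h else 1)
      = (\<Prod>h\<in>{h \<in> cycle_edges. hless h (m h)}. edge_factor h)"
    using cycle_edges_sub
    by (subst prod.inter_filter[symmetric]) (auto intro!: prod.cong)
  also have "\<dots> = (\<Prod>v\<in>cyc. toggle_sign (lab (out v)) * - order_sign (out v) (m (out v)))"
  proof (rule prod.reindex_bij_witness[where
        i = "\<lambda>v. if hless (out v) (m (out v)) then out v else m (out v)"
        and j = "\<lambda>h. if h \<in> Bar then fst h else fst (m h)"])
    fix h assume "h \<in> {h \<in> cycle_edges. hless h (m h)}"
    then have h: "h \<in> cycle_edges" "hless h (m h)" "h \<in> half_edges val" using cycle_edges_sub by auto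
    let ?v = "if h \<in> Bar then fst h else fst (m h)"
    have out: "out ?v = (if h \<in> Bar then h else m h)"
      using Bar_eq_out[of h, symmetric] Bar_eq_out[of "m h", symmetric] Bar_edge[OF h(3)] by auto
    have asym: "\<not> hless (m h) h" using h(2) hless_trans hless_irrefl by blast
    show "(if hless (out ?v) (m (out ?v)) then out ?v else m (out ?v)) = h"
      unfolding out using h asym m_m by auto
    show "?v \<in> cyc"
      using h cycle_edges_m[OF h(3)] cycle_edges_iff by auto
    show "toggle_sign (lab (out ?v)) * - order_sign (out ?v) (m (out ?v)) = edge_factor h"
      unfolding out using h asym m_m[OF h(3)] edge_labels(2)[OF h(3)] by (auto simp: edge_factor_def order_sign_def Bar_def)
  next
    fix v assume v: "v \<in> cyc"
    have out: "out v \<in> Bar" "out v \<in> half_edges val" "out v \<in> cycle_edges"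
      using v out_in_Bar out_in cyc_less by (auto simp: cycle_edges_def)
    then have m_out: "m (out v) \<notin> Bar" "m (m (out v)) = out v" "m (out v) \<in> cycle_edges"
      using Bar_edge m_m cycle_edges_m by auto
    show "(if (if hless (out v) (m (out v)) then out v else m (out v)) \<in> Bar
           then fst (if hless (out v) (m (out v)) then out v else m (out v))
           else fst (m (if hless (out v) (m (out v)) then out v else m (out v)))) = v"
      using out m_out by simp
    show "(if hless (out v) (m (out v)) then out v else m (out v)) \<in> {h \<in> cycle_edges. hless h (m h)}"
      using out m_out hless_total[of "out v" "m (out v)"] m_neq[OF out(2)] by auto
  qed
  finally show ?thesis .
qed

text \<open>The sign \<open>toggle_sign\<close> of \<open>out v\<close> occurs once at the vertex v
  and once on the line leaving it, so these signs cancel; what is left is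
  \<open>cycle_edges_sign\<close>.\<close>

lemma amplitude_flip: "amplitude flip = - amplitude lab"
proof -
  let ?ts = "\<Prod>v\<in>cyc. toggle_sign (lab (out v))"
  let ?s1 = "\<Prod>v\<in>cyc. order_sign (out v) (inn v)" and ?s2 = "\<Prod>v\<in>cyc. - order_sign (out v) (m (out v))"
  let ?W = "(-1) ^ card {(h, h'). h \<in> cycle_edges \<and> h' \<in> cycle_edges \<and> crossing m h h'} :: complex"
  let ?v = "\<lambda>v. - V (node_labels lab v) (node_momenta v) / of_nat (fact (val ! v))"
  let ?e = "\<lambda>h. prop (k h) $ lab h $ lab (m h)"
  have "(\<Prod>v\<in>{n..<length val}. - V (node_labels flip v) (node_momenta v) / of_nat (fact (val ! v)))
      = (\<Prod>v\<in>{n..<length val}. (if v \<in> cyc then toggle_sign (lab (out v)) * order_sign (out v) (inn v) else 1) * ?v v)"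
    by (intro prod.cong refl) (subst vertex_flip, auto)
  also have "\<dots> = (\<Prod>v\<in>{n..<length val}. if v \<in> cyc then toggle_sign (lab (out v)) * order_sign (out v) (inn v) else 1)
      * (\<Prod>v\<in>{n..<length val}. ?v v)"
    by (rule prod.distrib)
  also have "(\<Prod>v\<in>{n..<length val}. if v \<in> cyc then toggle_sign (lab (out v)) * order_sign (out v) (inn v) else 1)
      = (\<Prod>v\<in>{n..<length val} \<inter> cyc. toggle_sign (lab (out v)) * order_sign (out v) (inn v))"
    by (simp add: prod.inter_restrict)
  also have "{n..<length val} \<inter> cyc = cyc" using cyc_internal by auto
  finally have vertices: "(\<Prod>v\<in>{n..<length val}. - V (node_labels flip v) (node_momenta v) / of_nat (fact (val ! v)))
      = ?ts * ?s1 * (\<Prod>v\<in>{n..<length val}. ?v v)"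
    by (simp add: prod.distrib)
  have edges: "(\<Prod>h\<in>{h \<in> half_edges val. hless h (m h)}. prop (k h) $ flip h $ flip (m h))
      = ?ts * ?s2 * (\<Prod>h\<in>{h \<in> half_edges val. hless h (m h)}. ?e h)" (is "?l = _")
  proof -
    have "?l = (\<Prod>h\<in>{h \<in> half_edges val. hless h (m h)}. (if h \<in> cycle_edges then edge_factor h else 1) * ?e h)"
      by (intro prod.cong refl prop_flip) auto
    then show ?thesis by (simp only: prod.distrib prod_edge_factor)
  qed
  have "?ts * ?ts = 1" by (simp flip: prod.distrib)
  moreover have "amplitude flip = (?ts * ?ts) * (?s1 * ?s2 * ?W) * amplitude lab"
    unfolding amplitude_eq vertices edges wick_sign_flip by (simp only: mult_ac)
  ultimately show ?thesis
    unfolding cycle_edges_sign by simp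
qed

lemma flip_labelling: "flip \<in> labellings xs val"
proof -
  have "(i, 0) \<notin> cycle_edges" if "i < n" for i
    using that cyc_internal[of i] cycle_edges_iff[of "(i, 0)"] by auto
  then show ?thesis
    using lab cycle_edges_sub lengths by (auto simp: labellings_def flip_def PiE_iff extensional_def)
qed

lemma Bar_flip: "{h \<in> half_edges val. barred (flip h)} = Bar"
  by (auto simp: Bar_def flip_def)

end

context diagram begin

text \<open>The exchange as a map on labellings, stated outside the locale that fixes one of them,
  so that it can be iterated. Its cycle is read off from the barred half-edges.\<close>

definition flipped :: "(half_edge \<Rightarrow> 'a tym_field) \<Rightarrow> half_edge \<Rightarrow> 'a tym_field" where
  "flipped lab h = (if h \<in> unicyclic.cycle_edges val m {h \<in> half_edges val. barred (lab h)}
     then partner (lab h) else lab h)"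

lemma sum_amplitude: "(\<Sum>lab\<in>labellings xs val. amplitude lab) = 0"
proof -
  let ?A = "{lab \<in> labellings xs val. amplitude lab \<noteq> 0}"
  have flipped: "flipped lab \<in> ?A" "flipped (flipped lab) = lab" "amplitude (flipped lab) = - amplitude lab"
    if A: "lab \<in> ?A" for lab
  proof -
    have lab: "lab \<in> labellings xs val" "amplitude lab \<noteq> 0" using A by auto
    interpret L: labelled_diagram f g \<sigma> S0 n val m xs ps k lab
      by unfold_locales (rule lab)+
    have eq: "flipped lab = L.flip"
      unfolding flipped_def[abs_def] L.flip_def[abs_def] L.Bar_def ..
    show "amplitude (flipped lab) = - amplitude lab"
      unfolding eq by (rule L.amplitude_flip)
    then show "flipped lab \<in> ?A"
      using L.flip_labelling lab(2) unfolding eq by simp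
    \<comment> \<open>The exchange preserves the set of barred half-edges, so the second exchange
      runs along the same cycle.\<close>
    have "flipped L.flip h = lab h" for h
    proof -
      have "flipped L.flip h = (if h \<in> L.cycle_edges then partner (L.flip h) else L.flip h)"
        unfolding flipped_def L.Bar_flip ..
      then show ?thesis by (simp add: L.flip_def)
    qed
    then show "flipped (flipped lab) = lab" unfolding eq by (rule ext)
  qed
  have fin: "finite (labellings xs val)"
    by (rule finite_subset[of _ "half_edges val \<rightarrow>\<^sub>E UNIV"]) (auto simp: labellings_def intro: finite_PiE)
  have all: "(\<Sum>lab\<in>labellings xs val. amplitude lab) = (\<Sum>lab\<in>?A. amplitude lab)"
    by (rule sum.mono_neutral_right) (use fin in auto)
  have "(\<Sum>lab\<in>?A. amplitude lab) = (\<Sum>lab\<in>?A. amplitude (flipped lab))"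
  proof (rule sum.reindex_bij_betw[symmetric], rule bij_betw_byWitness[where f' = flipped])
    show image: "flipped ` ?A \<subseteq> ?A" using flipped(1) by (rule image_subsetI)
    show "flipped ` ?A \<subseteq> ?A" by (rule image)
  qed (rule ballI, rule flipped(2), assumption)+
  also have "\<dots> = - (\<Sum>lab\<in>?A. amplitude lab)"
    unfolding sum_negf[symmetric] by (rule sum.cong[OF refl]) (rule flipped(3))
  finally have "(\<Sum>lab\<in>?A. amplitude lab) = 0" by simp
  with all show ?thesis by (rule trans)
qed

end

section \<open>Loop integration and the sum over topologies\<close>

lemma finite_topologies: "finite (topologies S n N)"
proof -
  let ?D = "{length (letters w) | w. w \<in> Poly_Mapping.keys S \<and> 3 \<le> length (letters w)}"
  have "finite ?D" by simp
  then have "finite {vs. set vs \<subseteq> ?D \<and> length vs = N}" by (rule finite_lists_length_eq)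
  then have "finite (\<Union>vs\<in>{vs. set vs \<subseteq> ?D \<and> length vs = N}.
      {replicate n 1 @ vs} \<times> {m. m permutes half_edges (replicate n 1 @ vs)})"
    by (intro finite_UN_I finite_cartesian_product finite_permutations) auto
  then show ?thesis
    by (rule rev_finite_subset) (auto simp: topologies_def is_pairing_def)
qed

lemma loop_integrationD:
  assumes "loop_integration I" "is_pairing val m" "length ps \<le> length val" "\<forall>i<length ps. val ! i = 1"
  shows "I ps val m (\<lambda>k. F k + G k) = I ps val m F + I ps val m G"
    and "I ps val m (\<lambda>k. c * F k) = c * I ps val m F"
    and "(\<And>k. k \<in> momenta ps val m \<Longrightarrow> F k = G k) \<Longrightarrow> I ps val m F = I ps val m G"
proof -
  have "is_pairing val m \<and> length ps \<le> length val \<and> (\<forall>i<length ps. val ! i = 1)"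
    using assms by simp
  note D = assms(1)[unfolded loop_integration_def, THEN spec[of _ ps], THEN spec[of _ val], THEN spec[of _ m], THEN mp, OF this]
  show "I ps val m (\<lambda>k. F k + G k) = I ps val m F + I ps val m G"
    by (rule D[THEN conjunct1, THEN spec, THEN spec])
  show "I ps val m (\<lambda>k. c * F k) = c * I ps val m F"
    by (rule D[THEN conjunct2, THEN conjunct1, THEN spec, THEN spec])
  show "I ps val m F = I ps val m G" if "\<And>k. k \<in> momenta ps val m \<Longrightarrow> F k = G k"
    by (rule D[THEN conjunct2, THEN conjunct2, THEN conjunct1, THEN spec, THEN spec, THEN mp]) (use that in blast)
qed

lemma loop_integration_0:
  assumes "loop_integration I" "is_pairing val m" "length ps \<le> length val" "\<forall>i<length ps. val ! i = 1"
  shows "I ps val m (\<lambda>_. 0) = 0"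
  using loop_integrationD(2)[OF assms, of 0 "\<lambda>_. 0"] by simp

lemma loop_integration_sum:
  assumes "loop_integration I" "is_pairing val m" "length ps \<le> length val" "\<forall>i<length ps. val ! i = 1" "finite A"
  shows "(\<Sum>x\<in>A. I ps val m (F x)) = I ps val m (\<lambda>k. \<Sum>x\<in>A. F x k)"
  using assms(5)
proof (induction A)
  case empty
  then show ?case using loop_integration_0[OF assms(1-4)] by simp
next
  case (insert x A)
  have "I ps val m (\<lambda>k. F x k + (\<Sum>x\<in>A. F x k)) = I ps val m (F x) + I ps val m (\<lambda>k. \<Sum>x\<in>A. F x k)"
    by (rule loop_integrationD(1)[OF assms(1-4)])
  then show ?case using insert by simp
qed

text \<open>For a fixed topology and external momenta the same linear functional serves all
  labellings, so their finite sum can be taken under the integration, where it vanishes at every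
  conserving configuration.\<close>

lemma loop_topology_contribution:
  assumes S0: "topological_invariant S0" and I: "loop_integration I"
    and topo: "(val, m) \<in> topologies S n N" "connected_topology val m" "loops val \<ge> 1" "length es = n"
  shows "(\<Sum>lab\<in>labellings (map fst es) val.
     I (map snd es) val m (integrand anticommuting (tym_action f g \<sigma> S0) n val m lab)) = 0"
proof -
  obtain vs where vs: "val = replicate n 1 @ vs" "\<forall>d\<in>set vs. 3 \<le> d" and pairing: "is_pairing val m"
    using topo(1) by (auto simp: topologies_def)
  have external: "\<forall>i<length (map snd es). val ! i = 1" and le: "length (map snd es) \<le> length val"
    using vs(1) topo(4) by (auto simp: nth_append)
  have fin: "finite (labellings (map fst es) val)"
    by (rule finite_subset[of _ "half_edges val \<rightarrow>\<^sub>E UNIV"]) (auto simp: labellings_def intro: finite_PiE)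
  have zero: "(\<Sum>lab\<in>labellings (map fst es) val. integrand anticommuting (tym_action f g \<sigma> S0) n val m lab k) = 0"
    if k: "k \<in> momenta (map snd es) val m" for k
  proof -
    interpret diagram f g \<sigma> S0 n val m "map fst es" "map snd es" k
    proof
      show "val ! v > 0" if "n \<le> v" "v < length val" for v
      proof -
        have "val ! v \<in> set vs" using that vs(1) by (auto simp: nth_append)
        then show ?thesis using vs(2) by force
      qed
    qed (use S0 pairing topo external le k in auto)
    show ?thesis using sum_amplitude by (simp add: amplitude_def)
  qed
  have "(\<Sum>lab\<in>labellings (map fst es) val.
     I (map snd es) val m (integrand anticommuting (tym_action f g \<sigma> S0) n val m lab))
     = I (map snd es) val m (\<lambda>k. \<Sum>lab\<in>labellings (map fst es) val. integrand anticommuting (tym_action f g \<sigma> S0) n val m lab k)"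
    by (rule loop_integration_sum[OF I pairing le external fin])
  also have "\<dots> = I (map snd es) val m (\<lambda>_. 0)"
    by (rule loop_integrationD(3)[OF I pairing le external zero])
  finally show ?thesis by (simp add: loop_integration_0[OF I pairing le external])
qed

theorem proposition3:
  fixes f :: "'a::finite \<Rightarrow> 'a \<Rightarrow> 'a \<Rightarrow> real"
    and g \<sigma> :: real
    and S0 :: "'a tym_field dpoly"
    and I :: integration
    and \<Phi> :: "('a tym_field \<times> momentum) list"
  assumes "semisimple_lie_algebra f"
    and "\<sigma> = 1 \<or> \<sigma> = -1"
    and "topological_invariant S0"
    and "loop_integration I"
  shows "tree_level_exact anticommuting (tym_action f g \<sigma> S0) I \<Phi>"
proof -
  let ?S = "tym_action f g \<sigma> S0"
  let ?T = "\<lambda>Ls N. {(val, m) \<in> topologies ?S (length \<Phi>) N. connected_topology val m \<and> loops val \<in> Ls}"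
  let ?F = "\<lambda>(val, m). \<Sum>lab\<in>labellings (map fst \<Phi>) val.
          I (map snd \<Phi>) val m (integrand anticommuting ?S (length \<Phi>) val m lab)"
  have zero: "?F t = 0" if "t \<in> ?T {1..} N" for t N
  proof (cases t)
    case (Pair val m)
    then have "(val, m) \<in> topologies ?S (length \<Phi>) N" "connected_topology val m" "1 \<le> loops val"
      using that by auto
    from loop_topology_contribution[OF assms(3,4) this refl, of f g \<sigma>] Pair show ?thesis by simp
  qed
  have "radiative_corrections anticommuting ?S I \<Phi> N = 0" for N
    unfolding radiative_corrections_def diagram_sum_def using zero by simp
  moreover have "connected_green anticommuting ?S I \<Phi> N = tree_green anticommuting ?S I \<Phi> N" for N
  proof -
    have "sum ?F (?T UNIV N) = sum ?F (?T {0} N)"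
    proof (rule sum.mono_neutral_right)
      \<comment> \<open>A sum over an infinite set would be 0 by convention and could not be split
        into trees and loops.\<close>
      show "finite (?T UNIV N)"
        by (rule finite_subset[OF _ finite_topologies[of ?S "length \<Phi>" N]]) auto
      show "\<forall>t\<in>?T UNIV N - ?T {0} N. ?F t = 0"
      proof
        fix t assume "t \<in> ?T UNIV N - ?T {0} N"
        then have "t \<in> ?T {1..} N" by auto
        then show "?F t = 0" by (rule zero)
      qed
    qed auto
    then show ?thesis
      unfolding connected_green_def tree_green_def diagram_sum_def by simp
  qed
  ultimately show ?thesis
    unfolding tree_level_exact_def by simp
qed

end
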